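(* Let $G$ be a second countable unimodular locally compact group, let $(\pi, \mathcal{H}_\pi)$ be a discrete series representation of $G$ of formal dimension $d_\pi>0$, and let $\Gamma\subset G$ be a lattice which is an ICC group. Then the following assertions hold: (i) If $\mathrm{vol}(G/\Gamma)\, d_\pi<1$, then there exists $g\in\mathcal{H}_\pi$ such that $\pi(\Gamma)g$ is a Parseval frame for $\mathcal{H}_\pi$, but $\pi(\Gamma)''$ does not admit a separating vector, and there is no $g\in\mathcal{H}_\pi$ such that $\pi(\Gamma)g$ is a Riesz sequence in $\mathcal{H}_\pi$. (ii) If $\mathrm{vol}(G/\Gamma)\, d_\pi=1$, then there exists $g\in\mathcal{H}_\pi$ such that $\pi(\Gamma)g$ is an orthonormal basis of $\mathcal{H}_\pi$. (iii) If $\mathrm{vol}(G/\Gamma)\, d_\pi>1$, then there exists $g\in\mathcal{H}_\pi$ such that $\pi(\Gamma)g$ is an orthonormal system in $\mathcal{H}_\pi$, but $\pi|_\Gamma$ does not admit a cyclic vector. (While $d_\pi$ and $\mathrm{vol}(G/\Gamma)$ depend on the normalization of the Haar measure on $G$, their product $\mathrm{vol}(G/\Gamma)\,d_\pi$ does not.)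
   Context: Fix a Haar measure $\mu_G$ on $G$. A unitary representation $(\pi,\mathcal{H}_\pi)$ of $G$ on a complex Hilbert space is a homomorphism $\pi$ from $G$ to the unitary group of $\mathcal{H}_\pi$ such that $x\mapsto\langle\pi(x)f,g\rangle$ is Borel for all $f,g\in\mathcal{H}_\pi$. It is irreducible if $\mathcal{H}_\pi\neq\{0\}$ and the only closed $\pi(G)$-invariant subspaces are $\{0\}$ and $\mathcal{H}_\pi$; it is square-integrable if there is a norm dense subspace $\mathcal{D}\subset\mathcal{H}_\pi$ such that $\langle f,\pi(\cdot)g\rangle\in L^2(G)$ for all $f\in\mathcal{H}_\pi$, $g\in\mathcal{D}$. A discrete series representation is an irreducible and square-integrable one. Hilbert spaces are complex and separable; inner products are linear in the first argument. Formal dimension: the unique number $d_\pi>0$ such that $\int_G\langle\pi(x)f_1,g_1\rangle\overline{\langle\pi(x)f_2,g_2\rangle}\,d\mu_G(x)=d_\pi^{-1}\langle f_1,f_2\rangle\overline{\langle g_1,g_2\rangle}$ for all $f_1,f_2,g_1,g_2\in\mathcal{H}_\pi$. Lattice: a discrete subgroup $\Gamma\subset G$ admitting a right fundamental domain of finite measure, i.e., a Borel set $\Omega\subset G$ with $\mu_G(\Omega)<\infty$, $G=\Omega\cdot\Gamma$ and $\Omega\gamma\cap\Omega\gamma'=\emptyset$ for distinct $\gamma,\gamma'\in\Gamma$. The co-volume is $\mathrm{vol}(G/\Gamma):=\mu_G(\Omega)$ (independent of $\Omega$). ICC: for every $\gamma_0\in\Gamma\setminus\{e\}$ the conjugacy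 class $\{\gamma\gamma_0\gamma^{-1}:\gamma\in\Gamma\}$ is infinite. For $g\in\mathcal{H}_\pi$, $\pi(\Gamma)g=(\pi(\gamma)g)_{\gamma\in\Gamma}$ is regarded as a family indexed by $\Gamma$ (repetitions allowed); "orthonormal system/basis" refers to this indexed family. It is a Parseval frame for $\mathcal{H}_\pi$ if $\|f\|^2=\sum_{\gamma\in\Gamma}|\langle f,\pi(\gamma)g\rangle|^2$ for all $f\in\mathcal{H}_\pi$. It is a Riesz sequence if there are $A,B>0$ with $A\|c\|_{\ell^2}^2\le\|\sum_{\gamma\in\Gamma}c_\gamma\pi(\gamma)g\|^2\le B\|c\|_{\ell^2}^2$ for all $c\in\ell^2(\Gamma)$. The vector $g$ is cyclic for $\pi|_\Gamma$ if the closed linear span of $\pi(\Gamma)g$ is $\mathcal{H}_\pi$. For $M\subset\mathcal{B}(\mathcal{H}_\pi)$, $M'$ is the commutant, $M''=(M')'$. A vector $g$ is separating for $\pi(\Gamma)''$ if $T\in\pi(\Gamma)''$ and $Tg=0$ imply $T=0$. *)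

theory Defs
  imports "HOL-Analysis.Analysis"
begin

section \<open>Complex Hilbert spaces\<close>

class complex_vector = real_vector +
  fixes scaleC :: "complex \<Rightarrow> 'a \<Rightarrow> 'a"  (infixr \<open>*\<^sub>C\<close> 75)
  assumes scaleC_add_right: "c *\<^sub>C (x + y) = c *\<^sub>C x + c *\<^sub>C y"
    and scaleC_add_left: "(c + d) *\<^sub>C x = c *\<^sub>C x + d *\<^sub>C x"
    and scaleC_scaleC: "c *\<^sub>C (d *\<^sub>C x) = (c * d) *\<^sub>C x"
    and scaleR_eq_scaleC: "r *\<^sub>R x = complex_of_real r *\<^sub>C x"

lemma scaleC_one: "1 *\<^sub>C x = (x :: 'a::complex_vector)"
  using scaleR_eq_scaleC[of 1 x] by simp

global_interpretation complex_vector: vector_space "scaleC :: complex \<Rightarrow> 'a \<Rightarrow> 'a::complex_vector"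
  defines csubspace = complex_vector.subspace
    and cspan = complex_vector.span
  by unfold_locales (simp_all add: scaleC_add_right scaleC_add_left scaleC_scaleC scaleC_one)

text \<open>
  The complex inner product is linear in the first argument. Its real part is the
  inner product of the underlying real inner product space, which therefore induces
  the same norm and topology.
\<close>

class complex_inner = complex_vector + real_inner +
  fixes cinner :: "'a \<Rightarrow> 'a \<Rightarrow> complex"
  assumes cinner_commute: "cinner x y = cnj (cinner y x)"
    and cinner_add_left: "cinner (x + y) z = cinner x z + cinner y z"
    and cinner_scaleC_left: "cinner (c *\<^sub>C x) y = c * cinner x y"
    and inner_eq_Re_cinner: "inner x y = Re (cinner x y)"

class complex_hilbert_space = complex_inner + complete_space

definition bounded_clinear :: "('a::complex_inner \<Rightarrow> 'b::complex_inner) \<Rightarrow> bool" where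
  "bounded_clinear T \<longleftrightarrow> bounded_linear T \<and> (\<forall>c x. T (c *\<^sub>C x) = c *\<^sub>C T x)"

definition unitary :: "('a::complex_inner \<Rightarrow> 'a) \<Rightarrow> bool" where
  "unitary U \<longleftrightarrow> bounded_clinear U \<and> surj U \<and> (\<forall>x y. cinner (U x) (U y) = cinner x y)"

definition commutant :: "('a::complex_inner \<Rightarrow> 'a) set \<Rightarrow> ('a \<Rightarrow> 'a) set" where
  "commutant M = {T. bounded_clinear T \<and> (\<forall>S\<in>M. T \<circ> S = S \<circ> T)}"

definition separating_vector :: "('a::complex_inner \<Rightarrow> 'a) set \<Rightarrow> 'a \<Rightarrow> bool" where
  "separating_vector M g \<longleftrightarrow> (\<forall>T\<in>M. T g = 0 \<longrightarrow> T = (\<lambda>_. 0))"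


section \<open>Indexed families of vectors\<close>

definition parseval_frame :: "'i set \<Rightarrow> ('i \<Rightarrow> 'a::complex_inner) \<Rightarrow> bool" where
  "parseval_frame I e \<longleftrightarrow>
     (\<forall>f. ((\<lambda>i. (cmod (cinner f (e i)))\<^sup>2) has_sum (norm f)\<^sup>2) I)"

definition riesz_sequence :: "'i set \<Rightarrow> ('i \<Rightarrow> 'a::complex_inner) \<Rightarrow> bool" where
  "riesz_sequence I e \<longleftrightarrow>
     (\<exists>A>0. \<exists>B>0. \<forall>c::'i \<Rightarrow> complex. (\<lambda>i. (cmod (c i))\<^sup>2) summable_on I \<longrightarrow>
        (\<lambda>i. c i *\<^sub>C e i) summable_on I \<and>
        A * (\<Sum>\<^sub>\<infinity>i\<in>I. (cmod (c i))\<^sup>2) \<le> (norm (\<Sum>\<^sub>\<infinity>i\<in>I. c i *\<^sub>C e i))\<^sup>2 \<and>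
        (norm (\<Sum>\<^sub>\<infinity>i\<in>I. c i *\<^sub>C e i))\<^sup>2 \<le> B * (\<Sum>\<^sub>\<infinity>i\<in>I. (cmod (c i))\<^sup>2))"

definition orthonormal_system :: "'i set \<Rightarrow> ('i \<Rightarrow> 'a::complex_inner) \<Rightarrow> bool" where
  "orthonormal_system I e \<longleftrightarrow>
     (\<forall>i\<in>I. \<forall>j\<in>I. cinner (e i) (e j) = (if i = j then 1 else 0))"

definition total_family :: "'i set \<Rightarrow> ('i \<Rightarrow> 'a::complex_inner) \<Rightarrow> bool" where
  "total_family I e \<longleftrightarrow> closure (cspan (e ` I)) = UNIV"

definition orthonormal_basis :: "'i set \<Rightarrow> ('i \<Rightarrow> 'a::complex_inner) \<Rightarrow> bool" where
  "orthonormal_basis I e \<longleftrightarrow> orthonormal_system I e \<and> total_family I e"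


section \<open>Haar measure and lattices\<close>

text \<open>
  Groups are written additively, following the library class
  \<^class>\<open>topological_group_add\<close>, but they are not assumed to be commutative:
  \<open>x + y\<close> is the product \<open>xy\<close>, \<open>0\<close> the identity and \<open>- x\<close> the inverse.
\<close>

definition radon_measure :: "'g::topological_space measure \<Rightarrow> bool" where
  "radon_measure \<mu> \<longleftrightarrow> sets \<mu> = sets borel \<and>
     (\<forall>K. compact K \<longrightarrow> emeasure \<mu> K < \<infinity>) \<and>
     (\<forall>A\<in>sets borel. emeasure \<mu> A = (INF U\<in>{U. open U \<and> A \<subseteq> U}. emeasure \<mu> U)) \<and>
     (\<forall>U. open U \<longrightarrow> emeasure \<mu> U = (SUP K\<in>{K. compact K \<and> K \<subseteq> U}. emeasure \<mu> K))"

definition haar_measure :: "'g::topological_group_add measure \<Rightarrow> bool" where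
  "haar_measure \<mu> \<longleftrightarrow> radon_measure \<mu> \<and> emeasure \<mu> UNIV \<noteq> 0 \<and>
     (\<forall>a. \<forall>A\<in>sets borel. emeasure \<mu> ((\<lambda>x. a + x) ` A) = emeasure \<mu> A)"

text \<open>By default Haar measures are left Haar measures.\<close>

definition unimodular :: "'g::topological_group_add itself \<Rightarrow> bool" where
  "unimodular _ \<longleftrightarrow> (\<forall>\<mu>::'g measure. haar_measure \<mu> \<longrightarrow>
     (\<forall>a. \<forall>A\<in>sets borel. emeasure \<mu> ((\<lambda>x. x + a) ` A) = emeasure \<mu> A))"

definition is_subgroup :: "'g::group_add set \<Rightarrow> bool" where
  "is_subgroup \<Gamma> \<longleftrightarrow> 0 \<in> \<Gamma> \<and> (\<forall>x\<in>\<Gamma>. \<forall>y\<in>\<Gamma>. x + y \<in> \<Gamma>) \<and> (\<forall>x\<in>\<Gamma>. - x \<in> \<Gamma>)"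

definition right_fundamental_domain ::
    "'g::topological_group_add measure \<Rightarrow> 'g set \<Rightarrow> 'g set \<Rightarrow> bool" where
  "right_fundamental_domain \<mu> \<Gamma> \<Omega> \<longleftrightarrow>
     \<Omega> \<in> sets borel \<and> emeasure \<mu> \<Omega> < \<infinity> \<and>
     (\<Union>\<gamma>\<in>\<Gamma>. (\<lambda>x. x + \<gamma>) ` \<Omega>) = UNIV \<and>
     (\<forall>\<gamma>\<in>\<Gamma>. \<forall>\<gamma>'\<in>\<Gamma>. \<gamma> \<noteq> \<gamma>' \<longrightarrow> (\<lambda>x. x + \<gamma>) ` \<Omega> \<inter> (\<lambda>x. x + \<gamma>') ` \<Omega> = {})"

definition lattice_subgroup :: "'g::topological_group_add measure \<Rightarrow> 'g set \<Rightarrow> bool" where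
  "lattice_subgroup \<mu> \<Gamma> \<longleftrightarrow>
     is_subgroup \<Gamma> \<and> discrete \<Gamma> \<and> (\<exists>\<Omega>. right_fundamental_domain \<mu> \<Gamma> \<Omega>)"

text \<open>For unimodular groups the value does not depend on the choice of the domain.\<close>

definition covolume :: "'g::topological_group_add measure \<Rightarrow> 'g set \<Rightarrow> real" where
  "covolume \<mu> \<Gamma> = measure \<mu> (SOME \<Omega>. right_fundamental_domain \<mu> \<Gamma> \<Omega>)"

definition icc :: "'g::group_add set \<Rightarrow> bool" where
  "icc \<Gamma> \<longleftrightarrow> (\<forall>\<gamma>\<^sub>0\<in>\<Gamma> - {0}. infinite {\<gamma> + \<gamma>\<^sub>0 + - \<gamma> | \<gamma>. \<gamma> \<in> \<Gamma>})"


section \<open>Unitary representations\<close>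

definition unitary_rep :: "('g::topological_group_add \<Rightarrow> 'h::complex_hilbert_space \<Rightarrow> 'h) \<Rightarrow> bool"
  where
  "unitary_rep \<pi> \<longleftrightarrow>
     (\<forall>x. unitary (\<pi> x)) \<and> (\<forall>x y. \<pi> (x + y) = \<pi> x \<circ> \<pi> y) \<and>
     (\<forall>f g. (\<lambda>x. cinner (\<pi> x f) g) \<in> borel_measurable borel)"

definition irreducible_rep ::
    "('g::topological_group_add \<Rightarrow> 'h::complex_hilbert_space \<Rightarrow> 'h) \<Rightarrow> bool" where
  "irreducible_rep \<pi> \<longleftrightarrow>
     (UNIV :: 'h set) \<noteq> {0} \<and>
     (\<forall>V. csubspace V \<and> closed V \<and> (\<forall>x. \<pi> x ` V \<subseteq> V) \<longrightarrow> V = {0} \<or> V = UNIV)"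

definition square_integrable :: "'g measure \<Rightarrow> ('g \<Rightarrow> complex) \<Rightarrow> bool" where
  "square_integrable \<mu> F \<longleftrightarrow>
     F \<in> borel_measurable \<mu> \<and> integrable \<mu> (\<lambda>x. (cmod (F x))\<^sup>2)"

definition square_integrable_rep ::
    "'g::topological_group_add measure \<Rightarrow> ('g \<Rightarrow> 'h::complex_hilbert_space \<Rightarrow> 'h) \<Rightarrow> bool" where
  "square_integrable_rep \<mu> \<pi> \<longleftrightarrow>
     (\<exists>D. csubspace D \<and> closure D = UNIV \<and>
        (\<forall>f. \<forall>g\<in>D. square_integrable \<mu> (\<lambda>x. cinner f (\<pi> x g))))"

definition discrete_series ::
    "'g::topological_group_add measure \<Rightarrow> ('g \<Rightarrow> 'h::complex_hilbert_space \<Rightarrow> 'h) \<Rightarrow> bool" where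
  "discrete_series \<mu> \<pi> \<longleftrightarrow>
     unitary_rep \<pi> \<and> irreducible_rep \<pi> \<and> square_integrable_rep \<mu> \<pi>"

definition formal_dimension ::
    "'g::topological_group_add measure \<Rightarrow> ('g \<Rightarrow> 'h::complex_hilbert_space \<Rightarrow> 'h) \<Rightarrow> real" where
  "formal_dimension \<mu> \<pi> = (THE d. d > 0 \<and>
     (\<forall>f\<^sub>1 f\<^sub>2 g\<^sub>1 g\<^sub>2.
        (\<integral>x. cinner (\<pi> x f\<^sub>1) g\<^sub>1 * cnj (cinner (\<pi> x f\<^sub>2) g\<^sub>2) \<partial>\<mu>) =
        complex_of_real (inverse d) * cinner f\<^sub>1 f\<^sub>2 * cnj (cinner g\<^sub>1 g\<^sub>2)))"

end

theory Submission
  imports Defs "HOL-Library.Diagonal_Subsequence"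
begin

text \<open>
  Write \<open>C\<^sub>u f = (\<langle>f, \<pi>(\<gamma>) u\<rangle>)\<^sub>\<gamma>\<close>, let \<open>\<Omega>\<close> be a fundamental domain and put \<open>c = 1 / d\<^sub>\<pi>\<close>. Unfolding the
  orthogonality relations over \<open>G = \<Omega> \<cdot> \<Gamma>\<close> gives
  \<open>\<integral>\<^sub>\<Omega> \<parallel>C\<^sub>u \<pi>(\<omega>)\<^sup>* h\<parallel>\<^sup>2 d\<omega> = c \<parallel>h\<parallel>\<^sup>2 \<parallel>u\<parallel>\<^sup>2\<close>, so averaging over \<open>\<Omega>\<close> is a trace on the commutant of
  \<open>\<pi>(\<Gamma>)\<close> which takes the value \<open>c \<parallel>u\<parallel>\<^sup>2\<close> at \<open>C\<^sub>u\<^sup>* C\<^sub>u\<close> and the value \<open>vol(\<Omega>)\<close> at the identity.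
  Comparing the two values decides which of the systems in the theorem can exist.

  Existence comes from an extreme point \<open>x\<close> of the weakly compact convex set of vectors with
  \<open>C\<^sub>x\<^sup>* C\<^sub>x \<le> 1\<close>: as in the description of the extreme points of the unit ball of a factor, \<open>C\<^sub>x\<close> is a
  partial isometry, and the ICC property forces it to be an isometry (Parseval frame) or \<open>\<pi>(\<Gamma>)x\<close> to
  be orthonormal. For the converse directions an arbitrary vector \<open>g\<close> is replaced by the Bessel
  vector \<open>(1 + C\<^sub>g\<^sup>* C\<^sub>g)\<^sup>-\<^sup>1 g\<close>, which is again cyclic or separating if \<open>g\<close> is, and for a Bessel vector \<open>v\<close>
  the traces of \<open>s C\<^sub>v\<^sup>* C\<^sub>v (1 + s C\<^sub>v\<^sup>* C\<^sub>v)\<^sup>-\<^sup>1\<close> and \<open>s C\<^sub>v C\<^sub>v\<^sup>* (1 + s C\<^sub>v C\<^sub>v\<^sup>*)\<^sup>-\<^sup>1\<close> are compared as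
  \<open>s \<rightarrow> \<infinity>\<close>. The inverses are obtained by minimising quadratic forms, which together with
  a square root by power series also yields the instance of Schur's lemma that is needed for the
  formal dimension.
\<close>

section \<open>Complex Hilbert spaces\<close>

text \<open>In the theorem the covolume times the formal dimension is vol(\<Omega>) / c, so the
  three cases compare vol(\<Omega>), the trace of the identity of the representation space, with c,
  the weight that the same normalisation gives to the identity of
  \<open>\<ell>\<^sup>2(\<Gamma>)\<close>. What remains of the theory of von Neumann algebras is the
  formula that the trace of \<open>C_v^* C_u\<close> is c \<langle>u, v\<rangle>: since \<langle>u,
  v\<rangle> is the coefficient of \<open>C_v u\<close> at the identity of \<Gamma>, one number is
  read on both spaces. Factoriality is replaced by a single averaging statement,
  \<open>icc_average\<close>, the only place where the ICC property acts. The main obstacle is that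
  \<open>C_g\<close> may be unbounded for a general vector g. Resolvents of \<open>C_g^* C_g\<close>
  are still available, because the variational problem behind them only asks for closedness, which
  is Fatou's lemma. The same resolvent with G in place of \<Gamma> yields the orthogonality
  relations, and averages over \<Omega> supply a dense set of vectors g with bounded
  \<open>C_g\<close>.\<close>

lemma cinner_add_right: "cinner x (y + z) = cinner x y + cinner x (z :: 'a::complex_inner)"
  by (metis cinner_commute cinner_add_left complex_cnj_add)

lemma cinner_scaleC_right: "cinner x (c *\<^sub>C y) = cnj c * cinner x (y :: 'a::complex_inner)"
  by (metis cinner_commute cinner_scaleC_left complex_cnj_mult)

lemma cinner_scaleR_left: "cinner (r *\<^sub>R x) y = r * cinner x (y :: 'a::complex_inner)"
  by (simp add: scaleR_eq_scaleC cinner_scaleC_left)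

lemma cinner_scaleR_right: "cinner x (r *\<^sub>R y) = r * cinner x (y :: 'a::complex_inner)"
  by (simp add: scaleR_eq_scaleC cinner_scaleC_right)

lemma cinner_minus_left [simp]: "cinner (- x) y = - cinner x (y :: 'a::complex_inner)"
  using cinner_scaleR_left[of "-1" x y] by simp

lemma cinner_minus_right [simp]: "cinner x (- y) = - cinner x (y :: 'a::complex_inner)"
  using cinner_scaleR_right[of x "-1" y] by simp

lemma cinner_zero_left [simp]: "cinner 0 (y :: 'a::complex_inner) = 0"
  using cinner_scaleR_left[of 0 y y] by simp

lemma cinner_zero_right [simp]: "cinner (y :: 'a::complex_inner) 0 = 0"
  using cinner_scaleR_right[of y 0 y] by simp

lemma cinner_diff_left: "cinner (x - y) z = cinner x z - cinner y (z :: 'a::complex_inner)"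
  using cinner_add_left[of x "- y" z] by simp

lemma cinner_diff_right: "cinner x (y - z) = cinner x y - cinner x (z :: 'a::complex_inner)"
  using cinner_add_right[of x y "- z"] by simp

lemmas cinner_simps = cinner_add_left cinner_add_right cinner_diff_left cinner_diff_right
  cinner_scaleC_left cinner_scaleC_right cinner_scaleR_left cinner_scaleR_right

lemma cinner_self: "cinner x x = complex_of_real ((norm (x :: 'a::complex_inner))\<^sup>2)"
proof -
  have "Im (cinner x x) = 0"
    using cinner_commute[of x x] by (metis Reals_cnj_iff complex_is_Real_iff)
  moreover have "Re (cinner x x) = (norm x)\<^sup>2"
    by (metis inner_eq_Re_cinner power2_norm_eq_inner)
  ultimately show ?thesis by (simp add: complex_eq_iff)
qed

lemma cinner_self_eq_0 [simp]: "cinner x x = 0 \<longleftrightarrow> x = (0 :: 'a::complex_inner)"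
  by (simp add: cinner_self)

lemma cinner_eq_0_commute: "cinner x y = 0 \<longleftrightarrow> cinner y (x :: 'a::complex_inner) = 0"
  by (metis cinner_commute complex_cnj_zero)

lemma cmod_cinner_commute: "cmod (cinner x y) = cmod (cinner y (x :: 'a::complex_inner))"
  by (metis cinner_commute complex_mod_cnj)

lemma Re_cinner_commute: "Re (cinner x y) = Re (cinner y (x :: 'a::complex_inner))"
  by (metis inner_commute inner_eq_Re_cinner)

lemma cinner_ext: "(\<And>z. cinner x z = cinner y z) \<Longrightarrow> x = (y :: 'a::complex_inner)"
  by (metis cinner_diff_left cinner_self_eq_0 eq_iff_diff_eq_0)

lemma norm_scaleC: "norm (c *\<^sub>C x) = cmod c * norm (x :: 'a::complex_inner)"
proof -
  have "complex_of_real ((norm (c *\<^sub>C x))\<^sup>2) = (c * cnj c) * complex_of_real ((norm x)\<^sup>2)"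
    unfolding cinner_self[symmetric] by (simp add: cinner_simps)
  also have "\<dots> = complex_of_real ((cmod c * norm x)\<^sup>2)"
    unfolding complex_norm_square[symmetric] by (simp add: power_mult_distrib)
  finally have "complex_of_real ((norm (c *\<^sub>C x))\<^sup>2) = complex_of_real ((cmod c * norm x)\<^sup>2)" .
  then show ?thesis
    by (metis mult_nonneg_nonneg norm_ge_zero of_real_eq_iff power2_eq_imp_eq)
qed

lemma Cauchy_Schwarz_cinner: "cmod (cinner x y) \<le> norm x * norm (y :: 'a::complex_inner)"
proof (cases "cinner x y = 0")
  case False
  \<comment> \<open>A phase of modulus one that makes \<open>cinner (c *\<^sub>C x) y\<close> real
    and nonnegative, so that the inequality for the real inner product applies.\<close>
  define c where "c = cnj (cinner x y) / cmod (cinner x y)"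
  have "cmod c = 1" using False by (simp add: c_def norm_divide)
  have "c * cinner x y = cmod (cinner x y)"
    using False unfolding c_def by (simp add: field_simps complex_norm_square[symmetric] power2_eq_square)
  then have "cmod (cinner x y) = Re (cinner (c *\<^sub>C x) y)"
    by (simp add: cinner_simps)
  also have "\<dots> \<le> norm (c *\<^sub>C x) * norm y"
    by (metis inner_eq_Re_cinner norm_cauchy_schwarz)
  finally show ?thesis by (simp add: norm_scaleC \<open>cmod c = 1\<close>)
qed simp

lemma bounded_bilinear_cinner: "bounded_bilinear (cinner :: 'a::complex_inner \<Rightarrow> 'a \<Rightarrow> complex)"
  by (unfold_locales)
     (auto simp: cinner_simps scaleR_conv_of_real intro!: exI[of _ 1] Cauchy_Schwarz_cinner)

lemmas tendsto_cinner = bounded_bilinear.tendsto[OF bounded_bilinear_cinner]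

lemma csubspace_0: "csubspace V \<Longrightarrow> 0 \<in> V"
  and csubspace_add: "csubspace V \<Longrightarrow> x \<in> V \<Longrightarrow> y \<in> V \<Longrightarrow> x + y \<in> V"
  and csubspace_scale: "csubspace V \<Longrightarrow> x \<in> V \<Longrightarrow> c *\<^sub>C x \<in> V"
  by (auto simp: complex_vector.subspace_def)

lemma csubspace_scaleR: "csubspace V \<Longrightarrow> x \<in> V \<Longrightarrow> r *\<^sub>R x \<in> V"
  by (simp add: scaleR_eq_scaleC csubspace_scale)

lemma csubspace_diff: "csubspace V \<Longrightarrow> x \<in> V \<Longrightarrow> y \<in> V \<Longrightarrow> x - (y::'a::complex_vector) \<in> V"
  using csubspace_add[of V x "(-1) *\<^sub>R y"] csubspace_scaleR[of V y "-1"] by simp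

lemma norm_add_sq:
  "(norm (x + y))\<^sup>2 = (norm x)\<^sup>2 + (norm y)\<^sup>2 + 2 * Re (cinner x (y::'a::complex_inner))"
  by (simp add: inner_eq_Re_cinner[symmetric] power2_norm_eq_inner algebra_simps inner_commute)

text \<open>Minimising \<open>Re (Q m m) - 2 Re (\<phi> m)\<close> makes the completeness of the form domain
  under the form norm unnecessary: lower semicontinuity of the form suffices.\<close>

lemma form_representation:
  fixes Q :: "'h::complex_hilbert_space \<Rightarrow> 'h \<Rightarrow> complex" and \<phi> :: "'h \<Rightarrow> complex"
  assumes V: "csubspace V"
    and Q_add: "\<And>x y z. x \<in> V \<Longrightarrow> y \<in> V \<Longrightarrow> z \<in> V \<Longrightarrow> Q (x + y) z = Q x z + Q y z"
    and Q_scale: "\<And>c x y. x \<in> V \<Longrightarrow> y \<in> V \<Longrightarrow> Q (c *\<^sub>C x) y = c * Q x y"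
    and Q_cnj: "\<And>x y. Q y x = cnj (Q x y)"
    and Q_ge: "\<And>x. x \<in> V \<Longrightarrow> (norm x)\<^sup>2 \<le> Re (Q x x)"
    and Q_closed: "\<And>X x L. (\<And>n. X n \<in> V) \<Longrightarrow> X \<longlonglongrightarrow> x \<Longrightarrow>
        (\<lambda>n. Re (Q (X n) (X n))) \<longlonglongrightarrow> L \<Longrightarrow> x \<in> V \<and> Re (Q x x) \<le> L"
    and \<phi>: "bounded_linear \<phi>" and \<phi>_scale: "\<And>c x. \<phi> (c *\<^sub>C x) = cnj c * \<phi> x"
  shows "\<exists>k\<in>V. \<forall>m\<in>V. Q k m = \<phi> m"
proof -
  interpret \<phi>: bounded_linear \<phi> by fact
  obtain C where C: "\<And>x. cmod (\<phi> x) \<le> norm x * C" using \<phi>.bounded by blast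
  have Q_add': "Q x (y + z) = Q x y + Q x z" if "x \<in> V" "y \<in> V" "z \<in> V" for x y z
    using Q_add[of y z x] that by (metis Q_cnj complex_cnj_add)
  have Q_scale': "Q x (c *\<^sub>C y) = cnj c * Q x y" if "x \<in> V" "y \<in> V" for x y c
    using Q_scale[of y x c] that by (metis Q_cnj complex_cnj_mult)
  define J where "J m = Re (Q m m) - 2 * Re (\<phi> m)" for m
  have J_add: "J (x + y) = J x + Re (Q y y) + 2 * Re (Q x y) - 2 * Re (\<phi> y)"
    if "x \<in> V" "y \<in> V" for x y
  proof -
    have "Q (x + y) (x + y) = Q x x + Q y y + (Q x y + Q y x)"
      using that V by (simp add: Q_add Q_add' csubspace_add)
    also have "Q y x = cnj (Q x y)" by (rule Q_cnj)
    finally show ?thesis by (simp add: J_def \<phi>.add)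
  qed
  have J_ge: "J m \<ge> - (C\<^sup>2)" if "m \<in> V" for m
  proof -
    have "J m \<ge> (norm m)\<^sup>2 - 2 * (norm m * C)"
      unfolding J_def using Q_ge[OF that] C[of m] abs_Re_le_cmod[of "\<phi> m"] by linarith
    moreover have "(norm m - C)\<^sup>2 \<ge> 0" by simp
    ultimately show ?thesis by (simp add: power2_diff)
  qed
  define j where "j = Inf (J ` V)"
  have bdd: "bdd_below (J ` V)" using J_ge by (auto simp: bdd_below_def)
  have j_le: "j \<le> J m" if "m \<in> V" for m
    unfolding j_def using bdd that by (simp add: cINF_lower)
  have "\<exists>x\<in>V. J x < j + 1 / real (Suc n)" for n
  proof -
    have "Inf (J ` V) < j + 1 / real (Suc n)" by (simp add: j_def)
    then show ?thesis using cInf_less_iff[of "J ` V"] bdd csubspace_0[OF V] by auto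
  qed
  then obtain X where X: "\<And>n. X n \<in> V" "\<And>n. J (X n) < j + 1 / real (Suc n)"
    by metis
  \<comment> \<open>The linear term of \<open>J\<close> is additive, so the parallelogram law of the
    form gives J x + J y = 2 J a + 2 Re Q(d, d) for the midpoint \<open>a\<close> and the half
    difference \<open>d\<close>; moreover \<open>J a\<close> is at least \<open>j\<close>.\<close>
  have para: "(norm (x - y))\<^sup>2 \<le> 2 * (J x + J y - 2 * j)" if "x \<in> V" "y \<in> V" for x y
  proof -
    define d where "d = (1/2) *\<^sub>R (x - y)"
    define a where "a = (1/2) *\<^sub>R (x + y)"
    have in_V: "d \<in> V" "a \<in> V"
      using that V by (auto simp: d_def a_def intro!: csubspace_scaleR csubspace_diff csubspace_add)
    define e where "e = (-1) *\<^sub>C d"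
    have e: "e \<in> V" using in_V V by (simp only: e_def csubspace_scale)
    have xy: "x = a + d" "y = a + e"
      using scaleR_eq_scaleC[of "-1" d]
      by (simp_all add: a_def d_def e_def algebra_simps flip: scaleR_add_left)
    have "Q e e = Q d d" "Q a e = - Q a d" "\<phi> e = - \<phi> d"
      unfolding e_def using Q_scale[of d "(-1) *\<^sub>C d" "-1"] Q_scale'[of d d "-1"]
        Q_scale'[of a d "-1"] \<phi>_scale[of "-1" d] in_V e e_def by auto
    then have "J x + J y = 2 * J a + 2 * Re (Q d d)"
      using in_V e unfolding xy by (simp add: J_add)
    moreover have "(norm (x - y))\<^sup>2 = 4 * (norm d)\<^sup>2" by (simp add: d_def power_divide)
    ultimately show ?thesis using j_le[of a] Q_ge[of d] in_V by simp
  qed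
  have J_lim: "(\<lambda>n. J (X n)) \<longlonglongrightarrow> j"
  proof (rule tendsto_sandwich)
    show "\<forall>\<^sub>F n in sequentially. j \<le> J (X n)" using j_le X by simp
    show "\<forall>\<^sub>F n in sequentially. J (X n) \<le> j + 1 / real (Suc n)"
      using X by (simp add: less_imp_le)
    show "(\<lambda>n. j + 1 / real (Suc n)) \<longlonglongrightarrow> j"
      using tendsto_add[OF tendsto_const LIMSEQ_inverse_real_of_nat, of j] by (simp add: inverse_eq_divide)
  qed simp
  have "Cauchy X"
  proof (rule metric_CauchyI)
    fix e :: real assume "e > 0"
    then obtain N where N: "\<And>n. n \<ge> N \<Longrightarrow> 1 / real (Suc n) < e\<^sup>2 / 4"
      using LIMSEQ_D[OF LIMSEQ_inverse_real_of_nat, of "e\<^sup>2/4"]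
      by (auto simp: inverse_eq_divide)
    have "dist (X m) (X n) < e" if "m \<ge> N" "n \<ge> N" for m n
    proof -
      have "J (X m) < j + e\<^sup>2 / 4" "J (X n) < j + e\<^sup>2 / 4"
        using X(2)[of m] N[OF that(1)] X(2)[of n] N[OF that(2)]
        by (meson add_strict_left_mono order_less_trans)+
      then have "(norm (X m - X n))\<^sup>2 < e\<^sup>2"
        using para[OF X(1) X(1), of m n] by argo
      then show ?thesis using \<open>e > 0\<close> by (simp add: dist_norm power2_less_imp_less)
    qed
    then show "\<exists>N. \<forall>m\<ge>N. \<forall>n\<ge>N. dist (X m) (X n) < e" by blast
  qed
  then obtain k where k: "X \<longlonglongrightarrow> k" using Cauchy_convergent convergent_def by blast
  \<comment> \<open>\<open>J (X n)\<close> converges and \<phi> is continuous, so the values of the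
    form converge, as \<open>Q_closed\<close> demands.\<close>
  have "(\<lambda>n. J (X n) + 2 * Re (\<phi> (X n))) \<longlonglongrightarrow> j + 2 * Re (\<phi> k)"
    by (intro tendsto_intros J_lim \<phi>.tendsto k)
  then have "(\<lambda>n. Re (Q (X n) (X n))) \<longlonglongrightarrow> j + 2 * Re (\<phi> k)" by (simp add: J_def)
  from Q_closed[OF X(1) k this] have kV: "k \<in> V" and Jk: "J k \<le> j" by (auto simp: J_def)
  have "Q k m = \<phi> m" if "m \<in> V" for m
  proof (rule ccontr)
    assume neq: "Q k m \<noteq> \<phi> m"
    define z where "z = Q k m - \<phi> m"
    define q where "q = Re (Q m m)"
    have "z \<noteq> 0" using neq by (simp add: z_def)
    have ineq: "2 * t * (cmod z)\<^sup>2 \<le> t\<^sup>2 * (cmod z)\<^sup>2 * q" for t :: real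
    proof -
      \<comment> \<open>A step of length t in the descent direction -z: its linear contribution is
        -2t|z|^2, its quadratic one t^2|z|^2 q. For the later choice t = 1 / (q + 1) the product t q
        stays below 1, while minimality would force it to be at least 2.\<close>
      define c where "c = - (complex_of_real t * z)"
      have zz: "z * cnj z = complex_of_real ((cmod z)\<^sup>2)" by (rule complex_norm_square[symmetric])
      have "J (k + c *\<^sub>C m) \<ge> J k"
        using j_le[of "k + c *\<^sub>C m"] Jk kV that V by (simp add: csubspace_add csubspace_scale)
      then have "Re (Q (c *\<^sub>C m) (c *\<^sub>C m)) + 2 * Re (Q k (c *\<^sub>C m) - \<phi> (c *\<^sub>C m)) \<ge> 0"
        using J_add[OF kV, of "c *\<^sub>C m"] that V by (simp add: csubspace_scale)
      moreover have "Q k (c *\<^sub>C m) - \<phi> (c *\<^sub>C m) = cnj c * z"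
        using kV that by (simp add: Q_scale' \<phi>_scale z_def algebra_simps)
      moreover have "cnj c * z = - complex_of_real (t * (cmod z)\<^sup>2)"
        using zz by (simp add: c_def mult.assoc mult.commute[of "cnj z"])
      moreover have "Q (c *\<^sub>C m) (c *\<^sub>C m) = complex_of_real (t\<^sup>2 * (cmod z)\<^sup>2) * Q m m"
      proof -
        have "Q (c *\<^sub>C m) (c *\<^sub>C m) = (c * cnj c) * Q m m"
          using that V by (simp add: Q_scale Q_scale' csubspace_scale)
        also have "c * cnj c = complex_of_real (t\<^sup>2 * (cmod z)\<^sup>2)"
        proof -
          have "c * cnj c = complex_of_real (t\<^sup>2) * (z * cnj z)"
            by (simp add: c_def power2_eq_square)
          then show ?thesis unfolding zz by simp
        qed
        finally show ?thesis .
      qed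
      ultimately have "0 \<le> t\<^sup>2 * (cmod z)\<^sup>2 * q - 2 * t * (cmod z)\<^sup>2"
        by (simp only: Re_complex_of_real uminus_complex.sel q_def times_complex.sel Im_complex_of_real)
      then show ?thesis by simp
    qed
    have "q \<ge> 0" using Q_ge[OF that] zero_le_power2[of "norm m"] unfolding q_def by linarith
    define t where "t = 1 / (q + 1)"
    have t: "t > 0" "t * q < 1" using \<open>q \<ge> 0\<close> by (auto simp: t_def field_simps)
    have "2 * (t * (cmod z)\<^sup>2) \<le> (t * q) * (t * (cmod z)\<^sup>2)"
      using ineq[of t] by (simp add: power2_eq_square algebra_simps)
    moreover have "t * (cmod z)\<^sup>2 > 0" using t \<open>z \<noteq> 0\<close> by simp
    ultimately have "2 \<le> t * q"
      by (metis mult_le_cancel_right_pos mult.assoc)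
    then show False using t by simp
  qed
  then show ?thesis using kV by blast
qed

lemma orthogonal_projection_exists:
  fixes V :: "'h::complex_hilbert_space set"
  assumes "csubspace V" "closed V"
  shows "\<exists>k\<in>V. \<forall>m\<in>V. cinner k m = cinner f m"
proof (rule form_representation)
  show "x \<in> V \<and> Re (cinner x x) \<le> L"
    if "\<And>n. X n \<in> V" "X \<longlonglongrightarrow> x" "(\<lambda>n. Re (cinner (X n) (X n))) \<longlonglongrightarrow> L" for X x L
  proof
    show "x \<in> V" using that assms(2) closed_sequentially by blast
    have "(\<lambda>n. Re (cinner (X n) (X n))) \<longlonglongrightarrow> Re (cinner x x)"
      by (intro tendsto_intros tendsto_cinner that)
    then show "Re (cinner x x) \<le> L" using that LIMSEQ_unique by blast
  qed
  show "cinner y x = cnj (cinner x y)" for x y :: 'h by (rule cinner_commute)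
qed (use assms in \<open>auto simp: cinner_simps cinner_self
      intro: bounded_bilinear.bounded_linear_right[OF bounded_bilinear_cinner]\<close>)

lemma riesz_representation:
  fixes \<phi> :: "'h::complex_hilbert_space \<Rightarrow> complex"
  assumes "bounded_linear \<phi>" "\<And>c x. \<phi> (c *\<^sub>C x) = cnj c * \<phi> x"
  shows "\<exists>k. \<forall>m. cinner k m = \<phi> m"
proof -
  have "\<exists>k\<in>UNIV. \<forall>m\<in>UNIV. cinner k m = \<phi> m"
  proof (rule form_representation)
    show "x \<in> UNIV \<and> Re (cinner x x) \<le> L"
      if "X \<longlonglongrightarrow> x" "(\<lambda>n. Re (cinner (X n) (X n))) \<longlonglongrightarrow> L" for X and x :: 'h and L
    proof -
      have "(\<lambda>n. Re (cinner (X n) (X n))) \<longlonglongrightarrow> Re (cinner x x)"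
        by (intro tendsto_intros tendsto_cinner that)
      then show ?thesis using that LIMSEQ_unique by blast
    qed
    show "cinner y x = cnj (cinner x y)" for x y :: 'h by (rule cinner_commute)
  qed (use assms in \<open>auto simp: cinner_simps cinner_self\<close>)
  then show ?thesis by blast
qed

lemma riesz_representation_bound:
  fixes \<phi> :: "'h::complex_hilbert_space \<Rightarrow> complex"
  assumes "\<And>x y. \<phi> (x + y) = \<phi> x + \<phi> y" "\<And>c x. \<phi> (c *\<^sub>C x) = cnj c * \<phi> x"
    and "\<And>x. cmod (\<phi> x) \<le> C * norm x"
  shows "\<exists>k. \<forall>m. cinner k m = \<phi> m"
proof (rule riesz_representation)
  show "bounded_linear \<phi>"
    by (rule bounded_linear_intro[of _ C])
       (use assms in \<open>auto simp: scaleR_eq_scaleC scaleR_conv_of_real mult.commute\<close>)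
qed (use assms in auto)

lemma bounded_linear_scaleC: "bounded_linear (\<lambda>x::'a::complex_inner. c *\<^sub>C x)"
  by (rule bounded_linear_intro[of _ "cmod c"])
     (auto simp: scaleC_add_right norm_scaleC scaleR_eq_scaleC scaleC_scaleC mult.commute)

lemma csubspace_closure:
  fixes W :: "'h::complex_inner set"
  assumes "csubspace W" shows "csubspace (closure W)"
proof -
  have "x + y \<in> closure W" if xy: "x \<in> closure W" "y \<in> closure W" for x y
  proof -
    obtain f where "\<forall>n. f n \<in> W" "f \<longlonglongrightarrow> x"
      using xy(1) unfolding closure_sequential by blast
    moreover obtain g where "\<forall>n. g n \<in> W" "g \<longlonglongrightarrow> y"
      using xy(2) unfolding closure_sequential by blast
    ultimately have "\<forall>n. f n + g n \<in> W" "(\<lambda>n. f n + g n) \<longlonglongrightarrow> x + y"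
      using assms by (auto simp: csubspace_add intro: tendsto_add)
    then show ?thesis unfolding closure_sequential by (intro exI[of _ "\<lambda>n. f n + g n"]) simp
  qed
  moreover have "c *\<^sub>C x \<in> closure W" if x: "x \<in> closure W" for x c
  proof -
    obtain f where f: "\<forall>n. f n \<in> W" "f \<longlonglongrightarrow> x"
      using x unfolding closure_sequential by blast
    have "\<forall>n. c *\<^sub>C f n \<in> W" "(\<lambda>n. c *\<^sub>C f n) \<longlonglongrightarrow> c *\<^sub>C x"
      using f assms by (auto simp: csubspace_scale intro: bounded_linear.tendsto[OF bounded_linear_scaleC])
    then show ?thesis unfolding closure_sequential by (intro exI[of _ "\<lambda>n. c *\<^sub>C f n"]) simp
  qed
  moreover have "0 \<in> closure W" using assms csubspace_0 closure_subset by blast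
  ultimately show ?thesis by (simp add: complex_vector.subspace_def)
qed

lemma dense_if_orthogonal_trivial:
  fixes W :: "'h::complex_hilbert_space set"
  assumes "csubspace W" and "\<And>f. (\<And>w. w \<in> W \<Longrightarrow> cinner f w = 0) \<Longrightarrow> f = 0"
  shows "closure W = UNIV"
proof -
  have "f \<in> closure W" for f
  proof -
    obtain k where k: "k \<in> closure W" "\<And>m. m \<in> closure W \<Longrightarrow> cinner k m = cinner f m"
      using orthogonal_projection_exists[OF csubspace_closure[OF assms(1)] closed_closure] by blast
    have "f - k = 0"
    proof (rule assms(2))
      fix w assume "w \<in> W"
      then have "w \<in> closure W" using closure_subset by blast
      then show "cinner (f - k) w = 0" using k(2) by (simp add: cinner_diff_left)
    qed
    then show ?thesis using k by simp
  qed
  then show ?thesis by blast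
qed

lemma orthogonal_dense_eq_0:
  fixes W :: "'h::complex_inner set"
  assumes "closure W = UNIV" and "\<And>w. w \<in> W \<Longrightarrow> cinner f w = 0"
  shows "f = 0"
proof -
  obtain X where X: "\<And>n. X n \<in> W" "X \<longlonglongrightarrow> f"
    using assms(1) closure_sequential[of f W] by auto
  have "(\<lambda>n. cinner f (X n)) \<longlonglongrightarrow> cinner f f"
    by (intro tendsto_cinner tendsto_const X)
  then have "cinner f f = 0" using assms(2) X(1) by (simp add: LIMSEQ_const_iff)
  then show ?thesis by simp
qed

text \<open>Over the complex numbers the diagonal determines the form: its vanishing at x + y gives
  \<open>P x y + P y x = 0\<close>, and the same identity for \<open>\<i> *\<^sub>C y\<close> gives
  \<open>P y x = P x y\<close>.\<close>

lemma sesquilinear_polarization: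
  fixes P :: "'h::complex_vector \<Rightarrow> 'h \<Rightarrow> complex"
  assumes "\<And>x y z. P (x + y) z = P x z + P y z" "\<And>x y z. P z (x + y) = P z x + P z y"
    and "\<And>c x y. P (c *\<^sub>C x) y = c * P x y" "\<And>c x y. P x (c *\<^sub>C y) = cnj c * P x y"
    and diag: "\<And>x. P x x = 0"
  shows "P x y = 0"
proof -
  have *: "P x y + P y x = 0" for x y
    using diag[of "x + y"] diag[of x] diag[of y] by (simp add: assms(1-4) add.commute)
  have "P x (\<i> *\<^sub>C y) + P (\<i> *\<^sub>C y) x = 0" by (rule *)
  then have "\<i> * (P y x - P x y) = 0" by (simp add: assms algebra_simps)
  then have "P y x = P x y" by simp
  then show ?thesis using *[of x y] by simp
qed

section \<open>Square integrable functions\<close>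

text \<open>Square integrable functions are not taken modulo null sets, so values at single points
  remain available. The same notions serve the Haar measure, its restriction to the fundamental
  domain and counting measures.\<close>

definition ip :: "'i measure \<Rightarrow> ('i \<Rightarrow> complex) \<Rightarrow> ('i \<Rightarrow> complex) \<Rightarrow> complex" where
  "ip M F G = (\<integral>x. F x * cnj (G x) \<partial>M)"

definition nsq :: "'i measure \<Rightarrow> ('i \<Rightarrow> complex) \<Rightarrow> real" where
  "nsq M F = (\<integral>x. (cmod (F x))\<^sup>2 \<partial>M)"

lemma nsq_nonneg [simp]: "nsq M F \<ge> 0"
  by (simp add: nsq_def)

lemma ip_self: "ip M F F = complex_of_real (nsq M F)"
  unfolding ip_def nsq_def complex_norm_square[symmetric] by (rule integral_complex_of_real)

lemma ip_cnj: "ip M G F = cnj (ip M F G)"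
  unfolding ip_def by (subst Bochner_Integration.integral_cnj[symmetric]) (simp del: integral_cnj add: mult.commute)

lemma square_integrable_mult_cnj:
  assumes "square_integrable M F" "square_integrable M G"
  shows "integrable M (\<lambda>x. F x * cnj (G x))"
proof (rule Bochner_Integration.integrable_bound)
  show "integrable M (\<lambda>x. (cmod (F x))\<^sup>2 + (cmod (G x))\<^sup>2)"
    using assms by (simp add: square_integrable_def)
  have [measurable]: "F \<in> borel_measurable M" "G \<in> borel_measurable M"
    using assms by (auto simp: square_integrable_def)
  have [measurable]: "cnj \<in> borel_measurable borel"
    by (intro borel_measurable_continuous_onI continuous_intros)
  show "(\<lambda>x. F x * cnj (G x)) \<in> borel_measurable M" by measurable
  have "cmod (F x * cnj (G x)) \<le> (cmod (F x))\<^sup>2 + (cmod (G x))\<^sup>2" for x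
  proof -
    have "2 * cmod (F x) * cmod (G x) \<le> (cmod (F x))\<^sup>2 + (cmod (G x))\<^sup>2"
      by (rule sum_squares_bound)
    moreover have "0 \<le> cmod (F x) * cmod (G x)" by simp
    ultimately show ?thesis unfolding norm_mult complex_mod_cnj by linarith
  qed
  then show "AE x in M. norm (F x * cnj (G x)) \<le> norm ((cmod (F x))\<^sup>2 + (cmod (G x))\<^sup>2)"
    by (intro AE_I2) (metis abs_ge_self order_trans real_norm_def)
qed

lemma square_integrable_add:
  assumes "square_integrable M F" "square_integrable M G"
  shows "square_integrable M (\<lambda>x. F x + G x)"
proof -
  have [measurable]: "F \<in> borel_measurable M" "G \<in> borel_measurable M"
    using assms by (auto simp: square_integrable_def)
  have "integrable M (\<lambda>x. (cmod (F x + G x))\<^sup>2)"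
  proof (rule Bochner_Integration.integrable_bound)
    show "integrable M (\<lambda>x. 2 * ((cmod (F x))\<^sup>2 + (cmod (G x))\<^sup>2))"
      using assms by (simp add: square_integrable_def)
    have "(cmod (F x + G x))\<^sup>2 \<le> 2 * ((cmod (F x))\<^sup>2 + (cmod (G x))\<^sup>2)" for x
    proof -
      have "(cmod (F x + G x))\<^sup>2 \<le> (cmod (F x) + cmod (G x))\<^sup>2"
        by (intro power_mono norm_triangle_ineq) simp
      moreover have "2 * cmod (F x) * cmod (G x) \<le> (cmod (F x))\<^sup>2 + (cmod (G x))\<^sup>2"
        by (rule sum_squares_bound)
      ultimately show ?thesis unfolding power2_sum by argo
    qed
    then show "AE x in M. norm ((cmod (F x + G x))\<^sup>2) \<le> norm (2 * ((cmod (F x))\<^sup>2 + (cmod (G x))\<^sup>2))"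
      by (intro AE_I2) simp
  qed measurable
  then show ?thesis by (simp add: square_integrable_def)
qed

lemma square_integrable_cmult:
  assumes "square_integrable M F" shows "square_integrable M (\<lambda>x. c * F x)"
  using assms by (auto simp: square_integrable_def norm_mult power_mult_distrib)

lemma square_integrable_diff:
  assumes "square_integrable M F" "square_integrable M G"
  shows "square_integrable M (\<lambda>x. F x - G x)"
  using square_integrable_add[OF assms(1) square_integrable_cmult[OF assms(2), of "-1"]] by simp

lemma square_integrable_0 [simp]: "square_integrable M (\<lambda>x. 0)"
  by (simp add: square_integrable_def)

lemma ip_add_left:
  assumes "square_integrable M F" "square_integrable M G" "square_integrable M H"
  shows "ip M (\<lambda>x. F x + G x) H = ip M F H + ip M G H"
  using assms by (simp add: ip_def distrib_right square_integrable_mult_cnj)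

lemma ip_add_right:
  assumes "square_integrable M F" "square_integrable M G" "square_integrable M H"
  shows "ip M H (\<lambda>x. F x + G x) = ip M H F + ip M H G"
  using assms by (simp add: ip_def distrib_left square_integrable_mult_cnj)

lemma ip_diff_left:
  assumes "square_integrable M F" "square_integrable M G" "square_integrable M H"
  shows "ip M (\<lambda>x. F x - G x) H = ip M F H - ip M G H"
  using assms by (simp add: ip_def left_diff_distrib square_integrable_mult_cnj)

lemma ip_cmult_left: "ip M (\<lambda>x. c * F x) H = c * ip M F H"
  by (simp add: ip_def mult.assoc)

lemma ip_cmult_right: "ip M H (\<lambda>x. c * F x) = cnj c * ip M H F"
proof -
  have "ip M H (\<lambda>x. c * F x) = (\<integral>x. cnj c * (H x * cnj (F x)) \<partial>M)"
    unfolding ip_def by (intro Bochner_Integration.integral_cong) auto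
  then show ?thesis by (simp add: ip_def)
qed

lemma nsq_cmult: "nsq M (\<lambda>x. c * F x) = (cmod c)\<^sup>2 * nsq M F"
  by (simp add: nsq_def norm_mult power_mult_distrib)

lemma nsq_add:
  assumes "square_integrable M F" "square_integrable M G"
  shows "nsq M (\<lambda>x. F x + G x) = nsq M F + nsq M G + 2 * Re (ip M F G)"
proof -
  have "complex_of_real (nsq M (\<lambda>x. F x + G x)) = ip M F F + ip M G G + (ip M F G + ip M G F)"
    using assms by (simp add: ip_self[symmetric] ip_add_left ip_add_right square_integrable_add)
  also have "ip M G F = cnj (ip M F G)" by (rule ip_cnj)
  finally have "Re (complex_of_real (nsq M (\<lambda>x. F x + G x))) =
      Re (ip M F F + ip M G G + (ip M F G + cnj (ip M F G)))" by (simp only:)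
  then show ?thesis by (simp add: ip_self)
qed

lemma nsq_diff:
  assumes "square_integrable M F" "square_integrable M G"
  shows "nsq M (\<lambda>x. F x - G x) = nsq M F + nsq M G - 2 * Re (ip M F G)"
  using nsq_add[OF assms(1) square_integrable_cmult[OF assms(2), of "-1"]]
    nsq_cmult[of M "-1" G] ip_cmult_right[of M F "-1" G] by simp

lemma nsq_parallelogram:
  assumes "square_integrable M F" "square_integrable M G"
  shows "nsq M (\<lambda>x. F x + G x) + nsq M (\<lambda>x. F x - G x) = 2 * nsq M F + 2 * nsq M G"
  using assms by (simp add: nsq_add nsq_diff)

lemma Cauchy_Schwarz_ip:
  assumes F: "square_integrable M F" and G: "square_integrable M G"
  shows "(cmod (ip M F G))\<^sup>2 \<le> nsq M F * nsq M G"
proof -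
  define z where "z = ip M F G"
  \<comment> \<open>The squared norm of F - t z G, expanded; the factor z makes the cross term the
    real number -2t|z|^2.\<close>
  have *: "0 \<le> nsq M F + t\<^sup>2 * (cmod z)\<^sup>2 * nsq M G - 2 * t * (cmod z)\<^sup>2" for t :: real
  proof -
    have "0 \<le> nsq M (\<lambda>x. F x - (t * z) * G x)" by simp
    also have "\<dots> = nsq M F + (cmod (t * z))\<^sup>2 * nsq M G - 2 * Re (cnj (t * z) * z)"
      using nsq_diff[OF F square_integrable_cmult[OF G, of "t * z"]]
      by (simp only: nsq_cmult ip_cmult_right z_def)
    also have "cnj (t * z) * z = complex_of_real t * (z * cnj z)" by (simp add: mult_ac)
    also have "z * cnj z = complex_of_real ((cmod z)\<^sup>2)" by (rule complex_norm_square[symmetric])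
    finally show ?thesis by (simp add: norm_mult power_mult_distrib)
  qed
  show ?thesis
  proof (cases "nsq M G = 0")
    case True
    have "(cmod z)\<^sup>2 = 0"
    proof (rule ccontr)
      assume "(cmod z)\<^sup>2 \<noteq> 0"
      \<comment> \<open>At this t the linear term exceeds \<open>nsq M F\<close> by one, and the
        quadratic term vanishes together with \<open>nsq M G\<close>.\<close>
      then have "2 * ((nsq M F + 1) / (2 * (cmod z)\<^sup>2)) * (cmod z)\<^sup>2 = nsq M F + 1" by simp
      then show False using *[of "(nsq M F + 1) / (2 * (cmod z)\<^sup>2)"] True by simp
    qed
    then show ?thesis by (simp add: z_def)
  next
    case False
    then have pos: "nsq M G > 0" using nsq_nonneg[of M G] by linarith
    have "0 \<le> nsq M F - (cmod z)\<^sup>2 / nsq M G"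
      using *[of "1 / nsq M G"] pos by (simp add: power2_eq_square field_simps)
    then show ?thesis using pos by (simp add: z_def field_simps)
  qed
qed

lemma Cauchy_Schwarz_ip_sqrt:
  assumes F: "square_integrable M F" and G: "square_integrable M G"
  shows "cmod (ip M F G) \<le> sqrt (nsq M F) * sqrt (nsq M G)"
  using Cauchy_Schwarz_ip[OF assms] by (metis real_le_rsqrt real_sqrt_mult)

lemma nn_integral_cmod_sq:
  assumes "square_integrable M F"
  shows "(\<integral>\<^sup>+x. ennreal ((cmod (F x))\<^sup>2) \<partial>M) = ennreal (nsq M F)"
  unfolding nsq_def using assms by (intro nn_integral_eq_integral) (auto simp: square_integrable_def)

lemma square_integrableI_nn:
  assumes "F \<in> borel_measurable M" "(\<integral>\<^sup>+x. ennreal ((cmod (F x))\<^sup>2) \<partial>M) \<le> ennreal C" "C \<ge> 0"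
  shows "square_integrable M F" "nsq M F \<le> C"
proof -
  have [measurable]: "F \<in> borel_measurable M" by fact
  show *: "square_integrable M F"
    unfolding square_integrable_def
    using assms by (auto intro!: integrableI_bounded simp: ennreal_less_top order_le_less_trans)
  show "nsq M F \<le> C"
    using nn_integral_cmod_sq[OF *] assms by (metis ennreal_le_iff)
qed

text \<open>Fatou's lemma for the squared moduli. It makes analysis maps closed and their forms
  lower semicontinuous, even where they are unbounded.\<close>

lemma square_integrable_limit:
  assumes F: "\<And>n::nat. square_integrable M (F n)"
    and lim: "\<And>x. x \<in> space M \<Longrightarrow> (\<lambda>n. F n x) \<longlonglongrightarrow> G x"
    and L: "liminf (\<lambda>n. ennreal (nsq M (F n))) \<le> ennreal C" "C \<ge> 0"
  shows "square_integrable M G" "nsq M G \<le> C"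
proof -
  have F_meas[measurable]: "F n \<in> borel_measurable M" for n
    using F by (simp add: square_integrable_def)
  have G: "G \<in> borel_measurable M"
    by (rule borel_measurable_LIMSEQ_metric[OF F_meas lim])
  have "(\<integral>\<^sup>+x. ennreal ((cmod (G x))\<^sup>2) \<partial>M)
      = (\<integral>\<^sup>+x. liminf (\<lambda>n. ennreal ((cmod (F n x))\<^sup>2)) \<partial>M)"
    by (intro nn_integral_cong lim_imp_Liminf[symmetric] tendsto_intros lim) auto
  also have "\<dots> \<le> liminf (\<lambda>n. \<integral>\<^sup>+x. ennreal ((cmod (F n x))\<^sup>2) \<partial>M)"
    by (intro nn_integral_liminf) measurable
  also have "\<dots> = liminf (\<lambda>n. ennreal (nsq M (F n)))"
    by (simp add: nn_integral_cmod_sq F)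
  finally have le: "(\<integral>\<^sup>+x. ennreal ((cmod (G x))\<^sup>2) \<partial>M) \<le> ennreal C"
    using L by order
  show "square_integrable M G" "nsq M G \<le> C"
    using square_integrableI_nn[OF G le L(2)] by auto
qed

lemma square_integrable_limit_bounded:
  assumes "\<And>n::nat. square_integrable M (F n)"
    and "\<And>x. x \<in> space M \<Longrightarrow> (\<lambda>n. F n x) \<longlonglongrightarrow> G x"
    and C: "\<And>n. nsq M (F n) \<le> C"
  shows "square_integrable M G \<and> nsq M G \<le> C"
proof -
  have "liminf (\<lambda>n. ennreal (nsq M (F n))) \<le> liminf (\<lambda>n. ennreal C)"
    by (intro Liminf_mono) (auto intro!: always_eventually ennreal_leI C)
  then have "liminf (\<lambda>n. ennreal (nsq M (F n))) \<le> ennreal C" by (simp add: Liminf_const)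
  moreover have "C \<ge> 0" using C[of 0] nsq_nonneg[of M "F 0"] by linarith
  ultimately show ?thesis using square_integrable_limit[OF assms(1,2)] by blast
qed

lemma square_integrable_limit_tendsto:
  assumes "\<And>n::nat. square_integrable M (F n)"
    and "\<And>x. x \<in> space M \<Longrightarrow> (\<lambda>n. F n x) \<longlonglongrightarrow> G x"
    and L: "(\<lambda>n. nsq M (F n)) \<longlonglongrightarrow> L"
  shows "square_integrable M G \<and> nsq M G \<le> L"
proof -
  have "liminf (\<lambda>n. ennreal (nsq M (F n))) = ennreal L"
    by (intro lim_imp_Liminf tendsto_intros L) auto
  moreover have "L \<ge> 0" using L by (rule LIMSEQ_le_const) auto
  ultimately show ?thesis using square_integrable_limit[OF assms(1,2)] by (metis order_refl)
qed

section \<open>Families of vectors indexed by a measure space\<close>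

abbreviation coef :: "('i \<Rightarrow> 'h::complex_inner) \<Rightarrow> 'h \<Rightarrow> 'i \<Rightarrow> complex" where
  "coef e f \<equiv> (\<lambda>i. cinner f (e i))"

definition frame_domain :: "'i measure \<Rightarrow> ('i \<Rightarrow> 'h::complex_inner) \<Rightarrow> 'h set" where
  "frame_domain M e = {f. square_integrable M (coef e f)}"

definition bessel :: "'i measure \<Rightarrow> ('i \<Rightarrow> 'h::complex_inner) \<Rightarrow> real \<Rightarrow> bool" where
  "bessel M e C \<longleftrightarrow> (\<forall>f. square_integrable M (coef e f) \<and> nsq M (coef e f) \<le> C * (norm f)\<^sup>2)"

lemma csubspace_frame_domain: "csubspace (frame_domain M e)"
  by (auto simp: complex_vector.subspace_def frame_domain_def cinner_simps
      intro: square_integrable_add square_integrable_cmult)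

lemma synthesis_exists:
  fixes e :: "'i \<Rightarrow> 'h::complex_hilbert_space"
  assumes "bessel M e C" "square_integrable M c"
  shows "\<exists>k. \<forall>h. cinner k h = ip M c (coef e h)"
proof (rule riesz_representation_bound)
  fix x y :: 'h and a
  have e: "square_integrable M (coef e f)" for f using assms by (auto simp: bessel_def)
  show "ip M c (coef e (x + y)) = ip M c (coef e x) + ip M c (coef e y)"
    using assms e by (simp add: cinner_simps ip_add_right)
  show "ip M c (coef e (a *\<^sub>C x)) = cnj a * ip M c (coef e x)"
    by (simp add: cinner_simps ip_cmult_right)
  have "nsq M (coef e x) \<le> C * (norm x)\<^sup>2" using assms by (auto simp: bessel_def)
  then have "sqrt (nsq M (coef e x)) \<le> sqrt C * norm x"
    by (metis real_sqrt_le_iff real_sqrt_mult real_sqrt_abs abs_norm_cancel)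
  then have "sqrt (nsq M c) * sqrt (nsq M (coef e x)) \<le> sqrt (nsq M c) * (sqrt C * norm x)"
    by (intro mult_left_mono) auto
  then show "cmod (ip M c (coef e x)) \<le> (sqrt (nsq M c) * sqrt C) * norm x"
    using Cauchy_Schwarz_ip_sqrt[OF assms(2) e, of x] by (simp add: mult.assoc)
qed

text \<open>The weakly defined sum or integral of the vectors \<open>e i\<close> with weights
  \<open>c i\<close>, that is, the adjoint of the analysis map \<open>coef e\<close> applied to
  \<open>c\<close>.\<close>

definition synthesis :: "'i measure \<Rightarrow> ('i \<Rightarrow> 'h::complex_inner) \<Rightarrow> ('i \<Rightarrow> complex) \<Rightarrow> 'h" where
  "synthesis M e c = (SOME k. \<forall>h. cinner k h = ip M c (coef e h))"

lemma cinner_synthesis: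
  fixes e :: "'i \<Rightarrow> 'h::complex_hilbert_space"
  assumes "bessel M e C" "square_integrable M c"
  shows "cinner (synthesis M e c) h = ip M c (coef e h)"
  using someI_ex[OF synthesis_exists[OF assms]] unfolding synthesis_def by blast

text \<open>The operator \<open>B\<close> below is \<open>(1 + s C\<^sup>* C)\<^sup>-\<^sup>1\<close> for the possibly unbounded closed
  operator \<open>C f = coef e f\<close>.\<close>

locale frame_resolvent =
  fixes M :: "'i measure" and e :: "'i \<Rightarrow> 'h::complex_hilbert_space" and s :: real
  assumes meas: "\<And>f. coef e f \<in> borel_measurable M" and s_pos: "s > 0"
begin

definition B :: "'h \<Rightarrow> 'h" where
  "B f = (SOME k. k \<in> frame_domain M e \<and>
     (\<forall>m\<in>frame_domain M e. cinner k m + s * ip M (coef e k) (coef e m) = cinner f m))"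

lemma B_exists: "\<exists>k. k \<in> frame_domain M e \<and>
     (\<forall>m\<in>frame_domain M e. cinner k m + s * ip M (coef e k) (coef e m) = cinner f m)"
proof -
  let ?Q = "\<lambda>x y. cinner x y + s * ip M (coef e x) (coef e y)"
  have "\<exists>k\<in>frame_domain M e. \<forall>m\<in>frame_domain M e. ?Q k m = cinner f m"
  proof (rule form_representation)
    show "csubspace (frame_domain M e)" by (rule csubspace_frame_domain)
    show "?Q (x + y) z = ?Q x z + ?Q y z"
      if "x \<in> frame_domain M e" "y \<in> frame_domain M e" "z \<in> frame_domain M e" for x y z
      using that by (simp add: cinner_simps frame_domain_def ip_add_left distrib_left)
    show "?Q (c *\<^sub>C x) y = c * ?Q x y" for c x y
      by (simp add: cinner_simps ip_cmult_left distrib_left)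
    show "?Q y x = cnj (?Q x y)" for x y
      using ip_cnj[of M "coef e y" "coef e x"] cinner_commute[of y x] by simp
    show "(norm x)\<^sup>2 \<le> Re (?Q x x)" for x
      using s_pos by (simp add: cinner_self ip_self)
    show "x \<in> frame_domain M e \<and> Re (?Q x x) \<le> L"
      if "\<And>n. X n \<in> frame_domain M e" "X \<longlonglongrightarrow> x" "(\<lambda>n. Re (?Q (X n) (X n))) \<longlonglongrightarrow> L" for X x L
    proof -
      \<comment> \<open>The form values and the norms converge, hence so does the remaining summand
        \<open>nsq M (coef e (X n))\<close>, to which Fatou's lemma applies.\<close>
      have "(\<lambda>n. (Re (?Q (X n) (X n)) - (norm (X n))\<^sup>2) / s) \<longlonglongrightarrow> (L - (norm x)\<^sup>2) / s"
        using that s_pos by (intro tendsto_intros) auto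
      then have "(\<lambda>n. nsq M (coef e (X n))) \<longlonglongrightarrow> (L - (norm x)\<^sup>2) / s"
        using s_pos by (simp add: cinner_self ip_self)
      then have "square_integrable M (coef e x) \<and> nsq M (coef e x) \<le> (L - (norm x)\<^sup>2) / s"
        using that by (intro square_integrable_limit_tendsto[of _ "\<lambda>n. coef e (X n)"])
          (auto simp: frame_domain_def intro: tendsto_cinner)
      then show ?thesis
        using s_pos by (simp add: frame_domain_def cinner_self ip_self field_simps)
    qed
  qed (auto simp: cinner_simps intro: bounded_bilinear.bounded_linear_right[OF bounded_bilinear_cinner])
  then show ?thesis by blast
qed

lemma B_dom: "B f \<in> frame_domain M e"
  and B_eq: "m \<in> frame_domain M e \<Longrightarrow>
    cinner (B f) m + s * ip M (coef e (B f)) (coef e m) = cinner f m"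
  using someI_ex[OF B_exists[of f]] unfolding B_def by blast+

lemma B_square_integrable: "square_integrable M (coef e (B f))"
  using B_dom by (simp add: frame_domain_def)

lemma B_unique:
  assumes k: "k \<in> frame_domain M e" and
    eq: "\<And>m. m \<in> frame_domain M e \<Longrightarrow> cinner k m + s * ip M (coef e k) (coef e m) = cinner f m"
  shows "k = B f"
proof -
  let ?w = "k - B f"
  have w: "?w \<in> frame_domain M e"
    using k B_dom csubspace_diff csubspace_frame_domain by blast
  have "cinner ?w ?w + s * ip M (coef e ?w) (coef e ?w) = 0"
    using eq[OF w] B_eq[OF w, of f] k B_square_integrable[of f] w
    by (simp add: cinner_diff_left[of k] ip_diff_left frame_domain_def algebra_simps)
  then have "complex_of_real ((norm ?w)\<^sup>2 + s * nsq M (coef e ?w)) = 0"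
    by (simp add: cinner_self ip_self)
  then have "(norm ?w)\<^sup>2 + s * nsq M (coef e ?w) = 0"
    unfolding of_real_eq_0_iff .
  moreover have "s * nsq M (coef e ?w) \<ge> 0" using s_pos by simp
  ultimately have "(norm ?w)\<^sup>2 = 0" using zero_le_power2[of "norm ?w"] by linarith
  then show ?thesis by simp
qed

lemma B_add: "B (f + g) = B f + B g"
proof (rule B_unique[symmetric])
  show "B f + B g \<in> frame_domain M e"
    by (intro csubspace_add[OF csubspace_frame_domain] B_dom)
  fix m assume m: "m \<in> frame_domain M e"
  show "cinner (B f + B g) m + s * ip M (coef e (B f + B g)) (coef e m) = cinner (f + g) m"
  proof -
    have "cinner (B f + B g) m + s * ip M (coef e (B f + B g)) (coef e m)
        = (cinner (B f) m + s * ip M (coef e (B f)) (coef e m))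
        + (cinner (B g) m + s * ip M (coef e (B g)) (coef e m))"
      using m by (simp add: B_square_integrable cinner_add_left ip_add_left frame_domain_def algebra_simps)
    then show ?thesis unfolding B_eq[OF m] cinner_add_left[of f] .
  qed
qed

lemma B_scaleC: "B (c *\<^sub>C f) = c *\<^sub>C B f"
proof (rule B_unique[symmetric])
  show "c *\<^sub>C B f \<in> frame_domain M e"
    by (intro csubspace_scale[OF csubspace_frame_domain] B_dom)
  fix m assume m: "m \<in> frame_domain M e"
  have "cinner (c *\<^sub>C B f) m + s * ip M (coef e (c *\<^sub>C B f)) (coef e m)
      = c * (cinner (B f) m + s * ip M (coef e (B f)) (coef e m))"
    by (simp add: cinner_scaleC_left ip_cmult_left distrib_left)
  then show "cinner (c *\<^sub>C B f) m + s * ip M (coef e (c *\<^sub>C B f)) (coef e m) = cinner (c *\<^sub>C f) m"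
    unfolding B_eq[OF m] cinner_scaleC_left[of c f] .
qed

text \<open>The defining equation of \<open>B f\<close> tested against \<open>B f\<close> itself.
  Positivity, contractivity and the bound on \<open>s * nsq M (coef e (B f))\<close> are read off
  from it.\<close>

lemma B_energy:
  "cinner f (B f) = complex_of_real ((norm (B f))\<^sup>2 + s * nsq M (coef e (B f)))"
  using B_eq[OF B_dom, of f f] by (simp add: cinner_self ip_self)

lemma B_nonneg: "Re (cinner (B f) f) \<ge> 0"
  using B_energy[of f] s_pos by (simp add: Re_cinner_commute[of "B f"])

lemma B_selfadjoint: "cinner (B f) g = cinner f (B g)"
proof -
  have "cinner g (B f) = cinner (B g) (B f) + s * ip M (coef e (B g)) (coef e (B f))"
    using B_eq[OF B_dom, of g f] by simp
  then have "cinner (B f) g = cinner (B f) (B g) + s * ip M (coef e (B f)) (coef e (B g))"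
    using ip_cnj[of M "coef e (B f)" "coef e (B g)"] cinner_commute[of g "B f"]
      cinner_commute[of "B g" "B f"] cinner_commute[of "B f" g] cinner_commute[of "B f" "B g"]
      ip_cnj[of M "coef e (B g)" "coef e (B f)"] by (metis complex_cnj_add complex_cnj_complex_of_real complex_cnj_mult)
  also have "\<dots> = cinner f (B g)" by (rule B_eq[OF B_dom])
  finally show ?thesis .
qed

lemma norm_B_le: "norm (B f) \<le> norm f"
proof -
  have "(norm (B f))\<^sup>2 \<le> Re (cinner f (B f))" using s_pos by (simp add: B_energy)
  also have "\<dots> \<le> norm f * norm (B f)"
    using Cauchy_Schwarz_cinner complex_Re_le_cmod order_trans by blast
  finally have "norm (B f) * norm (B f) \<le> norm f * norm (B f)" by (simp add: power2_eq_square)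
  then show ?thesis by (cases "B f = 0") (auto simp: mult_le_cancel_right)
qed

lemma nsq_coef_B_le: "s * nsq M (coef e (B f)) \<le> (norm f)\<^sup>2"
proof -
  have "s * nsq M (coef e (B f)) \<le> Re (cinner f (B f))" by (simp add: B_energy)
  also have "\<dots> \<le> norm f * norm (B f)"
    using Cauchy_Schwarz_cinner complex_Re_le_cmod order_trans by blast
  also have "\<dots> \<le> norm f * norm f" by (intro mult_left_mono norm_B_le) simp
  finally show ?thesis by (simp add: power2_eq_square)
qed

lemma bounded_clinear_B: "bounded_clinear B"
proof -
  have "bounded_linear B"
    by (rule bounded_linear_intro[of _ 1])
       (auto simp: B_add B_scaleC scaleR_eq_scaleC norm_B_le)
  then show ?thesis by (simp add: bounded_clinear_def B_scaleC)
qed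

text \<open>If \<open>B f\<close> vanishes, the defining equation makes f orthogonal to the
  domain.\<close>

lemma B_inj:
  assumes "closure (frame_domain M e) = UNIV" "B f = 0" shows "f = 0"
  using assms(1)
proof (rule orthogonal_dense_eq_0)
  fix m assume "m \<in> frame_domain M e"
  from B_eq[OF this, of f] assms(2) show "cinner f m = 0" by (simp add: ip_def)
qed

text \<open>An isometry that preserves the domain and the form carries the equation for
  \<open>B f\<close> to the one for \<open>B (U f)\<close>, whose solution is unique.\<close>

lemma B_commute:
  assumes iso: "\<And>f g. cinner (U f) (U g) = cinner f g"
    and dom: "U ` frame_domain M e = frame_domain M e"
    and inv: "\<And>f g. ip M (coef e (U f)) (coef e (U g)) = ip M (coef e f) (coef e g)"
  shows "B (U f) = U (B f)"
proof (rule B_unique[symmetric])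
  show "U (B f) \<in> frame_domain M e" using dom B_dom by blast
  fix m assume "m \<in> frame_domain M e"
  then obtain m' where m': "m = U m'" "m' \<in> frame_domain M e" using dom by blast
  show "cinner (U (B f)) m + s * ip M (coef e (U (B f))) (coef e m) = cinner (U f) m"
    unfolding m'(1) iso inv by (rule B_eq[OF m'(2)])
qed

end

section \<open>Square roots of positive contractions and Schur's lemma\<close>

instance complex_hilbert_space \<subseteq> banach ..

text \<open>The coefficients of the binomial series of \<open>(1 - t)^(1/2)\<close>.\<close>

definition sqrt_coeff :: "nat \<Rightarrow> real" where
  "sqrt_coeff k = (-1) ^ k * ((1/2) gchoose k)"

lemma sqrt_coeff_0 [simp]: "sqrt_coeff 0 = 1"
  by (simp add: sqrt_coeff_def)

lemma neg_half_gbinomial_sign: "(-1) ^ m * ((-1/2 :: real) gchoose m) \<ge> 0"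
proof -
  have "(-1) ^ m * ((-1/2 :: real) gchoose m) = (\<Prod>i=0..<m. 1/2 + real i) / fact m"
  proof -
    have "(-1) ^ m * (\<Prod>i=0..<m. -1/2 - real i) = (\<Prod>i=0..<m. (-1) * (-1/2 - real i))"
      by (subst prod.distrib) simp
    also have "\<dots> = (\<Prod>i=0..<m. 1/2 + real i)" by (intro prod.cong) auto
    finally show ?thesis by (simp add: gbinomial_prod_rev)
  qed
  also have "\<dots> \<ge> 0" by (intro divide_nonneg_nonneg prod_nonneg) auto
  finally show ?thesis .
qed

lemma sqrt_coeff_Suc_le_0: "sqrt_coeff (Suc k) \<le> 0"
proof -
  have "sqrt_coeff (Suc k) = - (1 / (2 * real (Suc k))) * ((-1) ^ k * ((-1/2) gchoose k))"
    using gbinomial_absorption'[of "Suc k" "1/2 :: real"] by (simp add: sqrt_coeff_def)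
  moreover have "(1 / (2 * real (Suc k))) * ((-1) ^ k * ((-1/2 :: real) gchoose k)) \<ge> 0"
    by (intro mult_nonneg_nonneg neg_half_gbinomial_sign) simp
  ultimately show ?thesis by simp
qed

text \<open>The partial sums of all coefficients are, up to sign, binomial coefficients of -1/2, and
  they are nonnegative. Since only the coefficient 1 of index 0 is positive, the others have total
  absolute value at most 1. The series thus converges absolutely even for operators of norm exactly
  1.\<close>

lemma sqrt_coeff_partial_sum: "(\<Sum>k<n. \<bar>sqrt_coeff (Suc k)\<bar>) \<le> 1"
proof -
  have "(\<Sum>k\<le>n. sqrt_coeff k) = (-1) ^ n * ((1/2 - 1) gchoose n)"
    unfolding gbinomial_sum_lower_neg[symmetric] sqrt_coeff_def by (simp add: mult.commute)
  then have "(\<Sum>k\<le>n. sqrt_coeff k) \<ge> 0" using neg_half_gbinomial_sign[of n] by simp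
  moreover have "(\<Sum>k\<le>n. sqrt_coeff k) = 1 + (\<Sum>k<n. sqrt_coeff (Suc k))"
    by (simp add: sum.atMost_shift)
  moreover have "(\<Sum>k<n. \<bar>sqrt_coeff (Suc k)\<bar>) = - (\<Sum>k<n. sqrt_coeff (Suc k))"
    using sqrt_coeff_Suc_le_0 by (simp add: sum_negf[symmetric])
  ultimately show ?thesis by linarith
qed

lemma summable_sqrt_coeff_Suc: "summable (\<lambda>k. \<bar>sqrt_coeff (Suc k)\<bar>)"
  by (rule bounded_imp_summable[of _ 1]) (use sqrt_coeff_partial_sum[of "Suc _"] in \<open>auto simp: lessThan_Suc_atMost\<close>)

lemma summable_sqrt_coeff: "summable (\<lambda>k. \<bar>sqrt_coeff k\<bar>)"
  using summable_sqrt_coeff_Suc summable_Suc_iff[of "\<lambda>k. \<bar>sqrt_coeff k\<bar>"] by simp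

text \<open>Vandermonde's identity for 1/2 + 1/2 = 1: the square of the series is 1 - t.\<close>

lemma sqrt_coeff_convolution:
  "(\<Sum>i\<le>n. sqrt_coeff i * sqrt_coeff (n - i)) = (if n = 0 then 1 else if n = 1 then -1 else 0)"
proof -
  have "(\<Sum>i\<le>n. sqrt_coeff i * sqrt_coeff (n - i))
      = (\<Sum>i\<le>n. (-1) ^ n * (((1/2) gchoose i) * ((1/2) gchoose (n - i))))"
    by (intro sum.cong) (auto simp: sqrt_coeff_def power_add[symmetric] mult_ac simp flip: power_add)
  also have "\<dots> = (-1) ^ n * ((1::real) gchoose n)"
    using gbinomial_Vandermonde[of "1/2::real" "1/2" n] by (simp add: sum_distrib_left[symmetric] atLeast0AtMost)
  also have "(1::real) gchoose n = of_nat (1 choose n)" by (simp add: binomial_gbinomial)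
  also have "(-1) ^ n * \<dots> = (if n = 0 then 1 else if n = 1 then -1 else 0)"
    by (cases n rule: nat.exhaust; cases "n - 1" rule: nat.exhaust) (auto simp: binomial_eq_0)
  finally show ?thesis .
qed

text \<open>A Cauchy product weighted by a bounded sequence. With \<open>m n\<close> a matrix entry
  of the n-th power of an operator it squares an operator series by scalar computations
  only.\<close>

lemma double_series_convolution:
  fixes r :: "nat \<Rightarrow> real" and m :: "nat \<Rightarrow> complex"
  assumes r: "summable (\<lambda>k. \<bar>r k\<bar>)" and m: "\<And>n. cmod (m n) \<le> C"
  shows "(\<Sum>k. \<Sum>j. r k * (r j * m (k + j))) = (\<Sum>n. (\<Sum>i\<le>n. r i * r (n - i)) * m n)"
proof -
  let ?F = "\<lambda>(k, j). r k * (r j * m (k + j))"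
  let ?G = "\<lambda>(n, i). r i * (r (n - i) * m n)"
  have ron: "(\<lambda>k. \<bar>r k\<bar>) summable_on UNIV"
    using r by (intro norm_summable_imp_summable_on) simp
  have C: "C \<ge> 0" using m[of 0] norm_ge_zero order_trans by blast
  have F: "?F summable_on UNIV \<times> UNIV"
  proof (rule Infinite_Sum.abs_summable_summable, rule summable_on_comparison_test)
    have "(\<lambda>x. \<bar>r (fst x)\<bar> * \<bar>r (snd x)\<bar>) summable_on UNIV \<times> UNIV"
      proof (rule Infinite_Sum.abs_summable_summable, subst Infinite_Sum.abs_summable_on_Sigma_iff, intro conjI ballI)
      show "(\<lambda>y. norm (\<bar>r (fst (x, y))\<bar> * \<bar>r (snd (x, y))\<bar>)) summable_on UNIV" for x
        using ron by (simp add: abs_mult summable_on_cmult_right)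
      show "(\<lambda>x. norm (\<Sum>\<^sub>\<infinity>y. norm (\<bar>r (fst (x, y))\<bar> * \<bar>r (snd (x, y))\<bar>))) summable_on UNIV"
        using ron by (simp add: abs_mult infsum_cmult_right' infsum_nonneg summable_on_cmult_left)
    qed
    then show "(\<lambda>x. C * (\<bar>r (fst x)\<bar> * \<bar>r (snd x)\<bar>)) summable_on UNIV \<times> UNIV"
      by (rule summable_on_cmult_right)
    fix x :: "nat \<times> nat"
    have "norm (?F x) = cmod (m (fst x + snd x)) * (\<bar>r (fst x)\<bar> * \<bar>r (snd x)\<bar>)"
      by (simp add: case_prod_unfold norm_mult)
    then show "norm (?F x) \<le> C * (\<bar>r (fst x)\<bar> * \<bar>r (snd x)\<bar>)"
      using m by (simp add: mult_right_mono)
  qed auto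
  have summable_inner: "summable (\<lambda>j. norm (r k * (r j * m (k + j))))" for k
  proof (rule summable_comparison_test')
    show "summable (\<lambda>j. \<bar>r k\<bar> * C * \<bar>r j\<bar>)" by (intro summable_mult r)
    show "norm (norm (r k * (r j * m (k + j)))) \<le> \<bar>r k\<bar> * C * \<bar>r j\<bar>" for j
    proof -
      have "norm (norm (r k * (r j * m (k + j)))) = (\<bar>r k\<bar> * \<bar>r j\<bar>) * cmod (m (k + j))"
        by (simp add: norm_mult)
      also have "\<dots> \<le> (\<bar>r k\<bar> * \<bar>r j\<bar>) * C" by (intro mult_left_mono m) simp
      finally show ?thesis by (simp only: mult_ac)
    qed
  qed
  have G: "?G summable_on Sigma UNIV (\<lambda>n. {..n})"
    and FG: "infsum ?F (UNIV \<times> UNIV) = infsum ?G (Sigma UNIV (\<lambda>n. {..n}))"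
  proof -
    have "(?F summable_on UNIV \<times> UNIV) = (?G summable_on (Sigma UNIV (\<lambda>n. {..n})))"
      by (rule summable_on_reindex_bij_witness[of _ "\<lambda>(n, i). (i, n - i)" "\<lambda>(k, j). (k + j, k)"]) auto
    then show "?G summable_on Sigma UNIV (\<lambda>n. {..n})" using F by simp
    show "infsum ?F (UNIV \<times> UNIV) = infsum ?G (Sigma UNIV (\<lambda>n. {..n}))"
      by (rule infsum_reindex_bij_witness[of _ "\<lambda>(n, i). (i, n - i)" "\<lambda>(k, j). (k + j, k)"]) auto
  qed
  have suminf_infsum: "suminf f = infsum f UNIV" if "f summable_on UNIV" for f :: "nat \<Rightarrow> complex"
    using that by (metis has_sum_imp_sums has_sum_infsum sums_unique)
  have "(\<Sum>k. \<Sum>j. r k * (r j * m (k + j))) = (\<Sum>k. \<Sum>\<^sub>\<infinity>j. r k * (r j * m (k + j)))"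
    using summable_inner by (simp add: suminf_infsum norm_summable_imp_summable_on)
  also have "\<dots> = (\<Sum>\<^sub>\<infinity>k. \<Sum>\<^sub>\<infinity>j. r k * (r j * m (k + j)))"
    by (intro suminf_infsum summable_on_Sigma_banach F)
  also have "\<dots> = infsum ?G (Sigma UNIV (\<lambda>n. {..n}))"
    using FG infsum_Sigma'_banach[OF F] by simp
  also have "\<dots> = (\<Sum>\<^sub>\<infinity>n. \<Sum>\<^sub>\<infinity>i\<in>{..n}. r i * (r (n - i) * m n))"
    using infsum_Sigma'_banach[OF G] by simp
  also have "\<dots> = (\<Sum>n. \<Sum>\<^sub>\<infinity>i\<in>{..n}. r i * (r (n - i) * m n))"
    by (intro suminf_infsum[symmetric] summable_on_Sigma_banach G)
  finally show ?thesis by (simp add: sum_distrib_right mult.assoc)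
qed

text \<open>The square root of \<open>1 - X\<close> is the binomial series in \<open>X\<close>.\<close>

locale selfadjoint_contraction =
  fixes X :: "'h::complex_hilbert_space \<Rightarrow> 'h"
  assumes X_add: "X (f + g) = X f + X g" and X_scaleC: "X (c *\<^sub>C f) = c *\<^sub>C X f"
    and X_norm: "norm (X f) \<le> norm f"
    and X_selfadjoint: "cinner (X f) g = cinner f (X g)"
begin

lemma Xn_add: "(X ^^ n) (f + g) = (X ^^ n) f + (X ^^ n) g"
  by (induction n) (auto simp: X_add)

lemma Xn_scaleC: "(X ^^ n) (c *\<^sub>C f) = c *\<^sub>C (X ^^ n) f"
  by (induction n) (auto simp: X_scaleC)

lemma Xn_plus: "(X ^^ (k + j)) f = (X ^^ j) ((X ^^ k) f)"
  by (metis add.commute comp_apply funpow_add)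

lemma Xn_norm: "norm ((X ^^ n) f) \<le> norm f"
  by (induction n) (auto intro: order_trans[OF X_norm])

lemma Xn_selfadjoint: "cinner ((X ^^ n) f) g = cinner f ((X ^^ n) g)"
proof (induction n arbitrary: g)
  case (Suc n)
  show ?case by (simp add: X_selfadjoint Suc) (simp only: funpow_swap1)
qed simp

definition R :: "'h \<Rightarrow> 'h" where "R f = (\<Sum>k. sqrt_coeff k *\<^sub>R (X ^^ k) f)"

lemma summable_norm_R: "summable (\<lambda>k. norm (sqrt_coeff k *\<^sub>R (X ^^ k) f))"
proof (rule summable_comparison_test')
  show "summable (\<lambda>k. \<bar>sqrt_coeff k\<bar> * norm f)" by (intro summable_mult2 summable_sqrt_coeff)
qed (simp add: Xn_norm mult_left_mono)

lemma summable_R: "summable (\<lambda>k. sqrt_coeff k *\<^sub>R (X ^^ k) f)"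
  by (rule summable_norm_cancel[OF summable_norm_R])

lemma R_add: "R (f + g) = R f + R g"
  unfolding R_def by (simp add: suminf_add summable_R Xn_add scaleR_add_right)

lemma R_scaleC: "R (c *\<^sub>C f) = c *\<^sub>C R f"
proof -
  show ?thesis
    unfolding R_def bounded_linear.suminf[OF bounded_linear_scaleC summable_R]
    by (simp add: Xn_scaleC scaleR_eq_scaleC scaleC_scaleC mult.commute)
qed

lemma cinner_R: "cinner (R f) g = (\<Sum>k. sqrt_coeff k * cinner ((X ^^ k) f) g)"
  and summable_cinner_R: "summable (\<lambda>k. sqrt_coeff k * cinner ((X ^^ k) f) g)"
proof -
  note bl = bounded_bilinear.bounded_linear_left[OF bounded_bilinear_cinner, of g]
  show "cinner (R f) g = (\<Sum>k. sqrt_coeff k * cinner ((X ^^ k) f) g)"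
    unfolding R_def bounded_linear.suminf[OF bl summable_R] by (simp add: cinner_simps)
  show "summable (\<lambda>k. sqrt_coeff k * cinner ((X ^^ k) f) g)"
    using bounded_linear.summable[OF bl summable_R] by (simp add: cinner_simps)
qed

lemma R_selfadjoint: "cinner (R f) g = cinner f (R g)"
proof -
  have "cinner g (R f) = cnj (cinner (R f) g)" for f g by (rule cinner_commute)
  then have "cinner f (R g) = cnj (\<Sum>k. sqrt_coeff k * cinner ((X ^^ k) g) f)"
    by (simp add: cinner_R)
  also have "\<dots> = (\<Sum>k. cnj (sqrt_coeff k * cinner ((X ^^ k) g) f))"
    by (intro bounded_linear.suminf bounded_linear_cnj summable_cinner_R)
  also have "\<dots> = (\<Sum>k. sqrt_coeff k * cinner ((X ^^ k) f) g)"
    by (intro suminf_cong) (simp add: cinner_commute[of f, symmetric] Xn_selfadjoint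
        flip: cinner_commute)
  finally show ?thesis by (simp add: cinner_R)
qed

text \<open>The term of index 0 contributes the squared norm of f; the others cannot outweigh it, as
  their coefficients have total absolute value at most 1.\<close>

lemma R_nonneg: "Re (cinner (R f) f) \<ge> 0"
proof -
  have s: "summable (\<lambda>k. Re (sqrt_coeff k * cinner ((X ^^ k) f) f))"
    by (intro summable_Re summable_cinner_R)
  have "Re (cinner (R f) f) = (\<Sum>k. Re (sqrt_coeff k * cinner ((X ^^ k) f) f))"
    unfolding cinner_R by (rule Re_suminf[OF summable_cinner_R])
  also have "\<dots> = (norm f)\<^sup>2 + (\<Sum>k. Re (sqrt_coeff (Suc k) * cinner ((X ^^ Suc k) f) f))"
    using suminf_split_head[OF s] by (simp add: cinner_self)
  finally have split: "Re (cinner (R f) f)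
      = (norm f)\<^sup>2 + (\<Sum>k. Re (sqrt_coeff (Suc k) * cinner ((X ^^ Suc k) f) f))" .
  have "(\<Sum>k. Re (sqrt_coeff (Suc k) * cinner ((X ^^ Suc k) f) f))
      \<ge> (\<Sum>k. - (\<bar>sqrt_coeff (Suc k)\<bar> * (norm f)\<^sup>2))"
  proof (rule suminf_le)
    show "summable (\<lambda>k. - (\<bar>sqrt_coeff (Suc k)\<bar> * (norm f)\<^sup>2))"
      by (intro summable_minus summable_mult2 summable_sqrt_coeff_Suc)
    show "summable (\<lambda>k. Re (sqrt_coeff (Suc k) * cinner ((X ^^ Suc k) f) f))"
      using s by (subst summable_Suc_iff)
    show "- (\<bar>sqrt_coeff (Suc k)\<bar> * (norm f)\<^sup>2) \<le> Re (sqrt_coeff (Suc k) * cinner ((X ^^ Suc k) f) f)"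
      for k
    proof -
      have "cmod (cinner ((X ^^ Suc k) f) f) \<le> norm ((X ^^ Suc k) f) * norm f"
        by (rule Cauchy_Schwarz_cinner)
      also have "\<dots> \<le> norm f * norm f" by (intro mult_right_mono Xn_norm) simp
      finally have "\<bar>sqrt_coeff (Suc k)\<bar> * cmod (cinner ((X ^^ Suc k) f) f)
          \<le> \<bar>sqrt_coeff (Suc k)\<bar> * (norm f)\<^sup>2"
        by (intro mult_left_mono) (auto simp: power2_eq_square)
      moreover have "\<bar>Re (sqrt_coeff (Suc k) * cinner ((X ^^ Suc k) f) f)\<bar>
          \<le> \<bar>sqrt_coeff (Suc k)\<bar> * cmod (cinner ((X ^^ Suc k) f) f)"
        using abs_Re_le_cmod[of "sqrt_coeff (Suc k) * cinner ((X ^^ Suc k) f) f"]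
        by (simp only: norm_mult norm_of_real)
      ultimately show ?thesis by linarith
    qed
  qed
  moreover have "(\<Sum>k. - (\<bar>sqrt_coeff (Suc k)\<bar> * (norm f)\<^sup>2)) = - ((\<Sum>k. \<bar>sqrt_coeff (Suc k)\<bar>) * (norm f)\<^sup>2)"
    by (simp add: suminf_minus summable_mult2 summable_sqrt_coeff_Suc suminf_mult2[symmetric])
  ultimately have "Re (cinner (R f) f) \<ge> (norm f)\<^sup>2 - (\<Sum>k. \<bar>sqrt_coeff (Suc k)\<bar>) * (norm f)\<^sup>2"
    using split by linarith
  moreover have "(\<Sum>k. \<bar>sqrt_coeff (Suc k)\<bar>) * (norm f)\<^sup>2 \<le> 1 * (norm f)\<^sup>2"
    by (intro mult_right_mono suminf_le_const[OF summable_sqrt_coeff_Suc sqrt_coeff_partial_sum]) simp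
  ultimately show ?thesis by simp
qed

lemma R_squared: "R (R f) = f - X f"
proof (rule cinner_ext)
  fix g
  have "cinner (R (R f)) g = cinner (R f) (R g)" by (rule R_selfadjoint)
  also have "\<dots> = (\<Sum>k. sqrt_coeff k * cinner (R ((X ^^ k) f)) g)"
    unfolding cinner_R[of f] by (simp add: R_selfadjoint)
  also have "\<dots> = (\<Sum>k. sqrt_coeff k * (\<Sum>j. sqrt_coeff j * cinner ((X ^^ (k + j)) f) g))"
    unfolding cinner_R Xn_plus ..
  also have "\<dots> = (\<Sum>k. \<Sum>j. sqrt_coeff k * (sqrt_coeff j * cinner ((X ^^ (k + j)) f) g))"
  proof -
    have "summable (\<lambda>j. sqrt_coeff j * cinner ((X ^^ (k + j)) f) g)" for k
      using summable_cinner_R[of "(X ^^ k) f" g] by (simp only: Xn_plus)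
    then show ?thesis by (simp add: suminf_mult)
  qed
  also have "\<dots> = (\<Sum>n. (\<Sum>i\<le>n. sqrt_coeff i * sqrt_coeff (n - i)) * cinner ((X ^^ n) f) g)"
  proof (rule double_series_convolution[OF summable_sqrt_coeff])
    show "cmod (cinner ((X ^^ n) f) g) \<le> norm f * norm g" for n
      by (rule order_trans[OF Cauchy_Schwarz_cinner]) (intro mult_right_mono Xn_norm norm_ge_zero)
  qed
  also have "\<dots> = (\<Sum>n. if n \<in> {0, 1} then (if n = 0 then 1 else -1) * cinner ((X ^^ n) f) g else 0)"
    unfolding sqrt_coeff_convolution by (intro suminf_cong) auto
  also have "\<dots> = cinner f g - cinner (X f) g"
    by (subst suminf_finite[of "{0, 1}"]) auto
  finally show "cinner (R (R f)) g = cinner (f - X f) g" by (simp add: cinner_simps)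
qed

lemma R_commute:
  assumes U: "bounded_linear U" and UX: "\<And>f. U (X f) = X (U f)"
  shows "R (U f) = U (R f)"
proof -
  have "U ((X ^^ k) f) = (X ^^ k) (U f)" for k f by (induction k) (auto simp: UX)
  then show ?thesis
    unfolding R_def bounded_linear.suminf[OF U summable_R]
    by (simp add: linear_simps(5)[OF U])
qed

lemma bounded_linear_R: "bounded_linear R"
proof (rule bounded_linear_intro)
  show "norm (R f) \<le> norm f * (\<Sum>k. \<bar>sqrt_coeff k\<bar>)" for f
  proof -
    have "norm (R f) \<le> (\<Sum>k. norm (sqrt_coeff k *\<^sub>R (X ^^ k) f))"
      unfolding R_def by (rule summable_norm[OF summable_norm_R])
    also have "\<dots> \<le> (\<Sum>k. \<bar>sqrt_coeff k\<bar> * norm f)"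
      by (intro suminf_le summable_norm_R summable_mult2 summable_sqrt_coeff)
         (simp add: Xn_norm mult_left_mono)
    also have "\<dots> = norm f * (\<Sum>k. \<bar>sqrt_coeff k\<bar>)"
      unfolding suminf_mult2[OF summable_sqrt_coeff, symmetric] by (rule mult.commute)
    finally show ?thesis .
  qed
qed (auto simp: R_add R_scaleC scaleR_eq_scaleC)

end

lemma le_0_if_small:
  fixes a b :: real assumes "\<And>t. t > 0 \<Longrightarrow> a \<le> t * b" shows "a \<le> 0"
proof (rule ccontr)
  assume "\<not> a \<le> 0"
  then have a: "a > 0" by simp
  then have b: "b > 0" using assms[of 1] by simp
  show False using assms[of "a / (2 * b)"] a b by simp
qed

lemma unitary_add: "unitary U \<Longrightarrow> U (f + g) = U f + U g"
  and unitary_diff: "unitary U \<Longrightarrow> U (f - g) = U f - U g"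
  and unitary_scaleC: "unitary U \<Longrightarrow> U (c *\<^sub>C f) = c *\<^sub>C U f"
  and unitary_cinner: "unitary U \<Longrightarrow> cinner (U f) (U g) = cinner f g"
  by (auto simp: unitary_def bounded_clinear_def linear_simps)

lemma csubspace_kernel:
  assumes "bounded_linear A" "\<And>c f. A (c *\<^sub>C f) = c *\<^sub>C A f"
  shows "csubspace {f. A f = 0}" "closed {f. A f = (0 :: 'h::complex_inner)}"
proof -
  interpret bounded_linear A by fact
  show "csubspace {f. A f = 0}"
    using assms(2) by (auto simp: complex_vector.subspace_def add zero complex_vector.scale_zero_right)
  show "closed {f. A f = 0}"
    by (intro closed_Collect_eq continuous_on continuous_on_const continuous_on_id)
qed

lemma irreducible_kernel:
  assumes irr: "irreducible_rep \<pi>" and A: "bounded_linear A" "\<And>c f. A (c *\<^sub>C f) = c *\<^sub>C A f"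
    and comm: "\<And>x f. A (\<pi> x f) = \<pi> x (A f)" and rep: "unitary_rep \<pi>"
    and f: "A f = 0" "f \<noteq> 0"
  shows "A g = 0"
proof -
  have "\<pi> x ` {f. A f = 0} \<subseteq> {f. A f = 0}" for x
    using comm rep unitary_add[of "\<pi> x" 0 0] by (auto simp: unitary_rep_def)
  then have "{f. A f = 0} = {0} \<or> {f. A f = 0} = UNIV"
    using irr csubspace_kernel[OF A] unfolding irreducible_rep_def by blast
  then show ?thesis using f by auto
qed

text \<open>The square root R of 1 - (1 - A^2) is the absolute value of A, and (R - A)(R + A) = 0.
  Either R + A vanishes, or its range contains a nonzero vector of the kernel of R - A, which is
  then everything by irreducibility. So A is -R or R, and R is positive.\<close>

lemma irreducible_sign:
  fixes \<pi> :: "'g::topological_group_add \<Rightarrow> 'h::complex_hilbert_space \<Rightarrow> 'h"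
  assumes rep: "unitary_rep \<pi>" and irr: "irreducible_rep \<pi>"
    and A: "bounded_linear A" "\<And>c f. A (c *\<^sub>C f) = c *\<^sub>C A f" "\<And>f. norm (A f) \<le> norm f"
    and sa: "\<And>f g. cinner (A f) g = cinner f (A g)"
    and comm: "\<And>x f. A (\<pi> x f) = \<pi> x (A f)"
  shows "(\<forall>f. Re (cinner (A f) f) \<ge> 0) \<or> (\<forall>f. Re (cinner (A f) f) \<le> 0)"
proof -
  have un: "unitary (\<pi> x)" for x using rep by (simp add: unitary_rep_def)
  interpret A: bounded_linear A by fact
  have AA: "cinner (A (A f)) g = cinner (A f) (A g)" for f g by (rule sa)
  interpret X: selfadjoint_contraction "\<lambda>f. f - A (A f)"
  proof
    fix f g :: 'h and c
    show "f + g - A (A (f + g)) = f - A (A f) + (g - A (A g))" by (simp add: A.add)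
    show "c *\<^sub>C f - A (A (c *\<^sub>C f)) = c *\<^sub>C (f - A (A f))"
      by (simp add: A complex_vector.scale_right_diff_distrib)
    show "cinner (f - A (A f)) g = cinner f (g - A (A g))"
      by (simp add: cinner_simps sa)
    have "(norm (f - A (A f)))\<^sup>2 = (norm f)\<^sup>2 + (norm (A (A f)))\<^sup>2 - 2 * (norm (A f))\<^sup>2"
      using norm_add_sq[of f "- A (A f)"] by (simp add: sa[symmetric] cinner_self)
    moreover have "(norm (A (A f)))\<^sup>2 \<le> (norm (A f))\<^sup>2" by (intro power_mono A) auto
    ultimately have "(norm (f - A (A f)))\<^sup>2 \<le> (norm f)\<^sup>2" using zero_le_power2[of "norm (A f)"] by linarith
    then show "norm (f - A (A f)) \<le> norm f" by (rule power2_le_imp_le) simp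
  qed
  have RR: "X.R (X.R f) = A (A f)" for f by (simp add: X.R_squared)
  have RA: "X.R (A f) = A (X.R f)" for f
    by (rule X.R_commute[OF A(1)]) (simp add: A.diff)
  have R\<pi>: "X.R (\<pi> x f) = \<pi> x (X.R f)" for x f
    by (rule X.R_commute) (use un[of x] in \<open>auto simp: unitary_diff comm unitary_def bounded_clinear_def\<close>)
  show ?thesis
  proof (cases "\<forall>f. X.R f + A f = 0")
    case True
    have eq: "A f = - X.R f" for f
      by (rule minus_unique[symmetric]) (rule True[THEN spec])
    have "Re (cinner (A f) f) \<le> 0" for f
      using X.R_nonneg[of f] arg_cong[OF eq[of f], of "\<lambda>z. Re (cinner z f)"]
      unfolding cinner_minus_left uminus_complex.sel by linarith
    then show ?thesis by blast
  next
    case False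
    then obtain f where f: "X.R f + A f \<noteq> 0" by blast
    have "X.R g - A g = 0" for g
    proof (rule irreducible_kernel[OF irr, of "\<lambda>g. X.R g - A g" "X.R f + A f"])
      show "bounded_linear (\<lambda>g. X.R g - A g)"
        by (intro bounded_linear_sub X.bounded_linear_R A)
      show "X.R (X.R f + A f) - A (X.R f + A f) = 0"
        by (simp add: X.R_add RR RA A.add)
      show "X.R (c *\<^sub>C h) - A (c *\<^sub>C h) = c *\<^sub>C (X.R h - A h)" for c h
        by (simp add: X.R_scaleC A(2) complex_vector.scale_right_diff_distrib)
      show "X.R (\<pi> x h) - A (\<pi> x h) = \<pi> x (X.R h - A h)" for x h
        by (simp add: R\<pi> comm unitary_diff[OF un])
    qed (rule rep f)+
    then have eq: "X.R g = A g" for g by (rule eq_iff_diff_eq_0[THEN iffD2])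
    have "Re (cinner (A f) f) \<ge> 0" for f
      using X.R_nonneg[of f] arg_cong[OF eq[of f], of "\<lambda>z. Re (cinner z f)"] by linarith
    then show ?thesis by blast
  qed
qed

text \<open>Subtracting the value r of the quadratic form at a unit vector \<open>f0\<close> leaves
  an operator whose form has one sign, by \<open>irreducible_sign\<close>, and vanishes at
  \<open>f0\<close>. Then \<open>f0\<close> lies in its kernel, and by irreducibility so does
  everything.\<close>

lemma schur_selfadjoint:
  fixes \<pi> :: "'g::topological_group_add \<Rightarrow> 'h::complex_hilbert_space \<Rightarrow> 'h"
  assumes rep: "unitary_rep \<pi>" and irr: "irreducible_rep \<pi>"
    and B: "bounded_linear B" "\<And>c f. B (c *\<^sub>C f) = c *\<^sub>C B f" "\<And>f. norm (B f) \<le> norm f"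
    and sa: "\<And>f g. cinner (B f) g = cinner f (B g)"
    and comm: "\<And>x f. B (\<pi> x f) = \<pi> x (B f)"
  shows "\<exists>r::real. \<forall>f. B f = r *\<^sub>R f"
proof -
  interpret B: bounded_linear B by fact
  obtain f1 :: 'h where f1: "f1 \<noteq> 0" using irr unfolding irreducible_rep_def by blast
  define f0 where "f0 = f1 /\<^sub>R norm f1"
  have f0: "norm f0 = 1" "f0 \<noteq> 0" using f1 by (auto simp: f0_def)
  define r where "r = Re (cinner (B f0) f0)"
  have r: "\<bar>r\<bar> \<le> 1"
  proof -
    have "\<bar>r\<bar> \<le> norm (B f0) * norm f0"
      unfolding r_def using Cauchy_Schwarz_cinner abs_Re_le_cmod order_trans by blast
    then show ?thesis using B(3)[of f0] f0 by simp
  qed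
  \<comment> \<open>The factor 1/2 restores the contraction bound, as |r| is at most 1.\<close>
  define A where "A f = (1/2) *\<^sub>R (B f - r *\<^sub>R f)" for f
  have A: "bounded_linear A" "\<And>c f. A (c *\<^sub>C f) = c *\<^sub>C A f"
  proof -
    show "bounded_linear A"
      unfolding A_def
      by (intro bounded_linear_const_scaleR bounded_linear_sub B bounded_linear_scaleR_right)
    show "A (c *\<^sub>C f) = c *\<^sub>C A f" for c f
      by (simp add: A_def B scaleR_eq_scaleC scaleC_scaleC
        complex_vector.scale_right_diff_distrib mult.commute)
  qed
  interpret A: bounded_linear A by fact
  have A_norm: "norm (A f) \<le> norm f" for f
  proof -
    have "norm (B f - r *\<^sub>R f) \<le> norm (B f) + norm (r *\<^sub>R f)" by (rule norm_triangle_ineq4)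
    also have "\<dots> \<le> norm f + 1 * norm f"
      unfolding norm_scaleR by (intro add_mono B mult_right_mono r norm_ge_zero)
    finally show ?thesis by (simp add: A_def)
  qed
  have A_sa: "cinner (A f) g = cinner f (A g)" for f g
    by (simp add: A_def cinner_simps sa)
  have A_comm: "A (\<pi> x f) = \<pi> x (A f)" for x f
  proof -
    have "unitary (\<pi> x)" using rep by (simp add: unitary_rep_def)
    then show ?thesis by (simp add: A_def scaleR_eq_scaleC comm unitary_diff unitary_scaleC)
  qed
  have A0: "Re (cinner (A f0) f0) = 0"
    by (simp add: A_def cinner_simps cinner_self f0 r_def)
  \<comment> \<open>A form of one sign that vanishes at \<open>f0\<close> has no term of first order
    there: compare the orders t and t^2 at \<open>f0 + t *\<^sub>R g\<close>.\<close>
  have key: "Re (cinner (A f0) g) = 0" for g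
  proof -
    have expand: "Re (cinner (A (f0 + t *\<^sub>R g)) (f0 + t *\<^sub>R g))
        = 2 * t * Re (cinner (A f0) g) + t\<^sup>2 * Re (cinner (A g) g)" for t g
    proof -
      have "Re (cinner (A g) f0) = Re (cinner (A f0) g)"
        by (metis A_sa Re_cinner_commute)
      then show ?thesis
        by (simp add: A.add A.scaleR cinner_simps A0 power2_eq_square algebra_simps)
    qed
    from irreducible_sign[OF rep irr A A_norm A_sa A_comm]
    consider "\<And>f. Re (cinner (A f) f) \<ge> 0" | "\<And>f. Re (cinner (A f) f) \<le> 0" by blast
    then have "Re (cinner (A f0) g) \<le> 0" for g
    proof cases
      case 1
      have "- Re (cinner (A f0) g) \<le> 0" for g
      proof (rule le_0_if_small)
        fix t :: real assume t: "t > 0"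
        have "0 \<le> t * (2 * Re (cinner (A f0) g) + t * Re (cinner (A g) g))"
          using 1[of "f0 + t *\<^sub>R g"] unfolding expand by (simp add: power2_eq_square algebra_simps)
        then show "- Re (cinner (A f0) g) \<le> t * (Re (cinner (A g) g) / 2)"
          using t by (simp add: zero_le_mult_iff)
      qed
      from this[of "- g"] show ?thesis by simp
    next
      case 2
      show ?thesis
      proof (rule le_0_if_small)
        fix t :: real assume t: "t > 0"
        have "0 \<ge> t * (2 * Re (cinner (A f0) g) + t * Re (cinner (A g) g))"
          using 2[of "f0 + t *\<^sub>R g"] unfolding expand by (simp add: power2_eq_square algebra_simps)
        then show "Re (cinner (A f0) g) \<le> t * (- Re (cinner (A g) g) / 2)"
          using t by (simp add: mult_le_0_iff)
      qed
    qed
    from this[of g] this[of "- g"] show ?thesis by simp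
  qed
  have "A f0 = 0" using key[of "A f0"] by (simp add: cinner_self)
  then have "A f = 0" for f
    using irreducible_kernel[OF irr A A_comm rep] f0 by blast
  then show ?thesis by (auto simp: A_def)
qed

section \<open>Bi-invariant measures and the formal dimension\<close>

lemma measure_preserving_square_integrable:
  assumes T: "T \<in> measurable M M" "distr M M T = M" and F: "F \<in> borel_measurable M"
  shows "square_integrable M (\<lambda>x. F (T x)) \<longleftrightarrow> square_integrable M F"
    and "nsq M (\<lambda>x. F (T x)) = nsq M F"
proof -
  have F2: "(\<lambda>x. (cmod (F x))\<^sup>2) \<in> borel_measurable M" using F by measurable
  show "nsq M (\<lambda>x. F (T x)) = nsq M F"
    unfolding nsq_def using integral_distr[OF T(1) F2] T(2) by simp
  have "integrable M (\<lambda>x. (cmod (F (T x)))\<^sup>2) \<longleftrightarrow> integrable M (\<lambda>x. (cmod (F x))\<^sup>2)"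
    using integrable_distr_eq[OF T(1) F2] T(2) by simp
  moreover have "(\<lambda>x. F (T x)) \<in> borel_measurable M" using T F by measurable
  ultimately show "square_integrable M (\<lambda>x. F (T x)) \<longleftrightarrow> square_integrable M F"
    using F by (simp add: square_integrable_def)
qed

lemma borel_measurable_cnj [measurable]: "cnj \<in> borel_measurable borel"
  by (intro borel_measurable_continuous_onI continuous_intros)

lemma measure_preserving_ip:
  assumes T: "T \<in> measurable M M" "distr M M T = M"
    and F[measurable]: "F \<in> borel_measurable M" and G[measurable]: "G \<in> borel_measurable M"
  shows "ip M (\<lambda>x. F (T x)) (\<lambda>x. G (T x)) = ip M F G"
proof -
  have "(\<lambda>x. F x * cnj (G x)) \<in> borel_measurable M" by measurable
  from integral_distr[OF T(1) this] T(2) show ?thesis by (simp add: ip_def)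
qed

lemma square_integrable_cnj: "square_integrable M (\<lambda>x. cnj (F x)) \<longleftrightarrow> square_integrable M F"
proof -
  have "(\<lambda>x. cnj (F x)) \<in> borel_measurable M \<longleftrightarrow> F \<in> borel_measurable M"
  proof
    assume "(\<lambda>x. cnj (F x)) \<in> borel_measurable M"
    then have "(\<lambda>x. cnj (cnj (F x))) \<in> borel_measurable M" by measurable
    then show "F \<in> borel_measurable M" by simp
  qed measurable
  then show ?thesis by (simp add: square_integrable_def)
qed

lemma nsq_cnj: "nsq M (\<lambda>x. cnj (F x)) = nsq M F"
  by (simp add: nsq_def)

lemma borel_translate_right:
  fixes A :: "'g::{topological_group_add, second_countable_topology} set"
  assumes "A \<in> sets borel" shows "(\<lambda>x. x + a) ` A \<in> sets borel"
proof -
  have "(\<lambda>x. x + a) ` A = (\<lambda>x. x + - a) -` A \<inter> space borel"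
  proof (intro equalityI subsetI)
    fix x assume "x \<in> (\<lambda>x. x + - a) -` A \<inter> space borel"
    then show "x \<in> (\<lambda>x. x + a) ` A" by (intro image_eqI[of _ _ "x + - a"]) (auto simp: add.assoc)
  qed (auto simp: add.assoc)
  also have "\<dots> \<in> sets borel"
  proof (rule measurable_sets[OF _ assms])
    show "(\<lambda>x. x + - a) \<in> borel_measurable borel" by measurable
  qed
  finally show ?thesis .
qed

locale bi_invariant_measure =
  fixes \<mu> :: "'g::{topological_group_add, t2_space, second_countable_topology} measure"
  assumes sets_mu [measurable_cong]: "sets \<mu> = sets borel"
    and left: "\<And>a A. A \<in> sets borel \<Longrightarrow> emeasure \<mu> ((\<lambda>x. a + x) ` A) = emeasure \<mu> A"
    and right: "\<And>a A. A \<in> sets borel \<Longrightarrow> emeasure \<mu> ((\<lambda>x. x + a) ` A) = emeasure \<mu> A"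
    and sigma_finite_mu: "sigma_finite_measure \<mu>"
    and nonzero: "emeasure \<mu> UNIV \<noteq> 0"
begin

lemma space_mu [simp]: "space \<mu> = UNIV"
  using sets_eq_imp_space_eq[OF sets_mu] by simp

lemma uminus_measurable [measurable]: "uminus \<in> borel_measurable (borel :: 'g measure)"
  by (intro borel_measurable_continuous_onI continuous_intros)

lemma left_measurable: "(\<lambda>x. a + x) \<in> measurable \<mu> \<mu>" and
  right_measurable: "(\<lambda>x. x + a) \<in> measurable \<mu> \<mu>"
  by measurable

lemma distr_left: "distr \<mu> \<mu> (\<lambda>x. a + x) = \<mu>"
proof (rule measure_eqI)
  fix A assume "A \<in> sets (distr \<mu> \<mu> (\<lambda>x. a + x))"
  then have A: "A \<in> sets borel" by (simp add: sets_mu)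
  have "(\<lambda>x. a + x) -` A = (\<lambda>x. - a + x) ` A"
  proof (intro equalityI subsetI)
    fix x assume "x \<in> (\<lambda>x. a + x) -` A"
    then show "x \<in> (\<lambda>x. - a + x) ` A"
      by (intro image_eqI[of _ _ "a + x"]) (auto simp: add.assoc[symmetric])
  qed (auto simp: add.assoc[symmetric])
  then show "emeasure (distr \<mu> \<mu> (\<lambda>x. a + x)) A = emeasure \<mu> A"
    using A left[OF A, of "- a"] by (simp add: emeasure_distr left_measurable sets_mu)
qed simp

lemma distr_right: "distr \<mu> \<mu> (\<lambda>x. x + a) = \<mu>"
proof (rule measure_eqI)
  fix A assume "A \<in> sets (distr \<mu> \<mu> (\<lambda>x. x + a))"
  then have A: "A \<in> sets borel" by (simp add: sets_mu)
  have "(\<lambda>x. x + a) -` A = (\<lambda>x. x + - a) ` A"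
  proof (intro equalityI subsetI)
    fix x assume "x \<in> (\<lambda>x. x + a) -` A"
    then show "x \<in> (\<lambda>x. x + - a) ` A" by (intro image_eqI[of _ _ "x + a"]) (auto simp: add.assoc)
  qed (auto simp: add.assoc)
  then show "emeasure (distr \<mu> \<mu> (\<lambda>x. x + a)) A = emeasure \<mu> A"
    using A right[OF A, of "- a"] by (simp add: emeasure_distr right_measurable sets_mu)
qed simp

lemma nn_integral_left:
  assumes "f \<in> borel_measurable borel"
  shows "(\<integral>\<^sup>+x. f (a + x) \<partial>\<mu>) = (\<integral>\<^sup>+x. f x \<partial>\<mu>)"
  using nn_integral_distr[OF left_measurable[of a], of f] assms
  by (simp add: distr_left measurable_cong_sets[OF sets_mu refl])

lemma nn_integral_right:
  assumes "f \<in> borel_measurable borel"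
  shows "(\<integral>\<^sup>+x. f (x + a) \<partial>\<mu>) = (\<integral>\<^sup>+x. f x \<partial>\<mu>)"
  using nn_integral_distr[OF right_measurable[of a], of f] assms
  by (simp add: distr_right measurable_cong_sets[OF sets_mu refl])

text \<open>Evaluating \<open>\<integral>\<integral> f(x) g(yx) dx dy\<close> in two ways avoids the uniqueness of Haar measure.\<close>

lemma nn_integral_uminus:
  fixes f :: "'g \<Rightarrow> ennreal"
  assumes f[measurable]: "f \<in> borel_measurable borel"
  shows "(\<integral>\<^sup>+x. f (- x) \<partial>\<mu>) = (\<integral>\<^sup>+x. f x \<partial>\<mu>)"
proof -
  interpret sigma_finite_measure \<mu> by (rule sigma_finite_mu)
  interpret pair_sigma_finite \<mu> \<mu> by unfold_locales
  obtain A :: "nat \<Rightarrow> 'g set" where A: "range A \<subseteq> sets \<mu>" "(\<Union>i. A i) = space \<mu>"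
    "\<And>i. emeasure \<mu> (A i) \<noteq> \<infinity>"
    by (rule sigma_finite_measure.sigma_finite[OF sigma_finite_mu]) (rule that)
  \<comment> \<open>A set of finite nonzero measure, so that its measure can be cancelled at the
    end.\<close>
  have "\<exists>i. emeasure \<mu> (A i) \<noteq> 0"
  proof (rule ccontr)
    assume "\<not> ?thesis"
    then have "emeasure \<mu> (\<Union>i. A i) = 0" using A by (intro emeasure_UN_eq_0) auto
    then show False using nonzero A by simp
  qed
  then obtain i where i: "emeasure \<mu> (A i) \<noteq> 0" by blast
  define g :: "'g \<Rightarrow> ennreal" where "g = indicator (A i)"
  have g[measurable]: "g \<in> borel_measurable borel"
    using A(1) by (auto simp: g_def sets_mu)
  have G: "(\<integral>\<^sup>+x. g x \<partial>\<mu>) = emeasure \<mu> (A i)"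
    using A(1) by (auto simp: g_def)
  have "(\<integral>\<^sup>+y. (\<integral>\<^sup>+x. f x * g (y + x) \<partial>\<mu>) \<partial>\<mu>) = (\<integral>\<^sup>+x. (\<integral>\<^sup>+y. f x * g (y + x) \<partial>\<mu>) \<partial>\<mu>)"
    by (rule Fubini') measurable
  also have "\<dots> = (\<integral>\<^sup>+x. f x * (\<integral>\<^sup>+y. g y \<partial>\<mu>) \<partial>\<mu>)"
    by (intro nn_integral_cong) (simp add: nn_integral_cmult nn_integral_right[OF g])
  also have "\<dots> = (\<integral>\<^sup>+x. f x \<partial>\<mu>) * (\<integral>\<^sup>+y. g y \<partial>\<mu>)"
    by (simp add: nn_integral_multc)
  finally have 1: "(\<integral>\<^sup>+y. (\<integral>\<^sup>+x. f x * g (y + x) \<partial>\<mu>) \<partial>\<mu>) = (\<integral>\<^sup>+x. f x \<partial>\<mu>) * (\<integral>\<^sup>+y. g y \<partial>\<mu>)" .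
  have "(\<integral>\<^sup>+y. (\<integral>\<^sup>+x. f x * g (y + x) \<partial>\<mu>) \<partial>\<mu>) = (\<integral>\<^sup>+y. (\<integral>\<^sup>+x. f (- y + x) * g x \<partial>\<mu>) \<partial>\<mu>)"
  proof (rule nn_integral_cong)
    fix y
    have "(\<lambda>x. f x * g (y + x)) \<in> borel_measurable borel" by measurable
    from nn_integral_left[OF this, of "- y"]
    show "(\<integral>\<^sup>+x. f x * g (y + x) \<partial>\<mu>) = (\<integral>\<^sup>+x. f (- y + x) * g x \<partial>\<mu>)"
      by (simp add: add.assoc[symmetric])
  qed
  also have "\<dots> = (\<integral>\<^sup>+x. (\<integral>\<^sup>+y. f (- y + x) * g x \<partial>\<mu>) \<partial>\<mu>)"
    by (rule Fubini') measurable
  also have "\<dots> = (\<integral>\<^sup>+x. (\<integral>\<^sup>+y. f (- y) * g x \<partial>\<mu>) \<partial>\<mu>)"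
  proof (rule nn_integral_cong)
    fix x
    have "(\<lambda>y. f (- y + x) * g x) \<in> borel_measurable borel" by measurable
    from nn_integral_left[OF this, of x]
    show "(\<integral>\<^sup>+y. f (- y + x) * g x \<partial>\<mu>) = (\<integral>\<^sup>+y. f (- y) * g x \<partial>\<mu>)"
      by (simp add: minus_add add.assoc)
  qed
  also have "\<dots> = (\<integral>\<^sup>+x. f (- x) \<partial>\<mu>) * (\<integral>\<^sup>+y. g y \<partial>\<mu>)"
    by (simp add: nn_integral_multc nn_integral_cmult)
  finally have "(\<integral>\<^sup>+x. f x \<partial>\<mu>) * emeasure \<mu> (A i) = (\<integral>\<^sup>+x. f (- x) \<partial>\<mu>) * emeasure \<mu> (A i)"
    unfolding 1 G .
  then show ?thesis
    using i A(3)[of i] by (metis ennreal_mult_divide_eq infinity_ennreal_def)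
qed

lemma distr_uminus: "distr \<mu> \<mu> uminus = \<mu>"
proof (rule measure_eqI)
  fix A assume "A \<in> sets (distr \<mu> \<mu> uminus)"
  then have A[measurable]: "A \<in> sets borel" by (simp add: sets_mu)
  have m: "uminus \<in> measurable \<mu> \<mu>" by measurable
  have "emeasure (distr \<mu> \<mu> uminus) A = (\<integral>\<^sup>+x. indicator A x \<partial>distr \<mu> \<mu> uminus)"
    using A by (simp add: sets_mu)
  also have "\<dots> = (\<integral>\<^sup>+x. indicator A (- x) \<partial>\<mu>)"
    using A by (intro nn_integral_distr m) (simp add: sets_mu)
  also have "\<dots> = (\<integral>\<^sup>+x. indicator A x \<partial>\<mu>)" by (rule nn_integral_uminus) measurable
  finally show "emeasure (distr \<mu> \<mu> uminus) A = emeasure \<mu> A" using A by (simp add: sets_mu)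
qed simp

end

section \<open>Matrix coefficients and the orthogonality relations\<close>

locale discrete_series_rep = bi_invariant_measure \<mu>
  for \<mu> :: "'g::{topological_group_add, t2_space, second_countable_topology} measure" +
  fixes \<pi> :: "'g \<Rightarrow> 'h::complex_hilbert_space \<Rightarrow> 'h"
  assumes rep: "unitary_rep \<pi>" and irr: "irreducible_rep \<pi>" and sqint: "square_integrable_rep \<mu> \<pi>"
    and separable: "separable_space (euclidean :: 'h topology)"
begin

lemma pi_unitary: "unitary (\<pi> x)" and pi_add: "\<pi> (x + y) f = \<pi> x (\<pi> y f)"
  using rep by (auto simp: unitary_rep_def)

lemma pi_cinner [simp]: "cinner (\<pi> x f) (\<pi> x g) = cinner f g"
  by (rule unitary_cinner[OF pi_unitary])

lemma pi_inj: "\<pi> x f = \<pi> x g \<Longrightarrow> f = g"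
  using pi_cinner[of x "f - g" "f - g"] by (simp add: unitary_diff[OF pi_unitary])

lemma pi_0 [simp]: "\<pi> 0 f = f"
  using pi_add[of 0 0 f] pi_inj[of 0 "\<pi> 0 f" f] by simp

lemma pi_cancel [simp]: "\<pi> x (\<pi> (- x) f) = f" "\<pi> (- x) (\<pi> x f) = f"
  by (simp_all flip: pi_add)

lemma cinner_pi_left: "cinner (\<pi> x f) g = cinner f (\<pi> (- x) g)"
  using pi_cinner[of "- x" "\<pi> x f" g] by simp

lemma cinner_pi_right: "cinner f (\<pi> x g) = cinner (\<pi> (- x) f) g"
  by (simp add: cinner_pi_left)

lemma norm_pi [simp]: "norm (\<pi> x f) = norm f"
proof -
  have "complex_of_real ((norm (\<pi> x f))\<^sup>2) = complex_of_real ((norm f)\<^sup>2)"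
    unfolding cinner_self[symmetric] by simp
  then show ?thesis
    by (metis norm_ge_zero of_real_eq_iff power2_eq_imp_eq)
qed

lemma coef_measurable_borel [measurable]: "(\<lambda>x. cinner f (\<pi> x g)) \<in> borel_measurable borel"
proof -
  have [measurable]: "(\<lambda>x. cinner (\<pi> x g) f) \<in> borel_measurable borel"
    using rep by (simp add: unitary_rep_def)
  have "(\<lambda>x. cnj (cinner (\<pi> x g) f)) \<in> borel_measurable borel" by measurable
  then show ?thesis by (simp flip: cinner_commute)
qed

lemma coef_measurable: "(\<lambda>x. cinner f (\<pi> x g)) \<in> borel_measurable \<mu>"
  by measurable

abbreviation orb :: "'h \<Rightarrow> 'g \<Rightarrow> 'h" where "orb g \<equiv> (\<lambda>x. \<pi> x g)"

lemma coef_translate: "coef (orb g) (\<pi> y f) = (\<lambda>x. coef (orb g) f (- y + x))"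
  by (simp add: cinner_pi_left flip: pi_add)

text \<open>The resolvent at 1 of the analysis map commutes with all of \<open>\<pi>\<close>, so it
  is a scalar r by Schur's lemma, and r is not 0 because the domain is dense. Hence every vector
  lies in the range of the resolvent, therefore in the domain, and the form is (1 - r) / r times the
  squared norm.\<close>

lemma dense_domain_scalar:
  assumes dense: "closure (frame_domain \<mu> (orb g)) = UNIV"
  shows "\<exists>c. \<forall>f. square_integrable \<mu> (coef (orb g) f) \<and> nsq \<mu> (coef (orb g) f) = c * (norm f)\<^sup>2"
proof -
  interpret fr: frame_resolvent \<mu> "orb g" 1
    by unfold_locales (auto intro: coef_measurable)
  have dom_pi: "\<pi> y f \<in> frame_domain \<mu> (orb g)" if "f \<in> frame_domain \<mu> (orb g)" for y f
    using that measure_preserving_square_integrable(1)[OF left_measurable distr_left coef_measurable]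
    unfolding frame_domain_def by (simp add: coef_translate)
  have "fr.B (\<pi> y f) = \<pi> y (fr.B f)" for y f
  proof (rule fr.B_commute)
    show "\<pi> y ` frame_domain \<mu> (orb g) = frame_domain \<mu> (orb g)"
    proof (intro equalityI subsetI)
      fix f assume "f \<in> frame_domain \<mu> (orb g)"
      then show "f \<in> \<pi> y ` frame_domain \<mu> (orb g)"
        using dom_pi[of f "- y"] by (intro image_eqI[of _ _ "\<pi> (- y) f"]) auto
    qed (auto intro: dom_pi)
    show "ip \<mu> (coef (orb g) (\<pi> y f)) (coef (orb g) (\<pi> y f')) = ip \<mu> (coef (orb g) f) (coef (orb g) f')"
      for f f'
      unfolding coef_translate
      by (rule measure_preserving_ip[OF left_measurable distr_left coef_measurable coef_measurable])
  qed simp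
  then obtain r where r: "\<And>f. fr.B f = r *\<^sub>R f"
    using schur_selfadjoint[OF rep irr, of fr.B] fr.bounded_clinear_B fr.norm_B_le fr.B_selfadjoint
    unfolding bounded_clinear_def by blast
  obtain u :: 'h where u: "u \<noteq> 0" using irr unfolding irreducible_rep_def by blast
  have "r \<noteq> 0" using fr.B_inj[OF dense, of u] r[of u] u by auto
  have sq: "square_integrable \<mu> (coef (orb g) f)" for f
  proof -
    have "f = fr.B (f /\<^sub>R r)" using \<open>r \<noteq> 0\<close> by (simp add: r)
    then show ?thesis using fr.B_square_integrable by metis
  qed
  have "nsq \<mu> (coef (orb g) f) = ((1 - r) / r) * (norm f)\<^sup>2" for f
  proof -
    have "f \<in> frame_domain \<mu> (orb g)" using sq by (simp add: frame_domain_def)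
    from fr.B_eq[OF this, of f]
    have "complex_of_real (r * (norm f)\<^sup>2 + r * nsq \<mu> (coef (orb g) f)) = complex_of_real ((norm f)\<^sup>2)"
      by (simp add: r cinner_simps ip_cmult_left ip_self cinner_self)
    then have "r * (norm f)\<^sup>2 + r * nsq \<mu> (coef (orb g) f) = (norm f)\<^sup>2"
      by (rule of_real_eq_iff[THEN iffD1])
    then show ?thesis using \<open>r \<noteq> 0\<close> by (simp add: field_simps)
  qed
  then show ?thesis using sq by blast
qed

lemma coef_flip: "coef (orb g) f = (\<lambda>x. cnj (coef (orb f) g (- x)))"
  by (rule ext) (metis cinner_commute cinner_pi_left minus_minus)

text \<open>Inversion preserves the measure and, up to conjugation, exchanges f and g. This is where
  unimodularity enters the orthogonality relations.\<close>

lemma square_integrable_flip: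
  "square_integrable \<mu> (coef (orb g) f) \<longleftrightarrow> square_integrable \<mu> (coef (orb f) g)"
  and nsq_flip: "nsq \<mu> (coef (orb g) f) = nsq \<mu> (coef (orb f) g)"
proof -
  have m: "uminus \<in> measurable \<mu> \<mu>" by measurable
  show "square_integrable \<mu> (coef (orb g) f) \<longleftrightarrow> square_integrable \<mu> (coef (orb f) g)"
    using measure_preserving_square_integrable(1)[OF m distr_uminus coef_measurable[of g f]]
    by (subst coef_flip) (simp add: square_integrable_cnj)
  show "nsq \<mu> (coef (orb g) f) = nsq \<mu> (coef (orb f) g)"
    using measure_preserving_square_integrable(2)[OF m distr_uminus coef_measurable[of g f]]
    by (subst coef_flip) (simp add: nsq_cnj)
qed

text \<open>Square integrability is given for g in a dense set and all f. After the flip this says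
  that for every g the analysis map has a dense domain.\<close>

lemma matrix_coefficients_scalar:
  "\<exists>c. \<forall>f. square_integrable \<mu> (coef (orb g) f) \<and> nsq \<mu> (coef (orb g) f) = c * (norm f)\<^sup>2"
proof (rule dense_domain_scalar)
  obtain D where D: "closure D = UNIV" "\<And>f g. g \<in> D \<Longrightarrow> square_integrable \<mu> (coef (orb g) f)"
    using sqint unfolding square_integrable_rep_def by blast
  have "D \<subseteq> frame_domain \<mu> (orb g)"
    using D(2) square_integrable_flip by (auto simp: frame_domain_def)
  then show "closure (frame_domain \<mu> (orb g)) = UNIV"
    using D(1) closure_mono by blast
qed

text \<open>Separability makes the exceptional null set independent of f, and since the measure is
  nonzero some x lies outside of it.\<close>

lemma ae_zero_imp_zero:
  assumes "\<And>f. AE x in \<mu>. cinner f (\<pi> x g) = 0"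
  shows "g = 0"
proof -
  obtain S :: "'h set" where S: "countable S" "closure S = UNIV"
    using separable by (auto simp: separable_space_def)
  have ae: "AE x in \<mu>. \<forall>f\<in>S. cinner f (\<pi> x g) = 0"
    using assms S(1) by (simp add: AE_ball_countable)
  have "ae_filter \<mu> \<noteq> bot" using nonzero by (simp add: ae_filter_eq_bot_iff)
  then obtain x where "\<forall>f\<in>S. cinner f (\<pi> x g) = 0"
    using eventually_happens'[OF _ ae] by blast
  then have "\<pi> x g = 0"
    using orthogonal_dense_eq_0[OF S(2), of "\<pi> x g"] cinner_eq_0_commute by blast
  then have "norm (\<pi> x g) = 0" by simp
  then show ?thesis by simp
qed

text \<open>The factor l(g) in front of the squared norm of f is found by flipping: for a unit
  vector u it equals l(u) times the squared norm of g.\<close>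

lemma orthogonality_norm:
  "\<exists>c>0. \<forall>f g. square_integrable \<mu> (coef (orb g) f) \<and>
     nsq \<mu> (coef (orb g) f) = c * (norm f)\<^sup>2 * (norm g)\<^sup>2"
proof -
  obtain l where l: "\<And>f g. square_integrable \<mu> (coef (orb g) f)"
    "\<And>f g. nsq \<mu> (coef (orb g) f) = l g * (norm f)\<^sup>2"
    using matrix_coefficients_scalar by metis
  obtain u1 :: 'h where u1: "u1 \<noteq> 0" using irr unfolding irreducible_rep_def by blast
  define u where "u = u1 /\<^sub>R norm u1"
  have u: "norm u = 1" using u1 by (simp add: u_def)
  define c where "c = l u"
  have lg: "l g = c * (norm g)\<^sup>2" for g
    using nsq_flip[of g u] l(2)[of g u] l(2)[of u g] u by (simp add: c_def)
  have "c \<ge> 0" using l(2)[of u u] u nsq_nonneg[of \<mu> "coef (orb u) u"] by (simp add: c_def)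
  moreover have "c \<noteq> 0"
  proof
    assume "c = 0"
    have "AE x in \<mu>. cinner f (\<pi> x u) = 0" for f
    proof -
      have "(\<integral>x. (cmod (cinner f (\<pi> x u)))\<^sup>2 \<partial>\<mu>) = 0"
        using l(2)[where f = f and g = u] \<open>c = 0\<close> by (simp add: nsq_def c_def)
      moreover have int: "integrable \<mu> (\<lambda>x. (cmod (cinner f (\<pi> x u)))\<^sup>2)"
        using l(1) by (simp add: square_integrable_def)
      ultimately have "AE x in \<mu>. (cmod (cinner f (\<pi> x u)))\<^sup>2 = 0"
        using integral_nonneg_eq_0_iff_AE[OF int] by simp
      then show ?thesis by simp
    qed
    then have "u = 0" by (rule ae_zero_imp_zero)
    then show False using u by simp
  qed
  ultimately have "c > 0" by simp
  then show ?thesis using l lg by (metis mult.commute mult.assoc)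
qed

text \<open>The reciprocal of the formal dimension, by \<open>formal_dimension_eq\<close>, and the
  constant c of the overview.\<close>

definition form_const :: real where
  "form_const = (SOME c. c > 0 \<and> (\<forall>f g. square_integrable \<mu> (coef (orb g) f) \<and>
     nsq \<mu> (coef (orb g) f) = c * (norm f)\<^sup>2 * (norm g)\<^sup>2))"

lemma form_const_pos: "form_const > 0"
  and coef_square_integrable: "square_integrable \<mu> (coef (orb g) f)"
  and nsq_coef: "nsq \<mu> (coef (orb g) f) = form_const * (norm f)\<^sup>2 * (norm g)\<^sup>2"
  using someI_ex[OF orthogonality_norm] unfolding form_const_def by blast+

text \<open>Two polarisations of the norm identity, in f and g for a fixed u, and then in the orbit
  vectors.\<close>

lemma orthogonality:
  "ip \<mu> (coef (orb u) f) (coef (orb v) g) = form_const * cinner f g * cinner v u"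
proof -
  have half: "ip \<mu> (coef (orb u) f) (coef (orb u) g) = form_const * cinner f g * (norm u)\<^sup>2" for f g u
  proof -
    have "ip \<mu> (coef (orb u) f) (coef (orb u) g) - form_const * cinner f g * (norm u)\<^sup>2 = 0"
      by (rule sesquilinear_polarization)
         (auto simp: cinner_simps ip_add_left ip_add_right ip_cmult_left ip_cmult_right
           coef_square_integrable ip_self nsq_coef cinner_self algebra_simps)
    then show ?thesis by simp
  qed
  have "ip \<mu> (coef (orb u) f) (coef (orb v) g) - form_const * cinner f g * cinner v u = 0" for u v
    \<comment> \<open>The expression is conjugate linear in u and linear in v, hence the exchanged
      order of the arguments.\<close>
    by (rule sesquilinear_polarization[of
          "\<lambda>v u. ip \<mu> (coef (orb u) f) (coef (orb v) g) - form_const * cinner f g * cinner v u"])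
       (auto simp: cinner_simps unitary_add[OF pi_unitary] unitary_scaleC[OF pi_unitary]
          ip_add_left ip_add_right ip_cmult_left ip_cmult_right coef_square_integrable half
          cinner_self algebra_simps)
  then show ?thesis by simp
qed

lemma formal_dimension_eq: "formal_dimension \<mu> \<pi> = 1 / form_const"
  unfolding formal_dimension_def
proof (rule the_equality)
  have rewrite: "(\<integral>x. cinner (\<pi> x f1) g1 * cnj (cinner (\<pi> x f2) g2) \<partial>\<mu>)
      = form_const * cinner f1 f2 * cnj (cinner g1 g2)" for f1 f2 g1 g2
  proof -
    have "cinner (\<pi> x f1) g1 * cnj (cinner (\<pi> x f2) g2)
        = coef (orb f2) g2 x * cnj (coef (orb f1) g1 x)" for x
      by (metis cinner_commute mult.commute)
    then have "(\<integral>x. cinner (\<pi> x f1) g1 * cnj (cinner (\<pi> x f2) g2) \<partial>\<mu>)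
        = ip \<mu> (coef (orb f2) g2) (coef (orb f1) g1)" by (simp add: ip_def)
    also have "\<dots> = form_const * cinner g2 g1 * cinner f1 f2" by (rule orthogonality)
    finally show ?thesis by (simp flip: cinner_commute)
  qed
  show "1 / form_const > 0 \<and> (\<forall>f\<^sub>1 f\<^sub>2 g\<^sub>1 g\<^sub>2.
        (\<integral>x. cinner (\<pi> x f\<^sub>1) g\<^sub>1 * cnj (cinner (\<pi> x f\<^sub>2) g\<^sub>2) \<partial>\<mu>) =
        complex_of_real (inverse (1 / form_const)) * cinner f\<^sub>1 f\<^sub>2 * cnj (cinner g\<^sub>1 g\<^sub>2))"
    using form_const_pos by (simp add: rewrite)
  fix d assume d: "d > 0 \<and> (\<forall>f\<^sub>1 f\<^sub>2 g\<^sub>1 g\<^sub>2.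
        (\<integral>x. cinner (\<pi> x f\<^sub>1) g\<^sub>1 * cnj (cinner (\<pi> x f\<^sub>2) g\<^sub>2) \<partial>\<mu>) =
        complex_of_real (inverse d) * cinner f\<^sub>1 f\<^sub>2 * cnj (cinner g\<^sub>1 g\<^sub>2))"
  obtain u :: 'h where u: "u \<noteq> 0" using irr unfolding irreducible_rep_def by blast
  have "complex_of_real form_const * cinner u u * cnj (cinner u u)
      = complex_of_real (inverse d) * cinner u u * cnj (cinner u u)"
    using d rewrite by metis
  then have "complex_of_real form_const = complex_of_real (inverse d)" using u by simp
  then have "form_const = inverse d" by (rule of_real_eq_iff[THEN iffD1])
  then show "d = 1 / form_const" by (simp add: divide_inverse)
qed

end

section \<open>Restriction to a lattice\<close>

lemma bij_square_integrable:
  assumes "bij_betw g A B"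
  shows "square_integrable (count_space A) (\<lambda>x. F (g x)) \<longleftrightarrow> square_integrable (count_space B) F"
    and "nsq (count_space A) (\<lambda>x. F (g x)) = nsq (count_space B) F"
    and "ip (count_space A) (\<lambda>x. F (g x)) (\<lambda>x. G (g x)) = ip (count_space B) F G"
  using integrable_bij_count_space[OF assms, of "\<lambda>x. (cmod (F x))\<^sup>2"]
    integral_bij_count_space[OF assms, of "\<lambda>x. (cmod (F x))\<^sup>2"]
    integral_bij_count_space[OF assms, of "\<lambda>x. F x * cnj (G x)"]
  by (auto simp: square_integrable_def nsq_def ip_def)

lemma nsq_pointwise_le:
  assumes "square_integrable (count_space A) F" "a \<in> A"
  shows "(cmod (F a))\<^sup>2 \<le> nsq (count_space A) F"
proof -
  have int: "integrable (count_space A) (\<lambda>x. (cmod (F x))\<^sup>2)"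
    using assms by (simp add: square_integrable_def)
  have eq: "(\<integral>x. (cmod (F x))\<^sup>2 * indicator {a} x \<partial>count_space A) = (cmod (F a))\<^sup>2"
  proof -
    have "(\<lambda>x. (cmod (F x))\<^sup>2 * indicator {a} x) = (\<lambda>x. (cmod (F a))\<^sup>2 * indicator {a} x)"
      by (auto simp: indicator_def)
    then show ?thesis using assms(2) by (simp add: measure_count_space)
  qed
  have "(\<integral>x. (cmod (F x))\<^sup>2 * indicator {a} x \<partial>count_space A) \<le> nsq (count_space A) F"
    unfolding nsq_def using int assms(2)
    by (intro integral_mono integrable_real_mult_indicator) (auto simp: indicator_def)
  then show ?thesis by (simp only: eq)
qed

lemma nsq_mono:
  assumes "square_integrable M F" "G \<in> borel_measurable M"
    and "\<And>x. x \<in> space M \<Longrightarrow> cmod (G x) \<le> cmod (F x)"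
  shows "square_integrable M G" "nsq M G \<le> nsq M F"
proof -
  have "(\<integral>\<^sup>+x. ennreal ((cmod (G x))\<^sup>2) \<partial>M) \<le> (\<integral>\<^sup>+x. ennreal ((cmod (F x))\<^sup>2) \<partial>M)"
    using assms(3) by (intro nn_integral_mono ennreal_leI power_mono) auto
  then have "(\<integral>\<^sup>+x. ennreal ((cmod (G x))\<^sup>2) \<partial>M) \<le> ennreal (nsq M F)"
    by (simp add: nn_integral_cmod_sq[OF assms(1)])
  then show "square_integrable M G" "nsq M G \<le> nsq M F"
    using square_integrableI_nn[OF assms(2)] by auto
qed

lemma square_integrable_count_space_eq_0:
  assumes "square_integrable (count_space A) F" "nsq (count_space A) F = 0" "a \<in> A"
  shows "F a = 0"
  using nsq_pointwise_le[OF assms(1,3)] assms(2) by simp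

locale lattice_rep = discrete_series_rep \<mu> \<pi>
  for \<mu> :: "'g::{topological_group_add, t2_space, second_countable_topology} measure"
    and \<pi> :: "'g \<Rightarrow> 'h::complex_hilbert_space \<Rightarrow> 'h" +
  fixes \<Gamma> \<Omega> :: "'g set"
  assumes subgroup: "is_subgroup \<Gamma>" and countable: "countable \<Gamma>"
    and domain: "right_fundamental_domain \<mu> \<Gamma> \<Omega>" and icc: "icc \<Gamma>"
begin

lemma zero_in: "0 \<in> \<Gamma>" and add_in: "x \<in> \<Gamma> \<Longrightarrow> y \<in> \<Gamma> \<Longrightarrow> x + y \<in> \<Gamma>"
  and uminus_in: "x \<in> \<Gamma> \<Longrightarrow> - x \<in> \<Gamma>"
  using subgroup by (auto simp: is_subgroup_def)

lemma diff_in: "x \<in> \<Gamma> \<Longrightarrow> y \<in> \<Gamma> \<Longrightarrow> x - y \<in> \<Gamma>"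
  using add_in[of x "- y"] uminus_in[of y] by simp

lemma bij_left: "a \<in> \<Gamma> \<Longrightarrow> bij_betw (\<lambda>x. a + x) \<Gamma> \<Gamma>"
  by (rule bij_betw_byWitness[of _ "\<lambda>x. - a + x"])
     (auto simp: add.assoc[symmetric] intro: add_in uminus_in)

lemma bij_right: "a \<in> \<Gamma> \<Longrightarrow> bij_betw (\<lambda>x. x + a) \<Gamma> \<Gamma>"
  by (rule bij_betw_byWitness[of _ "\<lambda>x. x - a"]) (auto intro: add_in diff_in)

lemma bij_uminus: "bij_betw uminus \<Gamma> \<Gamma>"
  by (rule bij_betw_byWitness[of _ uminus]) (auto intro: uminus_in)

lemma bij_conj: "a \<in> \<Gamma> \<Longrightarrow> bij_betw (\<lambda>x. a + x + - a) \<Gamma> \<Gamma>"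
  using bij_betw_trans[OF bij_left[of a] bij_right[of "- a"]] by (simp add: o_def uminus_in)

abbreviation "\<L> \<equiv> count_space \<Gamma>"

definition \<nu> :: "'g measure" where "\<nu> = restrict_space \<mu> \<Omega>"

definition vol :: real where "vol = measure \<mu> \<Omega>"

lemma Omega_borel [measurable]: "\<Omega> \<in> sets borel" and Omega_sets: "\<Omega> \<in> sets \<mu>"
  and emeasure_Omega: "emeasure \<mu> \<Omega> = ennreal vol"
  using domain by (auto simp: right_fundamental_domain_def sets_mu vol_def emeasure_eq_ennreal_measure)

lemma nn_integral_nu: "(\<integral>\<^sup>+x. f x \<partial>\<nu>) = (\<integral>\<^sup>+x. f x * indicator \<Omega> x \<partial>\<mu>)"
  unfolding \<nu>_def by (rule nn_integral_restrict_space) (simp add: Omega_sets)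

lemma emeasure_nu: "emeasure \<nu> (space \<nu>) = ennreal vol"
  by (simp add: \<nu>_def space_restrict_space emeasure_restrict_space Omega_sets emeasure_Omega)

lemma measurable_nu: "f \<in> borel_measurable borel \<Longrightarrow> f \<in> borel_measurable \<nu>"
  unfolding \<nu>_def by (intro measurable_restrict_space1) (simp add: measurable_cong_sets[OF sets_mu refl])

lemma finite_measure_nu: "finite_measure \<nu>"
  by (rule finite_measureI) (simp add: emeasure_nu)

text \<open>Each x lies in exactly one translate of \<Omega>, so inserting the sum of their
  indicators changes nothing. The sum over the countable group is exchanged with the integral, and
  right invariance moves each translate back to \<Omega>.\<close>

lemma fundamental_unfold:
  fixes F :: "'g \<Rightarrow> ennreal"
  assumes F[measurable]: "F \<in> borel_measurable borel"
  shows "(\<integral>\<^sup>+x. F x \<partial>\<mu>) = (\<integral>\<^sup>+x. (\<integral>\<^sup>+\<gamma>. F (x + \<gamma>) \<partial>\<L>) \<partial>\<nu>)"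
proof -
  have trans: "(\<lambda>x. x + \<gamma>) ` \<Omega> \<in> sets borel" for \<gamma>
    by (rule borel_translate_right) (rule Omega_borel)
  have one: "(\<integral>\<^sup>+\<gamma>. indicator ((\<lambda>x. x + \<gamma>) ` \<Omega>) x \<partial>\<L>) = (1::ennreal)" for x
  proof -
    obtain \<gamma>0 where g0: "\<gamma>0 \<in> \<Gamma>" "x \<in> (\<lambda>x. x + \<gamma>0) ` \<Omega>"
      using domain unfolding right_fundamental_domain_def by blast
    have "(\<integral>\<^sup>+\<gamma>. indicator ((\<lambda>x. x + \<gamma>) ` \<Omega>) x \<partial>\<L>) = (\<integral>\<^sup>+\<gamma>. indicator {\<gamma>0} \<gamma> \<partial>\<L>)"
    proof (rule nn_integral_cong)
      fix \<gamma> assume "\<gamma> \<in> space \<L>"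
      then have "x \<in> (\<lambda>x. x + \<gamma>) ` \<Omega> \<longleftrightarrow> \<gamma> = \<gamma>0"
        using domain g0 unfolding right_fundamental_domain_def space_count_space
        by (metis (no_types, lifting) disjoint_iff)
      then show "indicator ((\<lambda>x. x + \<gamma>) ` \<Omega>) x = (indicator {\<gamma>0} \<gamma> :: ennreal)"
        by (simp add: indicator_def)
    qed
    also have "\<dots> = 1" using g0 by simp
    finally show ?thesis .
  qed
  have "(\<integral>\<^sup>+x. F x \<partial>\<mu>) = (\<integral>\<^sup>+x. (\<integral>\<^sup>+\<gamma>. F x * indicator ((\<lambda>x. x + \<gamma>) ` \<Omega>) x \<partial>\<L>) \<partial>\<mu>)"
    by (simp add: nn_integral_cmult one)
  also have "\<dots> = (\<integral>\<^sup>+\<gamma>. (\<integral>\<^sup>+x. F x * indicator ((\<lambda>x. x + \<gamma>) ` \<Omega>) x \<partial>\<mu>) \<partial>\<L>)"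
    using trans by (intro nn_integral_count_space_nn_integral countable) (simp add: sets_mu)
  also have "\<dots> = (\<integral>\<^sup>+\<gamma>. (\<integral>\<^sup>+x. F (x + \<gamma>) * indicator \<Omega> x \<partial>\<mu>) \<partial>\<L>)"
  proof (rule nn_integral_cong)
    fix \<gamma>
    have "(\<lambda>x. F x * indicator ((\<lambda>x. x + \<gamma>) ` \<Omega>) x) \<in> borel_measurable borel"
      using trans[of \<gamma>] by measurable
    from nn_integral_right[OF this, of \<gamma>]
    have "(\<integral>\<^sup>+x. F x * indicator ((\<lambda>x. x + \<gamma>) ` \<Omega>) x \<partial>\<mu>)
        = (\<integral>\<^sup>+x. F (x + \<gamma>) * indicator ((\<lambda>x. x + \<gamma>) ` \<Omega>) (x + \<gamma>) \<partial>\<mu>)" by simp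
    also have "\<dots> = (\<integral>\<^sup>+x. F (x + \<gamma>) * indicator \<Omega> x \<partial>\<mu>)"
      by (intro nn_integral_cong) (auto simp: indicator_def)
    finally show "(\<integral>\<^sup>+x. F x * indicator ((\<lambda>x. x + \<gamma>) ` \<Omega>) x \<partial>\<mu>)
        = (\<integral>\<^sup>+x. F (x + \<gamma>) * indicator \<Omega> x \<partial>\<mu>)" .
  qed
  also have "\<dots> = (\<integral>\<^sup>+x. (\<integral>\<^sup>+\<gamma>. F (x + \<gamma>) * indicator \<Omega> x \<partial>\<L>) \<partial>\<mu>)"
    by (intro nn_integral_count_space_nn_integral[symmetric] countable) measurable
  also have "\<dots> = (\<integral>\<^sup>+x. (\<integral>\<^sup>+\<gamma>. F (x + \<gamma>) \<partial>\<L>) \<partial>\<nu>)"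
    unfolding nn_integral_nu by (simp add: nn_integral_multc)
  finally show ?thesis .
qed

section \<open>Averages over the fundamental domain and the density of Bessel vectors\<close>

lemma trace_nn:
  "(\<integral>\<^sup>+\<omega>. (\<integral>\<^sup>+\<gamma>. ennreal ((cmod (cinner (\<pi> (- \<omega>) h) (\<pi> \<gamma> u)))\<^sup>2) \<partial>\<L>) \<partial>\<nu>)
     = ennreal (form_const * (norm h)\<^sup>2 * (norm u)\<^sup>2)"
proof -
  have "(\<integral>\<^sup>+\<omega>. (\<integral>\<^sup>+\<gamma>. ennreal ((cmod (cinner (\<pi> (- \<omega>) h) (\<pi> \<gamma> u)))\<^sup>2) \<partial>\<L>) \<partial>\<nu>)
      = (\<integral>\<^sup>+\<omega>. (\<integral>\<^sup>+\<gamma>. ennreal ((cmod (cinner h (\<pi> (\<omega> + \<gamma>) u)))\<^sup>2) \<partial>\<L>) \<partial>\<nu>)"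
    by (simp add: cinner_pi_left pi_add)
  also have "\<dots> = (\<integral>\<^sup>+x. ennreal ((cmod (cinner h (\<pi> x u)))\<^sup>2) \<partial>\<mu>)"
    by (rule fundamental_unfold[symmetric]) measurable
  finally show ?thesis
    by (simp add: nn_integral_cmod_sq[OF coef_square_integrable] nsq_coef)
qed

lemma coef_nu_measurable: "(\<lambda>\<omega>. cinner f (\<pi> (- \<omega>) h)) \<in> borel_measurable \<nu>"
  by (rule measurable_nu) measurable

lemma bessel_nu: "bessel \<nu> (\<lambda>\<omega>. \<pi> (- \<omega>) h) (vol * (norm h)\<^sup>2)"
  unfolding bessel_def
proof (intro allI)
  fix f
  have "(\<integral>\<^sup>+\<omega>. ennreal ((cmod (cinner f (\<pi> (- \<omega>) h)))\<^sup>2) \<partial>\<nu>)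
      \<le> (\<integral>\<^sup>+\<omega>. ennreal ((norm f * norm h)\<^sup>2) \<partial>\<nu>)"
    using Cauchy_Schwarz_cinner[of f "\<pi> (- _) h"]
    by (intro nn_integral_mono ennreal_leI power_mono) auto
  also have "\<dots> = ennreal (vol * (norm h)\<^sup>2 * (norm f)\<^sup>2)"
    by (simp add: emeasure_nu ennreal_mult[symmetric] vol_def power_mult_distrib mult_ac)
  finally have "(\<integral>\<^sup>+\<omega>. ennreal ((cmod (cinner f (\<pi> (- \<omega>) h)))\<^sup>2) \<partial>\<nu>)
      \<le> ennreal (vol * (norm h)\<^sup>2 * (norm f)\<^sup>2)" .
  from square_integrableI_nn[OF coef_nu_measurable this]
  show "square_integrable \<nu> (coef (\<lambda>\<omega>. \<pi> (- \<omega>) h) f) \<and>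
      nsq \<nu> (coef (\<lambda>\<omega>. \<pi> (- \<omega>) h) f) \<le> vol * (norm h)\<^sup>2 * (norm f)\<^sup>2"
    by (simp add: vol_def)
qed

text \<open>The double integral of \<open>trace_nn\<close> in the other order. For the averaged
  operator K that sends f to the integral over \<Omega> of \<langle>f, \<pi>(-\<omega>)h\<rangle>
  \<pi>(-\<omega>)h it states that the numbers \<langle>K \<pi>(-\<gamma>)f,
  \<pi>(-\<gamma>)f\<rangle> have a finite sum over \<Gamma>.\<close>

lemma trace_swap:
  "(\<integral>\<^sup>+\<gamma>. ennreal (nsq \<nu> (coef (\<lambda>\<omega>. \<pi> (- \<omega>) h) (\<pi> (- \<gamma>) f))) \<partial>\<L>)
     = ennreal (form_const * (norm h)\<^sup>2 * (norm f)\<^sup>2)"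
proof -
  let ?n = "\<lambda>\<gamma> \<omega>. ennreal ((cmod (cinner (\<pi> \<gamma> f) (\<pi> (- \<omega>) h)))\<^sup>2)"
  have "(\<integral>\<^sup>+\<gamma>. ennreal (nsq \<nu> (coef (\<lambda>\<omega>. \<pi> (- \<omega>) h) (\<pi> (- \<gamma>) f))) \<partial>\<L>)
      = (\<integral>\<^sup>+\<gamma>. (\<integral>\<^sup>+\<omega>. ?n (- \<gamma>) \<omega> \<partial>\<nu>) \<partial>\<L>)"
    using bessel_nu by (simp add: nn_integral_cmod_sq bessel_def)
  also have "\<dots> = (\<integral>\<^sup>+\<gamma>. (\<integral>\<^sup>+\<omega>. ?n \<gamma> \<omega> \<partial>\<nu>) \<partial>\<L>)"
    by (rule nn_integral_bij_count_space[OF bij_uminus])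
  also have "\<dots> = (\<integral>\<^sup>+\<omega>. (\<integral>\<^sup>+\<gamma>. ?n \<gamma> \<omega> \<partial>\<L>) \<partial>\<nu>)"
  proof (rule nn_integral_count_space_nn_integral[symmetric, OF countable])
    fix \<gamma>
    have [measurable]: "(\<lambda>\<omega>. cinner (\<pi> \<gamma> f) (\<pi> (- \<omega>) h)) \<in> borel_measurable \<nu>"
      by (rule coef_nu_measurable)
    show "?n \<gamma> \<in> borel_measurable \<nu>" by measurable
  qed
  finally show ?thesis
    by (subst trace_nn[symmetric]) (simp add: cmod_cinner_commute)
qed

definition bessel_vectors :: "'h set" where
  "bessel_vectors = {u. \<exists>b. bessel \<L> (orb u) b}"

text \<open>The Cauchy-Schwarz inequality for the positive form of the averaged operator K bounds
  |\<langle>Ku, \<pi>(-\<gamma>)f\<rangle>|^2 by \<langle>Ku, u\<rangle> times \<langle>K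
  \<pi>(-\<gamma>)f, \<pi>(-\<gamma>)f\<rangle>, and \<open>trace_swap\<close> sums the latter. So
  the range of K consists of Bessel vectors.\<close>

lemma averaged_bessel:
  "synthesis \<nu> (\<lambda>\<omega>. \<pi> (- \<omega>) h) (coef (\<lambda>\<omega>. \<pi> (- \<omega>) h) u) \<in> bessel_vectors"
proof -
  let ?\<kappa> = "\<lambda>\<omega>. \<pi> (- \<omega>) h"
  let ?g = "synthesis \<nu> ?\<kappa> (coef ?\<kappa> u)"
  have sq: "square_integrable \<nu> (coef ?\<kappa> f)" for f using bessel_nu by (simp add: bessel_def)
  note g = cinner_synthesis[OF bessel_nu sq]
  define b where "b = nsq \<nu> (coef ?\<kappa> u) * (form_const * (norm h)\<^sup>2)"
  have b: "b \<ge> 0" using form_const_pos by (simp add: b_def)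
  have "square_integrable \<L> (coef (orb ?g) f) \<and> nsq \<L> (coef (orb ?g) f) \<le> b * (norm f)\<^sup>2" for f
  proof -
    have "(cmod (cinner f (\<pi> \<gamma> ?g)))\<^sup>2 \<le> nsq \<nu> (coef ?\<kappa> u) * nsq \<nu> (coef ?\<kappa> (\<pi> (- \<gamma>) f))" for \<gamma>
    proof -
      have "cmod (cinner f (\<pi> \<gamma> ?g)) = cmod (cinner ?g (\<pi> (- \<gamma>) f))"
        by (subst cinner_pi_right) (rule cmod_cinner_commute)
      then show ?thesis
        using Cauchy_Schwarz_ip[OF sq sq, of u "\<pi> (- \<gamma>) f"] by (simp add: g)
    qed
    then have "(\<integral>\<^sup>+\<gamma>. ennreal ((cmod (cinner f (\<pi> \<gamma> ?g)))\<^sup>2) \<partial>\<L>)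
        \<le> (\<integral>\<^sup>+\<gamma>. ennreal (nsq \<nu> (coef ?\<kappa> u) * nsq \<nu> (coef ?\<kappa> (\<pi> (- \<gamma>) f))) \<partial>\<L>)"
      by (intro nn_integral_mono ennreal_leI)
    also have "\<dots> = ennreal (nsq \<nu> (coef ?\<kappa> u)) * ennreal (form_const * (norm h)\<^sup>2 * (norm f)\<^sup>2)"
      unfolding trace_swap[symmetric] by (subst nn_integral_cmult[symmetric]) (auto simp: ennreal_mult)
    also have "\<dots> = ennreal (b * (norm f)\<^sup>2)"
      using form_const_pos by (simp add: ennreal_mult[symmetric] b_def mult.assoc)
    finally show ?thesis using square_integrableI_nn[of "coef (orb ?g) f" \<L>] b by auto
  qed
  then show ?thesis unfolding bessel_vectors_def bessel_def by blast
qed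

lemma bessel_pi:
  assumes "bessel \<L> (orb u) b" "\<delta> \<in> \<Gamma>" shows "bessel \<L> (orb (\<pi> \<delta> u)) b"
proof -
  have "coef (orb (\<pi> \<delta> u)) f = (\<lambda>\<gamma>. coef (orb u) f (\<gamma> + \<delta>))" for f by (simp add: pi_add)
  then show ?thesis
    using assms bij_square_integrable(1,2)[OF bij_right[OF assms(2)], of "coef (orb u) _"]
    unfolding bessel_def by simp
qed

lemma csubspace_bessel_vectors: "csubspace bessel_vectors"
proof -
  have "0 \<in> bessel_vectors"
    using unitary_scaleC[OF pi_unitary, of _ 0 0]
    by (auto simp: bessel_vectors_def bessel_def nsq_def intro!: exI[of _ 0])
  moreover have "u + v \<in> bessel_vectors" if uv: "u \<in> bessel_vectors" "v \<in> bessel_vectors" for u v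
  proof -
    obtain a b where ab: "bessel \<L> (orb u) a" "bessel \<L> (orb v) b"
      using uv by (auto simp: bessel_vectors_def)
    have "square_integrable \<L> (coef (orb (u + v)) f) \<and>
        nsq \<L> (coef (orb (u + v)) f) \<le> (2 * a + 2 * b) * (norm f)\<^sup>2" for f
    proof -
      have sq: "square_integrable \<L> (coef (orb u) f)" "square_integrable \<L> (coef (orb v) f)"
        and le: "nsq \<L> (coef (orb u) f) \<le> a * (norm f)\<^sup>2" "nsq \<L> (coef (orb v) f) \<le> b * (norm f)\<^sup>2"
        using ab by (auto simp: bessel_def)
      have "coef (orb (u + v)) f = (\<lambda>\<gamma>. coef (orb u) f \<gamma> + coef (orb v) f \<gamma>)"
        by (simp add: unitary_add[OF pi_unitary] cinner_add_right)
      then show ?thesis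
        using nsq_parallelogram[OF sq] nsq_nonneg[of \<L> "\<lambda>x. coef (orb u) f x - coef (orb v) f x"] le
          square_integrable_add[OF sq] unfolding distrib_right mult.assoc by (simp only: simp_thms)
    qed
    then show ?thesis unfolding bessel_vectors_def bessel_def by blast
  qed
  moreover have "c *\<^sub>C u \<in> bessel_vectors" if u: "u \<in> bessel_vectors" for c u
  proof -
    obtain b where b: "bessel \<L> (orb u) b"
      using u by (auto simp: bessel_vectors_def)
    have "square_integrable \<L> (coef (orb (c *\<^sub>C u)) f) \<and>
        nsq \<L> (coef (orb (c *\<^sub>C u)) f) \<le> ((cmod c)\<^sup>2 * b) * (norm f)\<^sup>2" for f
    proof -
      have "coef (orb (c *\<^sub>C u)) f = (\<lambda>\<gamma>. cnj c * coef (orb u) f \<gamma>)"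
        by (simp add: unitary_scaleC[OF pi_unitary] cinner_scaleC_right)
      then show ?thesis
        using b by (simp add: nsq_cmult square_integrable_cmult bessel_def mult_left_mono mult.assoc)
    qed
    then show ?thesis unfolding bessel_vectors_def bessel_def by blast
  qed
  ultimately show ?thesis by (simp add: complex_vector.subspace_def)
qed

text \<open>Bessel vectors are stable under \<Gamma>, so a vector u orthogonal to them is orthogonal
  to \<pi>(\<gamma>) K \<pi>(-\<gamma>) u for the averaged operator K. All the numbers \<langle>K
  \<pi>(-\<gamma>)u, \<pi>(-\<gamma>)u\<rangle> then vanish, but by \<open>trace_swap\<close> their
  sum is positive unless u = 0.\<close>

lemma bessel_vectors_dense: "closure bessel_vectors = UNIV"
proof (rule dense_if_orthogonal_trivial[OF csubspace_bessel_vectors])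
  fix u assume orth: "\<And>w. w \<in> bessel_vectors \<Longrightarrow> cinner u w = 0"
  obtain h :: 'h where h: "h \<noteq> 0" using irr unfolding irreducible_rep_def by blast
  let ?\<kappa> = "\<lambda>\<omega>. \<pi> (- \<omega>) h"
  have sq: "square_integrable \<nu> (coef ?\<kappa> f)" for f using bessel_nu by (simp add: bessel_def)
  have "nsq \<nu> (coef ?\<kappa> (\<pi> (- \<gamma>) u)) = 0" if "\<gamma> \<in> \<Gamma>" for \<gamma>
  proof -
    let ?v = "\<pi> (- \<gamma>) u"
    let ?g = "synthesis \<nu> ?\<kappa> (coef ?\<kappa> ?v)"
    have "\<pi> \<gamma> ?g \<in> bessel_vectors"
      using averaged_bessel bessel_pi that by (fastforce simp: bessel_vectors_def)
    then have "cinner ?g ?v = 0"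
      using orth[of "\<pi> \<gamma> ?g"] by (metis cinner_eq_0_commute cinner_pi_left)
    then have "ip \<nu> (coef ?\<kappa> ?v) (coef ?\<kappa> ?v) = 0"
      by (simp add: cinner_synthesis[OF bessel_nu sq])
    then show ?thesis by (simp add: ip_self)
  qed
  then have "(\<integral>\<^sup>+\<gamma>. ennreal (nsq \<nu> (coef ?\<kappa> (\<pi> (- \<gamma>) u))) \<partial>\<L>) = (\<integral>\<^sup>+\<gamma>. 0 \<partial>\<L>)"
    by (intro nn_integral_cong) simp
  then have "ennreal (form_const * (norm h)\<^sup>2 * (norm u)\<^sup>2) = 0"
    unfolding trace_swap by simp
  then have "form_const * (norm h)\<^sup>2 * (norm u)\<^sup>2 \<le> 0" by (simp add: ennreal_eq_0_iff)
  then show "u = 0"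
    using form_const_pos h by (simp add: mult_le_0_iff zero_less_mult_iff not_le)
qed

end

section \<open>Weak limits\<close>

lemma square_integrable_cong:
  assumes "\<And>x. x \<in> space M \<Longrightarrow> F x = F' x"
  shows "square_integrable M F \<longleftrightarrow> square_integrable M F'"
  using assms by (auto simp: square_integrable_def cong: measurable_cong Bochner_Integration.integrable_cong)

lemma nsq_cong:
  assumes "\<And>x. x \<in> space M \<Longrightarrow> F x = F' x" shows "nsq M F = nsq M F'"
  unfolding nsq_def using assms by (intro Bochner_Integration.integral_cong) auto

lemma ip_cong:
  assumes "\<And>x. x \<in> space M \<Longrightarrow> F x = F' x" "\<And>x. x \<in> space M \<Longrightarrow> G x = G' x"
  shows "ip M F G = ip M F' G'"
  unfolding ip_def using assms by (intro Bochner_Integration.integral_cong) auto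

lemma square_integrable_finite_support:
  assumes "finite T" "T \<subseteq> A"
  shows "square_integrable (count_space A) (\<lambda>x. F x * indicator T x)"
    and "nsq (count_space A) (\<lambda>x. F x * indicator T x) = (\<Sum>t\<in>T. (cmod (F t))\<^sup>2)"
proof -
  have eq: "(\<lambda>x. (cmod (F x * indicator T x))\<^sup>2) = (\<lambda>x. \<Sum>t\<in>T. (cmod (F t))\<^sup>2 * indicator {t} x)"
  proof
    fix x
    have "(\<Sum>t\<in>T. (cmod (F t))\<^sup>2 * indicator {t} x) = (\<Sum>t\<in>T. if x = t then (cmod (F x))\<^sup>2 else 0)"
      by (intro sum.cong) (auto simp: indicator_def)
    also have "\<dots> = (cmod (F x * indicator T x))\<^sup>2" using assms(1) by (simp add: indicator_def)
    finally show "(cmod (F x * indicator T x))\<^sup>2 = (\<Sum>t\<in>T. (cmod (F t))\<^sup>2 * indicator {t} x)" ..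
  qed
  have int: "integrable (count_space A) (\<lambda>x. (cmod (F t))\<^sup>2 * indicator {t} x)"
    and val: "(\<integral>x. (cmod (F t))\<^sup>2 * indicator {t} x \<partial>count_space A) = (cmod (F t))\<^sup>2"
    if "t \<in> T" for t
    using that assms by (auto simp: measure_count_space)
  show "square_integrable (count_space A) (\<lambda>x. F x * indicator T x)"
    using int unfolding square_integrable_def eq by (auto intro: Bochner_Integration.integrable_sum)
  show "nsq (count_space A) (\<lambda>x. F x * indicator T x) = (\<Sum>t\<in>T. (cmod (F t))\<^sup>2)"
    unfolding nsq_def eq by (rule trans[OF Bochner_Integration.integral_sum sum.cong]) (use int val in blast)+
qed

lemma sum_le_nsq:
  assumes "finite T" "T \<subseteq> A" "square_integrable (count_space A) F"
  shows "(\<Sum>t\<in>T. (cmod (F t))\<^sup>2) \<le> nsq (count_space A) F"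
  unfolding square_integrable_finite_support(2)[OF assms(1,2), symmetric]
  by (rule nsq_mono(2)[OF assms(3)]) (auto simp: indicator_def)

lemma nsq_tail:
  assumes A: "countable A" and G: "square_integrable (count_space A) G" and e: "e > 0"
  shows "\<exists>T. finite T \<and> T \<subseteq> A \<and> nsq (count_space A) (\<lambda>x. G x * indicator (A - T) x) < e"
proof -
  define T where "T n = from_nat_into A ` {..<n} \<inter> A" for n
  have "(\<lambda>n. nsq (count_space A) (\<lambda>x. G x * indicator (A - T n) x)) \<longlonglongrightarrow> (\<integral>x. 0 \<partial>count_space A)"
    unfolding nsq_def
  proof (rule integral_dominated_convergence)
    show "integrable (count_space A) (\<lambda>x. (cmod (G x))\<^sup>2)"
      using G by (simp add: square_integrable_def)
    have "(\<lambda>n. (cmod (G x * indicator (A - T n) x))\<^sup>2) \<longlonglongrightarrow> 0" if "x \<in> A" for x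
    proof (rule tendsto_eventually, rule eventually_sequentiallyI)
      fix n assume "n \<ge> Suc (to_nat_on A x)"
      then have "x \<in> T n"
        using that A from_nat_into_to_nat_on[OF A that] unfolding T_def
        by (auto simp: image_iff intro!: bexI[of _ "to_nat_on A x"])
      then show "(cmod (G x * indicator (A - T n) x))\<^sup>2 = 0" by simp
    qed
    then show "AE x in count_space A. (\<lambda>n. (cmod (G x * indicator (A - T n) x))\<^sup>2) \<longlonglongrightarrow> 0"
      by (simp add: AE_count_space)
  qed (auto simp: indicator_def AE_count_space)
  then have "\<forall>\<^sub>F n in sequentially. nsq (count_space A) (\<lambda>x. G x * indicator (A - T n) x) < e"
    using e by (intro order_tendstoD(2)) auto
  then obtain n where "nsq (count_space A) (\<lambda>x. G x * indicator (A - T n) x) < e"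
    by (auto simp: eventually_sequentially)
  moreover have "finite (T n)" "T n \<subseteq> A" by (auto simp: T_def)
  ultimately show ?thesis by blast
qed

text \<open>Up to a tail that is small uniformly in n by the bound \<open>K\<close>, the function
  \<open>G\<close> sees only finitely many coordinates of \<open>D n\<close>.\<close>

lemma ip_tendsto_0:
  assumes A: "countable A" and D: "\<And>n::nat. square_integrable (count_space A) (D n)"
    and K: "\<And>n. nsq (count_space A) (D n) \<le> K"
    and lim: "\<And>x. x \<in> A \<Longrightarrow> (\<lambda>n. D n x) \<longlonglongrightarrow> 0"
    and G: "square_integrable (count_space A) G"
  shows "(\<lambda>n. ip (count_space A) (D n) G) \<longlonglongrightarrow> 0"
proof (rule LIMSEQ_I)
  fix e :: real assume e: "e > 0"
  let ?M = "count_space A"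
  have K0: "K \<ge> 0" using K[of 0] nsq_nonneg[of ?M "D 0"] by linarith
  \<comment> \<open>The summand 1 keeps the denominator positive when \<open>K\<close> is 0.\<close>
  have "e / (2 * (sqrt K + 1)) > 0" using e K0 by (intro divide_pos_pos) (auto intro: add_nonneg_pos)
  then have "(e / (2 * (sqrt K + 1)))\<^sup>2 > 0" by (rule zero_less_power)
  from nsq_tail[OF A G this]
  obtain T where T: "finite T" "T \<subseteq> A" "nsq ?M (\<lambda>x. G x * indicator (A - T) x) < (e / (2 * (sqrt K + 1)))\<^sup>2"
    by blast
  let ?G2 = "\<lambda>x. G x * indicator (A - T) x"
  have G2: "square_integrable ?M ?G2" by (rule nsq_mono(1)[OF G]) (auto simp: indicator_def)
  have G1: "square_integrable ?M (\<lambda>x. G x * indicator T x)"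
    by (rule nsq_mono(1)[OF G]) (auto simp: indicator_def)
  have "(\<lambda>n. sqrt (\<Sum>t\<in>T. (cmod (D n t))\<^sup>2) * sqrt (nsq ?M G)) \<longlonglongrightarrow> sqrt (\<Sum>t\<in>T. (cmod 0)\<^sup>2) * sqrt (nsq ?M G)"
    using T(2) by (intro tendsto_intros lim) auto
  then have "\<forall>\<^sub>F n in sequentially. sqrt (\<Sum>t\<in>T. (cmod (D n t))\<^sup>2) * sqrt (nsq ?M G) < e / 2"
    using e by (intro order_tendstoD(2)) auto
  then obtain N where N: "\<And>n. n \<ge> N \<Longrightarrow> sqrt (\<Sum>t\<in>T. (cmod (D n t))\<^sup>2) * sqrt (nsq ?M G) < e / 2"
    by (auto simp: eventually_sequentially)
  have "norm (ip ?M (D n) G - 0) < e" if "n \<ge> N" for n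
  proof -
    note D1 = square_integrable_finite_support[OF T(1,2), of "D n"]
    have "ip ?M (D n) G = ip ?M (D n) (\<lambda>x. G x * indicator T x + ?G2 x)"
      by (rule ip_cong) (auto simp: indicator_def)
    also have "\<dots> = ip ?M (D n) (\<lambda>x. G x * indicator T x) + ip ?M (D n) ?G2"
      by (rule ip_add_right[OF G1 G2 D])
    also have "ip ?M (D n) (\<lambda>x. G x * indicator T x) = ip ?M (\<lambda>x. D n x * indicator T x) G"
      unfolding ip_def by (intro Bochner_Integration.integral_cong) (auto simp: indicator_def)
    finally have "cmod (ip ?M (D n) G)
        \<le> cmod (ip ?M (\<lambda>x. D n x * indicator T x) G) + cmod (ip ?M (D n) ?G2)"
      by (metis norm_triangle_ineq)
    moreover have "cmod (ip ?M (\<lambda>x. D n x * indicator T x) G)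
        \<le> sqrt (\<Sum>t\<in>T. (cmod (D n t))\<^sup>2) * sqrt (nsq ?M G)"
      using Cauchy_Schwarz_ip_sqrt[OF D1(1) G] by (simp only: D1(2))
    moreover have "cmod (ip ?M (D n) ?G2) \<le> e / 2"
    proof -
      have "sqrt (nsq ?M ?G2) \<le> e / (2 * (sqrt K + 1))"
        using T(3) e K0 by (intro real_le_lsqrt) (auto simp: add_nonneg_nonneg)
      then have "sqrt (nsq ?M (D n)) * sqrt (nsq ?M ?G2) \<le> (sqrt K + 1) * (e / (2 * (sqrt K + 1)))"
        using K[of n] K0 by (intro mult_mono) (auto intro: order_trans[OF real_sqrt_le_mono])
      also have "\<dots> = e / 2" using K0 by (simp add: field_simps add_nonneg_eq_0_iff)
      finally show ?thesis using Cauchy_Schwarz_ip_sqrt[OF D G2] order_trans by blast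
    qed
    ultimately show ?thesis using N[OF that] by simp
  qed
  then show "\<exists>N. \<forall>n\<ge>N. norm (ip ?M (D n) G - 0) < e" by blast
qed

lemma ip_tendsto:
  assumes A: "countable A" and F: "\<And>n::nat. square_integrable (count_space A) (F n)"
    and K: "\<And>n. nsq (count_space A) (F n) \<le> K"
    and lim: "\<And>x. x \<in> A \<Longrightarrow> (\<lambda>n. F n x) \<longlonglongrightarrow> L x"
    and G: "square_integrable (count_space A) G"
  shows "(\<lambda>n. ip (count_space A) (F n) G) \<longlonglongrightarrow> ip (count_space A) L G"
proof -
  have L: "square_integrable (count_space A) L" "nsq (count_space A) L \<le> K"
    using square_integrable_limit_bounded[of "count_space A" F L K] F K lim by auto
  have "(\<lambda>n. ip (count_space A) (\<lambda>x. F n x - L x) G) \<longlonglongrightarrow> 0"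
  proof (rule ip_tendsto_0[OF A _ _ _ G])
    show "square_integrable (count_space A) (\<lambda>x. F n x - L x)" for n
      by (rule square_integrable_diff[OF F L(1)])
    show "nsq (count_space A) (\<lambda>x. F n x - L x) \<le> 4 * K" for n
      using nsq_parallelogram[OF F L(1), of n] nsq_nonneg[of "count_space A" "\<lambda>x. F n x + L x"] K[of n] L(2)
      by linarith
    show "(\<lambda>n. F n x - L x) \<longlonglongrightarrow> 0" if "x \<in> A" for x
      using lim[OF that] by (rule LIM_zero)
  qed
  then have "(\<lambda>n. ip (count_space A) (F n) G - ip (count_space A) L G) \<longlonglongrightarrow> 0"
    by (simp add: ip_diff_left F L G)
  then show ?thesis by (rule LIM_zero_cancel)
qed

lemma bounded_family_subsequence:
  fixes x :: "nat \<Rightarrow> 'k \<Rightarrow> complex"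
  assumes A: "countable A" and bd: "\<And>k. k \<in> A \<Longrightarrow> \<exists>C. \<forall>n. cmod (x n k) \<le> C"
  shows "\<exists>r. strict_mono r \<and> (\<forall>k\<in>A. convergent (\<lambda>n. x (r n) k))"
proof (cases "A = {}")
  case False
  define P where "P k s \<longleftrightarrow> convergent (\<lambda>n. x (s n) (from_nat_into A k))" for k and s :: "nat \<Rightarrow> nat"
  interpret subseqs P
  proof
    fix k and s :: "nat \<Rightarrow> nat" assume "strict_mono s"
    obtain C where "\<And>n. cmod (x n (from_nat_into A k)) \<le> C"
      using bd[OF from_nat_into[OF False, of k]] by blast
    then have "bounded (range (\<lambda>n. x (s n) (from_nat_into A k)))"
      by (auto simp: bounded_iff)
    then obtain l r where "strict_mono r" "((\<lambda>n. x (s n) (from_nat_into A k)) \<circ> r) \<longlonglongrightarrow> l"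
      using bounded_imp_convergent_subsequence by blast
    then show "\<exists>r. strict_mono r \<and> P k (s \<circ> r)" unfolding P_def convergent_def o_def by blast
  qed
  have "convergent (\<lambda>n. x (diagseq n) k)" if k: "k \<in> A" for k
  proof -
    define j where "j = to_nat_on A k"
    \<comment> \<open>The diagonal sequence refines the j-th subsequence only from the index
      \<open>Suc j\<close> on.\<close>
    have "P j (diagseq \<circ> (+) (Suc j))"
    proof (rule diagseq_holds)
      fix r s n assume "strict_mono (r :: nat \<Rightarrow> nat)" "P n s"
      then show "P n (s \<circ> r)"
        unfolding P_def convergent_def using LIMSEQ_subseq_LIMSEQ by (fastforce simp: o_def)
    qed
    then have "convergent (\<lambda>n. x (diagseq (n + Suc j)) k)"
      using from_nat_into_to_nat_on[OF A k] by (simp add: P_def j_def o_def add.commute)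
    then show ?thesis
      using convergent_ignore_initial_segment[of "\<lambda>n. x (diagseq n) k" "Suc j"] by simp
  qed
  then show ?thesis using subseq_diagseq by blast
qed (auto intro: strict_mono_id)

text \<open>A diagonal subsequence converges against a countable dense set; the norm bound extends
  this to all y, and the Riesz representation turns the limit functional into a vector.\<close>

lemma weak_sequential_compactness:
  fixes X :: "nat \<Rightarrow> 'h::complex_hilbert_space"
  assumes S: "countable S" "closure S = (UNIV :: 'h set)" and K: "\<And>n. norm (X n) \<le> K"
  shows "\<exists>r x. strict_mono r \<and> (\<forall>y. (\<lambda>n. cinner (X (r n)) y) \<longlonglongrightarrow> cinner x y)"
proof -
  have bound: "cmod (cinner (X n) y) \<le> K * norm y" for n y
    using Cauchy_Schwarz_cinner[of "X n" y] mult_right_mono[OF K[of n] norm_ge_zero[of y]] by linarith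
  obtain r where r: "strict_mono r" "\<And>s. s \<in> S \<Longrightarrow> convergent (\<lambda>n. cinner (X (r n)) s)"
    using bounded_family_subsequence[OF S(1), of "\<lambda>n. cinner (X n)"] bound by blast
  have K0: "K \<ge> 0" using K[of 0] norm_ge_zero order_trans by blast
  have conv: "convergent (\<lambda>n. cinner (X (r n)) y)" for y
  proof (rule Cauchy_convergent, rule CauchyI)
    fix e :: real assume e: "e > 0"
    have "y \<in> closure S" using S by simp
    then obtain s where s: "s \<in> S" "dist s y < e / (3 * (K + 1))"
      using e K0 closure_approachable[of y S] by (metis add_nonneg_pos divide_pos_pos mult_pos_pos zero_less_numeral zero_less_one)
    from r(2)[OF s(1)] have "Cauchy (\<lambda>n. cinner (X (r n)) s)" by (rule convergent_Cauchy)
    then obtain N where N: "\<And>m n. m \<ge> N \<Longrightarrow> n \<ge> N \<Longrightarrow> cmod (cinner (X (r m)) s - cinner (X (r n)) s) < e / 3"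
      using e CauchyD[of _ "e/3"] by (metis divide_pos_pos zero_less_numeral)
    have close: "cmod (cinner (X n) (y - s)) \<le> e / 3" for n
    proof -
      have "cmod (cinner (X n) (y - s)) \<le> K * norm (y - s)" by (rule bound)
      also have "\<dots> \<le> (K + 1) * (e / (3 * (K + 1)))"
        using s K0 by (intro mult_mono) (auto simp: dist_norm norm_minus_commute)
      also have "\<dots> = e / 3" using K0 by (simp add: field_simps add_nonneg_eq_0_iff)
      finally show ?thesis .
    qed
    have "cmod (cinner (X (r m)) y - cinner (X (r n)) y) < e" if "m \<ge> N" "n \<ge> N" for m n
    proof -
      have "cinner (X (r m)) y - cinner (X (r n)) y = (cinner (X (r m)) s - cinner (X (r n)) s)
          + (cinner (X (r m)) (y - s) - cinner (X (r n)) (y - s))"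
        by (simp add: cinner_diff_right)
      also have "cmod \<dots> \<le> cmod (cinner (X (r m)) s - cinner (X (r n)) s)
          + (cmod (cinner (X (r m)) (y - s)) + cmod (cinner (X (r n)) (y - s)))"
        by (intro order_trans[OF norm_triangle_ineq] add_left_mono norm_triangle_ineq4)
      also have "\<dots> < e" using N[OF that] close[of "r m"] close[of "r n"] by linarith
      finally show ?thesis .
    qed
    then show "\<exists>M. \<forall>m\<ge>M. \<forall>n\<ge>M. norm (cinner (X (r m)) y - cinner (X (r n)) y) < e" by blast
  qed
  define \<phi> where "\<phi> y = lim (\<lambda>n. cinner (X (r n)) y)" for y
  have lim: "(\<lambda>n. cinner (X (r n)) y) \<longlonglongrightarrow> \<phi> y" for y
    using conv convergent_LIMSEQ_iff unfolding \<phi>_def by blast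
  have "\<exists>x. \<forall>y. cinner x y = \<phi> y"
  proof (rule riesz_representation_bound)
    show "\<phi> (y + z) = \<phi> y + \<phi> z" for y z
      using LIMSEQ_unique[OF lim[of "y + z"]] tendsto_add[OF lim lim] by (simp add: cinner_add_right)
    show "\<phi> (c *\<^sub>C y) = cnj c * \<phi> y" for c y
      using LIMSEQ_unique[OF lim[of "c *\<^sub>C y"]] tendsto_mult_left[OF lim] by (simp add: cinner_scaleC_right)
    show "cmod (\<phi> y) \<le> K * norm y" for y
      by (rule LIMSEQ_le_const2[OF tendsto_norm[OF lim]]) (use bound in auto)
  qed
  then show ?thesis using r(1) lim by metis
qed

context lattice_rep
begin

section \<open>Conjugation averages in an ICC group\<close>

text \<open>A sequence of almost minimal norm in the convex conjugation invariant set \<open>C\<close> is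
  asymptotically conjugation invariant, hence tends to \<open>0\<close> off the identity.\<close>

lemma icc_average:
  assumes \<phi>: "square_integrable \<L> \<phi>" and \<psi>: "square_integrable \<L> \<psi>"
    and const: "\<And>a. a \<in> \<Gamma> \<Longrightarrow> ip \<L> (\<lambda>\<gamma>. \<phi> (a + \<gamma> + - a)) \<psi> = c"
  shows "c = \<phi> 0 * cnj (\<psi> 0)"
proof -
  define C where "C = {\<xi>. square_integrable \<L> \<xi> \<and> \<xi> 0 = \<phi> 0 \<and>
    (\<forall>a\<in>\<Gamma>. ip \<L> (\<lambda>\<gamma>. \<xi> (a + \<gamma> + - a)) \<psi> = c)}"
  have C_sq: "square_integrable \<L> \<xi>" if "\<xi> \<in> C" for \<xi> using that by (simp add: C_def)
  have conj: "(\<lambda>\<gamma>. \<xi> (b + \<gamma> + - b)) \<in> C" "nsq \<L> (\<lambda>\<gamma>. \<xi> (b + \<gamma> + - b)) = nsq \<L> \<xi>"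
    if "\<xi> \<in> C" "b \<in> \<Gamma>" for \<xi> b
  proof -
    have "ip \<L> (\<lambda>\<gamma>. \<xi> (b + (a + \<gamma> + - a) + - b)) \<psi> = c" if "a \<in> \<Gamma>" for a
    proof -
      have "b + (a + \<gamma> + - a) + - b = (b + a) + \<gamma> + - (b + a)" for \<gamma>
        by (simp only: minus_add add.assoc)
      then show ?thesis using \<open>\<xi> \<in> C\<close> add_in[OF \<open>b \<in> \<Gamma>\<close> that] by (simp add: C_def)
    qed
    then show "(\<lambda>\<gamma>. \<xi> (b + \<gamma> + - b)) \<in> C"
      using that bij_square_integrable(1)[OF bij_conj[OF that(2)], of \<xi>] by (simp add: C_def)
    show "nsq \<L> (\<lambda>\<gamma>. \<xi> (b + \<gamma> + - b)) = nsq \<L> \<xi>"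
      by (rule bij_square_integrable(2)[OF bij_conj[OF that(2)]])
  qed
  have mid: "(\<lambda>\<gamma>. (1/2) * (\<xi> \<gamma> + \<eta> \<gamma>)) \<in> C" if "\<xi> \<in> C" "\<eta> \<in> C" for \<xi> \<eta>
  proof -
    have "ip \<L> (\<lambda>\<gamma>. (1/2) * (\<xi> (a + \<gamma> + - a) + \<eta> (a + \<gamma> + - a))) \<psi> = c" if "a \<in> \<Gamma>" for a
      unfolding ip_cmult_left
      using \<open>\<xi> \<in> C\<close> \<open>\<eta> \<in> C\<close> that conj(1)[OF \<open>\<xi> \<in> C\<close> that] conj(1)[OF \<open>\<eta> \<in> C\<close> that]
      by (subst ip_add_left) (auto simp: C_def \<psi>)
    then show ?thesis
      using that square_integrable_cmult[OF square_integrable_add[OF C_sq C_sq], OF that, of "1/2"]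
      by (simp add: C_def)
  qed
  define I where "I = Inf (nsq \<L> ` C)"
  have bdd: "bdd_below (nsq \<L> ` C)" by (auto simp: bdd_below_def intro!: exI[of _ 0])
  have I_le: "I \<le> nsq \<L> \<xi>" if "\<xi> \<in> C" for \<xi>
    unfolding I_def using bdd that by (simp add: cINF_lower)
  have "\<phi> \<in> C" using \<phi> const by (simp add: C_def)
  have "\<exists>\<xi>\<in>C. nsq \<L> \<xi> < I + 1 / real (Suc n)" for n
    using cInf_less_iff[of "nsq \<L> ` C" "I + 1 / real (Suc n)"] bdd \<open>\<phi> \<in> C\<close> by (auto simp: I_def)
  then obtain X where X: "\<And>n. X n \<in> C" "\<And>n. nsq \<L> (X n) < I + 1 / real (Suc n)" by metis
  have X_bd: "nsq \<L> (X n) \<le> I + 1" for n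
  proof -
    have "1 / real (Suc n) \<le> 1" by simp
    then show ?thesis using X(2)[of n] by linarith
  qed
  \<comment> \<open>The midpoint of \<open>X n\<close> and its conjugate lies in \<open>C\<close>,
    so its squared norm is at least \<open>I\<close>. The parallelogram law then bounds the
    difference by 4 times the excess of \<open>X n\<close> over \<open>I\<close>.\<close>
  have near: "(cmod (X n \<gamma> - X n (b + \<gamma> + - b)))\<^sup>2 \<le> 4 / real (Suc n)" if "b \<in> \<Gamma>" "\<gamma> \<in> \<Gamma>" for n b \<gamma>
  proof -
    let ?Y = "\<lambda>\<gamma>. X n (b + \<gamma> + - b)"
    note Y = conj[OF X(1)[of n] \<open>b \<in> \<Gamma>\<close>]
    have "I \<le> nsq \<L> (\<lambda>\<gamma>. (1/2) * (X n \<gamma> + ?Y \<gamma>))" by (intro I_le mid X Y)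
    also have "\<dots> = nsq \<L> (\<lambda>\<gamma>. X n \<gamma> + ?Y \<gamma>) / 4"
      unfolding nsq_cmult by (simp add: norm_divide power_divide)
    finally have "nsq \<L> (\<lambda>\<gamma>. X n \<gamma> - ?Y \<gamma>) \<le> 4 * nsq \<L> (X n) - 4 * I"
      using nsq_parallelogram[OF C_sq[OF X(1)] C_sq[OF Y(1)], of n] Y(2) by linarith
    moreover have "(cmod (X n \<gamma> - ?Y \<gamma>))\<^sup>2 \<le> nsq \<L> (\<lambda>\<gamma>. X n \<gamma> - ?Y \<gamma>)"
      by (rule nsq_pointwise_le[OF square_integrable_diff[OF C_sq[OF X(1)] C_sq[OF Y(1)]] that(2)])
    ultimately show ?thesis using X(2)[of n] by argo
  qed
  have zero: "(\<lambda>n. X n \<gamma>) \<longlonglongrightarrow> 0" if \<gamma>: "\<gamma> \<in> \<Gamma>" "\<gamma> \<noteq> 0" for \<gamma>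
  proof (rule LIMSEQ_I)
    fix e :: real assume e: "e > 0"
    \<comment> \<open>So many conjugates of \<gamma> that values of modulus e/2 on all of them would
      exceed the bound \<open>I + 1\<close> on the squared norm.\<close>
    obtain m :: nat where m: "(I + 1) / (e / 2)\<^sup>2 < m" using reals_Archimedean2 by blast
    have "infinite {a + \<gamma> + - a | a. a \<in> \<Gamma>}" using icc \<gamma> by (auto simp: icc_def)
    then obtain T where T: "T \<subseteq> {a + \<gamma> + - a | a. a \<in> \<Gamma>}" "finite T" "card T = m"
      using infinite_arbitrarily_large by blast
    have T\<Gamma>: "T \<subseteq> \<Gamma>" using T(1) \<gamma> by (auto intro!: add_in diff_in)
    obtain N :: nat where N: "4 / (e / 2)\<^sup>2 < N" using reals_Archimedean2 by blast
    have "norm (X n \<gamma> - 0) < e" if n: "n \<ge> N" for n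
    proof (rule ccontr)
      assume "\<not> norm (X n \<gamma> - 0) < e"
      then have big: "cmod (X n \<gamma>) \<ge> e" by simp
      have "(e / 2)\<^sup>2 \<le> (cmod (X n t))\<^sup>2" if "t \<in> T" for t
      proof -
        obtain a where a: "a \<in> \<Gamma>" "t = a + \<gamma> + - a" using T(1) \<open>t \<in> T\<close> by blast
        have "4 / (e / 2)\<^sup>2 < real (Suc n)" using N n by linarith
        then have "4 / real (Suc n) < (e / 2)\<^sup>2" using e by (simp add: field_simps)
        then have "(cmod (X n \<gamma> - X n t))\<^sup>2 < (e / 2)\<^sup>2"
          using near[OF a(1) \<gamma>(1), of n] a(2) by simp
        then have "cmod (X n \<gamma> - X n t) < e / 2"
          by (rule power2_less_imp_less) (use e in simp)
        then have "cmod (X n t) \<ge> e / 2"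
          using big norm_triangle_ineq2[of "X n \<gamma>" "X n t"] by linarith
        then show ?thesis using e by (intro power_mono) auto
      qed
      then have "real m * (e / 2)\<^sup>2 \<le> (\<Sum>t\<in>T. (cmod (X n t))\<^sup>2)"
        using sum_bounded_below[of T "(e / 2)\<^sup>2" "\<lambda>t. (cmod (X n t))\<^sup>2"] T(3) by simp
      also have "\<dots> \<le> nsq \<L> (X n)" by (rule sum_le_nsq[OF T(2) T\<Gamma> C_sq[OF X(1)]])
      also have "\<dots> \<le> I + 1" by (rule X_bd)
      also have "\<dots> < real m * (e / 2)\<^sup>2" using m e by (simp add: divide_less_eq)
      finally show False by simp
    qed
    then show "\<exists>N. \<forall>n\<ge>N. norm (X n \<gamma> - 0) < e" by blast
  qed
  \<comment> \<open>The limit keeps only the value at the identity, which is fixed throughout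
    \<open>C\<close>.\<close>
  let ?L = "\<lambda>\<gamma>. \<phi> 0 * indicator {0} \<gamma>"
  have "(\<lambda>n. ip \<L> (X n) \<psi>) \<longlonglongrightarrow> ip \<L> ?L \<psi>"
  proof (rule ip_tendsto[OF countable _ _ _ \<psi>])
    show "(\<lambda>n. X n \<gamma>) \<longlonglongrightarrow> \<phi> 0 * indicator {0} \<gamma>" if "\<gamma> \<in> \<Gamma>" for \<gamma>
    proof (cases "\<gamma> = 0")
      case True
      then show ?thesis using X(1) by (simp add: C_def)
    qed (use zero[OF that] in simp)
  qed (use X(1) C_sq X_bd in auto)
  moreover have "ip \<L> (X n) \<psi> = c" for n
    using X(1)[of n] zero_in unfolding C_def by (auto dest!: bspec[of _ _ 0])
  ultimately have "c = ip \<L> ?L \<psi>" by (simp add: LIMSEQ_const_iff)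
  also have "\<dots> = (\<integral>\<gamma>. (\<phi> 0 * cnj (\<psi> 0)) * complex_of_real (indicator {0} \<gamma>) \<partial>\<L>)"
    unfolding ip_def by (intro Bochner_Integration.integral_cong) (auto simp: indicator_def)
  also have "\<dots> = \<phi> 0 * cnj (\<psi> 0)" using zero_in by (simp add: measure_count_space)
  finally show ?thesis .
qed


section \<open>Mixed frame operators\<close>

lemma bessel_vectorsI: "bessel \<L> (orb u) b \<Longrightarrow> u \<in> bessel_vectors"
  by (auto simp: bessel_vectors_def)

lemma coef_sq: "u \<in> bessel_vectors \<Longrightarrow> square_integrable \<L> (coef (orb u) f)"
  by (auto simp: bessel_vectors_def bessel_def)

lemma bessel_nsq: "bessel \<L> (orb u) b \<Longrightarrow> nsq \<L> (coef (orb u) f) \<le> b * (norm f)\<^sup>2"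
  by (auto simp: bessel_def)

lemma bessel_vectors_pi: "u \<in> bessel_vectors \<Longrightarrow> \<delta> \<in> \<Gamma> \<Longrightarrow> \<pi> \<delta> u \<in> bessel_vectors"
  using bessel_pi by (auto simp: bessel_vectors_def)

lemma coef_pi: "coef (orb u) (\<pi> \<delta> f) \<gamma> = coef (orb u) f (- \<delta> + \<gamma>)"
  by (simp add: cinner_pi_left flip: pi_add)

text \<open>The operator \<open>C_v^* C_u\<close>, formally f \<mapsto> \<Sum> \<langle>f,
  \<pi>(\<gamma>)u\<rangle> \<pi>(\<gamma>)v. For Bessel vectors it commutes with
  \<pi>(\<Gamma>).\<close>

definition T :: "'h \<Rightarrow> 'h \<Rightarrow> 'h \<Rightarrow> 'h" where
  "T u v f = synthesis \<L> (orb v) (coef (orb u) f)"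

lemma T_cinner:
  assumes "u \<in> bessel_vectors" "v \<in> bessel_vectors"
  shows "cinner (T u v f) h = ip \<L> (coef (orb u) f) (coef (orb v) h)"
proof -
  obtain b where "bessel \<L> (orb v) b" using assms by (auto simp: bessel_vectors_def)
  then show ?thesis unfolding T_def by (rule cinner_synthesis) (rule coef_sq[OF assms(1)])
qed

lemma T_adjoint:
  assumes "u \<in> bessel_vectors" "v \<in> bessel_vectors"
  shows "cinner (T u v f) h = cinner f (T v u h)"
proof -
  have "cinner f (T v u h) = cnj (ip \<L> (coef (orb v) h) (coef (orb u) f))"
    unfolding T_cinner[OF assms(2,1), symmetric] by (rule cinner_commute)
  also have "\<dots> = ip \<L> (coef (orb u) f) (coef (orb v) h)" by (rule ip_cnj[symmetric])
  finally show ?thesis by (simp add: T_cinner assms)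
qed

lemma T_pi:
  assumes "u \<in> bessel_vectors" "v \<in> bessel_vectors" "\<delta> \<in> \<Gamma>"
  shows "T u v (\<pi> \<delta> f) = \<pi> \<delta> (T u v f)"
proof (rule cinner_ext)
  fix h
  have "cinner (T u v (\<pi> \<delta> f)) h = ip \<L> (\<lambda>\<gamma>. coef (orb u) f (- \<delta> + \<gamma>)) (coef (orb v) h)"
    unfolding T_cinner[OF assms(1,2)] coef_pi ..
  also have "\<dots> = ip \<L> (\<lambda>\<gamma>. coef (orb u) f (- \<delta> + (\<delta> + \<gamma>))) (\<lambda>\<gamma>. coef (orb v) h (\<delta> + \<gamma>))"
    by (rule bij_square_integrable(3)[OF bij_left[OF assms(3)], symmetric])
  also have "\<dots> = cinner (T u v f) (\<pi> (- \<delta>) h)"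
    unfolding T_cinner[OF assms(1,2)] coef_pi by (simp add: add.assoc[symmetric])
  finally show "cinner (T u v (\<pi> \<delta> f)) h = cinner (\<pi> \<delta> (T u v f)) h"
    by (simp add: cinner_pi_left)
qed

lemma T_diff:
  assumes "u \<in> bessel_vectors" "v \<in> bessel_vectors"
  shows "T u v (f - g) = T u v f - T u v g"
  by (rule cinner_ext) (simp add: T_adjoint[OF assms] cinner_diff_left)

lemma T_scaleC:
  assumes "u \<in> bessel_vectors" "v \<in> bessel_vectors"
  shows "T u v (c *\<^sub>C f) = c *\<^sub>C T u v f"
  by (rule cinner_ext) (simp add: T_adjoint[OF assms] cinner_scaleC_left)

lemma T_self: "u \<in> bessel_vectors \<Longrightarrow> Re (cinner (T u u f) f) = nsq \<L> (coef (orb u) f)"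
  by (simp add: T_cinner ip_self)

text \<open>In operator notation \<open>C_{A w} = C_w A\<close>. This transfers operators commuting
  with \<pi>(\<Gamma>) to orbit vectors: the frame operator of \<open>A w\<close> is that of w with
  A on either side.\<close>

lemma coef_commute:
  assumes "\<And>f g. cinner (A f) g = cinner f (A g)" "\<And>\<delta> f. \<delta> \<in> \<Gamma> \<Longrightarrow> A (\<pi> \<delta> f) = \<pi> \<delta> (A f)" "\<gamma> \<in> \<Gamma>"
  shows "coef (orb (A w)) f \<gamma> = coef (orb w) (A f) \<gamma>"
  using assms by metis

lemma square_integrable_cong_\<L>:
  assumes "\<And>\<gamma>. \<gamma> \<in> \<Gamma> \<Longrightarrow> F \<gamma> = G \<gamma>"
  shows "square_integrable \<L> F \<longleftrightarrow> square_integrable \<L> G" "nsq \<L> F = nsq \<L> G"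
  using square_integrable_cong[of \<L> F G] nsq_cong[of \<L> F G] assms by auto

lemma bessel_commute:
  assumes A: "\<And>f g. cinner (A f) g = cinner f (A g)" "\<And>\<delta> f. \<delta> \<in> \<Gamma> \<Longrightarrow> A (\<pi> \<delta> f) = \<pi> \<delta> (A f)"
    and w: "w \<in> bessel_vectors" and b: "\<And>f. nsq \<L> (coef (orb w) (A f)) \<le> b * (norm f)\<^sup>2"
  shows "bessel \<L> (orb (A w)) b"
  unfolding bessel_def
proof
  fix f
  note cong = square_integrable_cong_\<L>[of "coef (orb (A w)) f" "coef (orb w) (A f)", OF coef_commute[OF A]]
  show "square_integrable \<L> (coef (orb (A w)) f) \<and> nsq \<L> (coef (orb (A w)) f) \<le> b * (norm f)\<^sup>2"
    using cong coef_sq[OF w] b by simp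
qed

section \<open>An extremal Bessel vector\<close>

text \<open>Extremal points of the weakly compact convex set of vectors with Bessel bound \<open>1\<close> exist
  because a weakly continuous, strictly convex functional attains its maximum there.\<close>

lemma bessel_1_norm_le: "bessel \<L> (orb x) 1 \<Longrightarrow> norm x \<le> 1"
proof -
  assume b: "bessel \<L> (orb x) 1"
  have "(cmod (cinner x (\<pi> 0 x)))\<^sup>2 \<le> nsq \<L> (coef (orb x) x)"
    by (rule nsq_pointwise_le[OF coef_sq[OF bessel_vectorsI[OF b]] zero_in])
  also have "\<dots> \<le> (norm x)\<^sup>2" using bessel_nsq[OF b, of x] by simp
  finally have "((norm x)\<^sup>2)\<^sup>2 \<le> (norm x)\<^sup>2" by (simp add: cinner_self norm_power)
  then have le: "(norm x)\<^sup>2 * (norm x)\<^sup>2 \<le> (norm x)\<^sup>2 * 1" unfolding power2_eq_square by simp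
  show ?thesis
  proof (cases "x = 0")
    case False
    then have "(norm x)\<^sup>2 \<le> 1" by (intro mult_left_le_imp_le[OF le]) simp
    then show ?thesis by (simp add: abs_square_le_1)
  qed simp
qed

lemma bessel_1_weakly_closed:
  assumes X: "\<And>n::nat. bessel \<L> (orb (X n)) 1" and lim: "\<And>y. (\<lambda>n. cinner (X n) y) \<longlonglongrightarrow> cinner x y"
  shows "bessel \<L> (orb x) 1"
  unfolding bessel_def
proof
  fix f
  have "(\<lambda>n. cinner f (\<pi> \<gamma> (X n))) \<longlonglongrightarrow> cinner f (\<pi> \<gamma> x)" for \<gamma>
  proof -
    have "(\<lambda>n. cnj (cinner (X n) (\<pi> (- \<gamma>) f))) \<longlonglongrightarrow> cnj (cinner x (\<pi> (- \<gamma>) f))"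
      by (intro tendsto_cnj lim)
    then show ?thesis by (simp add: cinner_pi_right[of f] flip: cinner_commute)
  qed
  then show "square_integrable \<L> (coef (orb x) f) \<and> nsq \<L> (coef (orb x) f) \<le> 1 * (norm f)\<^sup>2"
    using X by (intro square_integrable_limit_bounded[of _ "\<lambda>n. coef (orb (X n)) f"]) (auto simp: bessel_def)
qed

lemma extremal_exists:
  "\<exists>x. bessel \<L> (orb x) 1 \<and>
     (\<forall>y. bessel \<L> (orb (x + y)) 1 \<and> bessel \<L> (orb (x - y)) 1 \<longrightarrow> y = 0)"
proof -
  obtain S :: "'h set" where S: "countable S" "closure S = UNIV"
    using separable by (auto simp: separable_space_def)
  then have Sne: "S \<noteq> {}" by auto
  define d where "d = from_nat_into S"
  have d: "range d = S" unfolding d_def by (rule range_from_nat_into[OF Sne S(1)])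
  \<comment> \<open>The weights make the norms square summable, so the sum \<Phi> of |\<langle>x, e
    n\<rangle>|^2 is weakly continuous on bounded sequences; the \<open>e n\<close> still separate
    vectors, so \<Phi> is strictly convex.\<close>
  define e where "e n = ((1/2) ^ n / (1 + norm (d n))) *\<^sub>R d n" for n
  have e_norm: "norm (e n) \<le> (1/2) ^ n" for n
  proof -
    have "norm (d n) / (1 + norm (d n)) \<le> 1" using add_pos_nonneg[OF zero_less_one norm_ge_zero, of "d n"] by (simp add: divide_le_eq_1)
    then have "(1/2) ^ n * (norm (d n) / (1 + norm (d n))) \<le> (1/2) ^ n * (1::real)"
      by (intro mult_left_mono) auto
    then show ?thesis by (simp add: e_def)
  qed
  let ?M = "count_space (UNIV :: nat set)"
  have e_bd: "(cmod (cinner x (e n)))\<^sup>2 \<le> (1/4) ^ n * (norm x)\<^sup>2" for x n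
  proof -
    have "cmod (cinner x (e n)) \<le> norm x * (1/2) ^ n"
      using Cauchy_Schwarz_cinner[of x "e n"] mult_left_mono[OF e_norm[of n] norm_ge_zero[of x]] by linarith
    then have "(cmod (cinner x (e n)))\<^sup>2 \<le> (norm x * (1/2) ^ n)\<^sup>2" by (intro power_mono) auto
    also have "\<dots> = (1/4) ^ n * (norm x)\<^sup>2"
      by (simp add: power_mult_distrib power2_eq_square flip: power_mult_distrib)
    finally show ?thesis .
  qed
  have int4: "integrable ?M (\<lambda>n. (1/4) ^ n * c)" for c :: real
    by (simp add: integrable_count_space_nat_iff abs_mult summable_mult2 power_abs)
  have sq: "square_integrable ?M (coef e x)" for x
    unfolding square_integrable_def
    using e_bd[of x] by (auto intro!: Bochner_Integration.integrable_bound[OF int4[of "(norm x)\<^sup>2"]])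
  define \<Phi> where "\<Phi> x = nsq ?M (coef e x)" for x
  have \<Phi>_0: "x = 0" if "\<Phi> x = 0" for x
  proof (rule orthogonal_dense_eq_0[OF S(2)])
    fix w assume "w \<in> S"
    then obtain n where n: "w = d n" using d by blast
    have "cinner x (e n) = 0"
      using square_integrable_count_space_eq_0[OF sq, of x n] that by (simp add: \<Phi>_def)
    moreover have "(1/2) ^ n / (1 + norm (d n)) \<noteq> 0"
      using add_pos_nonneg[OF zero_less_one norm_ge_zero, of "d n"] by simp
    ultimately show "cinner x w = 0"
      unfolding e_def n cinner_scaleR_right mult_eq_0_iff of_real_eq_0_iff by blast
  qed
  define K where "K = {x. bessel \<L> (orb x) 1}"
  have K0: "0 \<in> K"
    using unitary_scaleC[OF pi_unitary, of _ 0 0] by (simp add: K_def bessel_def nsq_def)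
  have \<Phi>_le: "\<Phi> x \<le> (\<integral>n. (1/4) ^ n * 1 \<partial>?M)" if "x \<in> K" for x
    unfolding \<Phi>_def nsq_def
  proof (rule integral_mono[OF _ int4])
    show "integrable ?M (\<lambda>n. (cmod (cinner x (e n)))\<^sup>2)" using sq by (simp add: square_integrable_def)
    have "(norm x)\<^sup>2 \<le> 1" using bessel_1_norm_le that by (simp add: K_def power_le_one)
    then show "(cmod (cinner x (e n)))\<^sup>2 \<le> (1/4) ^ n * 1" for n
      by (intro order_trans[OF e_bd mult_left_mono]) simp_all
  qed
  then have bdd: "bdd_above (\<Phi> ` K)" by (auto simp: bdd_above_def)
  define s where "s = Sup (\<Phi> ` K)"
  have \<Phi>_s: "\<Phi> x \<le> s" if "x \<in> K" for x unfolding s_def using bdd that by (simp add: cSUP_upper)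
  have "\<exists>x\<in>K. s - 1 / real (Suc n) < \<Phi> x" for n
    using less_cSup_iff[of "\<Phi> ` K" "s - 1 / real (Suc n)"] bdd K0 by (auto simp: s_def)
  then obtain X where X: "\<And>n. X n \<in> K" "\<And>n. s - 1 / real (Suc n) < \<Phi> (X n)" by metis
  have X1: "norm (X n) \<le> 1" for n using X(1) bessel_1_norm_le by (simp add: K_def)
  obtain r x where r: "strict_mono r" "\<And>y. (\<lambda>n. cinner (X (r n)) y) \<longlonglongrightarrow> cinner x y"
    using weak_sequential_compactness[OF S, of X 1] X1 by blast
  have xK: "bessel \<L> (orb x) 1"
    by (rule bessel_1_weakly_closed[OF _ r(2)]) (use X(1) in \<open>simp add: K_def\<close>)
  have "(\<lambda>n. \<Phi> (X (r n))) \<longlonglongrightarrow> \<Phi> x"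
    unfolding \<Phi>_def nsq_def
  proof (rule integral_dominated_convergence[OF _ _ int4[of 1]])
    show "AE k in ?M. (\<lambda>n. (cmod (cinner (X (r n)) (e k)))\<^sup>2) \<longlonglongrightarrow> (cmod (cinner x (e k)))\<^sup>2"
      by (intro AE_I2 tendsto_intros r)
    have "(cmod (cinner (X (r n)) (e k)))\<^sup>2 \<le> (1/4) ^ k * 1" for n k
    proof -
      have "(norm (X (r n)))\<^sup>2 \<le> 1" using X1 by (simp add: power_le_one)
      then show ?thesis
        by (intro order_trans[OF e_bd mult_left_mono]) simp_all
    qed
    then show "AE k in ?M. norm ((cmod (cinner (X (r n)) (e k)))\<^sup>2) \<le> (1/4) ^ k * 1" for n by simp
  qed auto
  moreover have "(\<lambda>n. \<Phi> (X (r n))) \<longlonglongrightarrow> s"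
  proof (rule LIMSEQ_subseq_LIMSEQ[OF _ r(1), of "\<lambda>n. \<Phi> (X n)", unfolded o_def])
    show "(\<lambda>n. \<Phi> (X n)) \<longlonglongrightarrow> s"
    proof (rule tendsto_sandwich)
      show "\<forall>\<^sub>F n in sequentially. s - 1 / real (Suc n) \<le> \<Phi> (X n)" using X(2) by (simp add: less_imp_le)
      show "\<forall>\<^sub>F n in sequentially. \<Phi> (X n) \<le> s" using \<Phi>_s X(1) by simp
      show "(\<lambda>n. s - 1 / real (Suc n)) \<longlonglongrightarrow> s"
        using tendsto_diff[OF tendsto_const LIMSEQ_inverse_real_of_nat, of s] by (simp add: inverse_eq_divide)
    qed simp
  qed
  ultimately have max: "\<Phi> x = s" by (rule LIMSEQ_unique)
  have "y = 0" if "bessel \<L> (orb (x + y)) 1" "bessel \<L> (orb (x - y)) 1" for y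
  proof (rule \<Phi>_0)
    \<comment> \<open>The parallelogram law: two values that do not exceed the maximum \<Phi> x have
      the sum 2 \<Phi> x + 2 \<Phi> y.\<close>
    have "\<Phi> (x + y) + \<Phi> (x - y) = 2 * \<Phi> x + 2 * \<Phi> y"
      unfolding \<Phi>_def using nsq_parallelogram[OF sq sq, of x y] by (simp add: cinner_simps)
    moreover have "\<Phi> (x + y) \<le> s" "\<Phi> (x - y) \<le> s" using \<Phi>_s that by (auto simp: K_def)
    moreover have "\<Phi> y \<ge> 0" by (simp add: \<Phi>_def)
    ultimately show "\<Phi> y = 0" using max by linarith
  qed
  then show ?thesis using xK by blast
qed

text \<open>Perturbing an extremal \<open>x\<close> by \<open>(x - S x) / 2\<close> shows that its frame operator \<open>S\<close> is a
  projection; perturbing it by \<open>c (z - T x z x)\<close> gives \<open>z = T x z x\<close> on the kernel of \<open>S\<close>.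
  Applied to all translates of \<open>z\<close>, this forces \<open>\<parallel>x\<parallel> = 1\<close> by the ICC property.\<close>

lemma extremal_vector:
  "\<exists>x. bessel \<L> (orb x) 1 \<and> nsq \<L> (coef (orb x) x) = (norm x)\<^sup>2 \<and>
     ((\<forall>f. nsq \<L> (coef (orb x) f) = (norm f)\<^sup>2) \<or>
      norm x = 1 \<and> (\<exists>z b. z \<noteq> 0 \<and> bessel \<L> (orb z) b \<and>
        (\<forall>f. nsq \<L> (coef (orb z) f) \<le> b * ((norm f)\<^sup>2 - nsq \<L> (coef (orb x) f)))))"
proof -
  obtain x where x1: "bessel \<L> (orb x) 1"
    and ext: "\<And>y. bessel \<L> (orb (x + y)) 1 \<Longrightarrow> bessel \<L> (orb (x - y)) 1 \<Longrightarrow> y = 0"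
    using extremal_exists by blast
  have x: "x \<in> bessel_vectors" using x1 by (rule bessel_vectorsI)
  define S where "S = T x x"
  have S_cinner: "cinner (S f) h = ip \<L> (coef (orb x) f) (coef (orb x) h)" for f h
    by (simp add: S_def T_cinner x)
  have S_sa: "cinner (S f) h = cinner f (S h)" for f h by (simp add: S_def T_adjoint x)
  have S_pi: "\<delta> \<in> \<Gamma> \<Longrightarrow> S (\<pi> \<delta> f) = \<pi> \<delta> (S f)" for \<delta> f by (simp add: S_def T_pi x)
  have S_diff: "S (f - g) = S f - S g" and S_scaleC: "S (c *\<^sub>C f) = c *\<^sub>C S f" for f g c
    by (simp_all add: S_def T_diff T_scaleC x)
  have S_minus: "S (- f) = - S f" for f
    using S_scaleC[of "-1" f] scaleR_eq_scaleC[of "-1" f] scaleR_eq_scaleC[of "-1" "S f"] by simp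
  have S_add: "S (f + g) = S f + S g" for f g using S_diff[of f "- g"] by (simp add: S_minus)
  have S_scaleR: "S (r *\<^sub>R f) = r *\<^sub>R S f" for r f by (simp add: scaleR_eq_scaleC S_scaleC)
  have S_nsq: "nsq \<L> (coef (orb x) f) = Re (cinner (S f) f)" for f
    unfolding S_def by (rule T_self[OF x, symmetric])
  have S_le: "Re (cinner (S f) f) \<le> (norm f)\<^sup>2" for f
    using bessel_nsq[OF x1, of f] by (simp add: S_nsq)
  have S_ge: "Re (cinner (S f) f) \<ge> 0" for f using S_nsq[of f] nsq_nonneg[of \<L>] by metis
  have re_sym: "Re (cinner f (S f)) = Re (cinner (S f) f)" for f by (simp only: S_sa)
  have nsqf: "(norm f)\<^sup>2 = Re (cinner f f)" for f :: 'h by (simp add: cinner_self)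
  define y where "y = (1/2) *\<^sub>R (x - S x)"
  have Sx: "S x = x"
  proof -
    have plus: "bessel \<L> (orb (x + y)) 1"
    proof -
      have "bessel \<L> (orb ((1/2) *\<^sub>R (3 *\<^sub>R x - S x))) 1"
      proof (rule bessel_commute[where A = "\<lambda>w. (1/2) *\<^sub>R (3 *\<^sub>R w - S w)"])
        fix f
        \<comment> \<open>The frame operator of x + y is S (3 - S)^2 / 4. It is at most 1 because 4
          - s(3 - s)^2 = (1 - s)^2 (4 - s).\<close>
        have "0 \<le> 4 * (norm (f - S f))\<^sup>2 - Re (cinner (S (f - S f)) (f - S f))"
          using S_le[of "f - S f"] zero_le_power2[of "norm (f - S f)"] by linarith
        then have "4 * Re (cinner (S ((1/2) *\<^sub>R (3 *\<^sub>R f - S f))) ((1/2) *\<^sub>R (3 *\<^sub>R f - S f))) \<le> 4 * (norm f)\<^sup>2"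
          unfolding nsqf by (simp add: S_diff S_scaleR cinner_simps S_sa algebra_simps)
        then show "nsq \<L> (coef (orb x) ((1/2) *\<^sub>R (3 *\<^sub>R f - S f))) \<le> 1 * (norm f)\<^sup>2"
          unfolding S_nsq by linarith
      next
        show "(1/2) *\<^sub>R (3 *\<^sub>R \<pi> \<delta> f - S (\<pi> \<delta> f)) = \<pi> \<delta> ((1/2) *\<^sub>R (3 *\<^sub>R f - S f))" if "\<delta> \<in> \<Gamma>" for \<delta> f
          using that by (simp add: S_pi scaleR_eq_scaleC unitary_scaleC[OF pi_unitary] unitary_diff[OF pi_unitary])
      qed (auto simp: cinner_simps S_sa x)
      moreover have "(1/2) *\<^sub>R (3 *\<^sub>R x - S x) = x + y"
      proof -
        have "(1/2) *\<^sub>R (3 *\<^sub>R x - S x) = ((1/2) * 3) *\<^sub>R x - (1/2) *\<^sub>R S x" by (simp add: scaleR_diff_right)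
        also have "(1/2 * 3) *\<^sub>R x = 1 *\<^sub>R x + (1/2) *\<^sub>R x" unfolding scaleR_add_left[symmetric] by simp
        finally show ?thesis by (simp add: y_def scaleR_diff_right)
      qed
      ultimately show ?thesis by simp
    qed
    have minus: "bessel \<L> (orb (x - y)) 1"
    proof -
      have "bessel \<L> (orb ((1/2) *\<^sub>R (x + S x))) 1"
      proof (rule bessel_commute[where A = "\<lambda>w. (1/2) *\<^sub>R (w + S w)"])
        fix f
        \<comment> \<open>The frame operator of x - y is S (1 + S)^2 / 4, and 4 - s(1 + s)^2 = 3s(1
          - s)^2 + 4(1 - s) + 4s^2(1 - s).\<close>
        have "0 \<le> Re (cinner (S (f - S f)) (f - S f))" by (rule S_ge)
        then have "4 * Re (cinner (S ((1/2) *\<^sub>R (f + S f))) ((1/2) *\<^sub>R (f + S f))) \<le> 4 * (norm f)\<^sup>2"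
          using S_le[of f] S_le[of "S f"]
          unfolding nsqf by (simp add: S_diff S_add S_scaleR cinner_simps S_sa algebra_simps)
        then show "nsq \<L> (coef (orb x) ((1/2) *\<^sub>R (f + S f))) \<le> 1 * (norm f)\<^sup>2"
          unfolding S_nsq by linarith
      next
        show "(1/2) *\<^sub>R (\<pi> \<delta> f + S (\<pi> \<delta> f)) = \<pi> \<delta> ((1/2) *\<^sub>R (f + S f))" if "\<delta> \<in> \<Gamma>" for \<delta> f
          using that by (simp add: S_pi scaleR_eq_scaleC unitary_scaleC[OF pi_unitary] unitary_add[OF pi_unitary])
      qed (auto simp: cinner_simps S_sa x)
      moreover have "(1/2) *\<^sub>R (x + S x) = x - y"
      proof -
        have "x - y = 1 *\<^sub>R x - (1/2) *\<^sub>R x + (1/2) *\<^sub>R S x" by (simp add: y_def scaleR_diff_right)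
        also have "1 *\<^sub>R x - (1/2) *\<^sub>R x = (1/2) *\<^sub>R x" unfolding scaleR_diff_left[symmetric] by simp
        finally show ?thesis by (simp add: scaleR_add_right)
      qed
      ultimately show ?thesis by simp
    qed
    have "y = 0" by (rule ext[OF plus minus])
    then show ?thesis by (simp add: y_def)
  qed
  have coef_S: "coef (orb w) (S f) \<gamma> = coef (orb (S w)) f \<gamma>" if "\<gamma> \<in> \<Gamma>" for w f \<gamma>
    by (rule coef_commute[OF S_sa S_pi that, symmetric])
  \<comment> \<open>From S x = x follows \<open>C_x S = C_x\<close>, and composing with the adjoint
    of \<open>C_x\<close> gives S S = S.\<close>
  have SS: "S (S f) = S f" for f
  proof (rule cinner_ext)
    fix h
    show "cinner (S (S f)) h = cinner (S f) h"
    proof -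
      have "cinner (S (S f)) h = ip \<L> (coef (orb x) (S f)) (coef (orb x) h)" by (rule S_cinner)
      also have "\<dots> = ip \<L> (coef (orb x) f) (coef (orb x) h)"
        by (rule ip_cong) (auto simp: coef_S Sx)
      also have "\<dots> = cinner (S f) h" by (rule S_cinner[symmetric])
      finally show ?thesis .
    qed
  qed
  have split: "(norm (f - S f))\<^sup>2 = (norm f)\<^sup>2 - nsq \<L> (coef (orb x) f)" for f
    unfolding nsqf S_nsq by (simp add: cinner_simps S_sa SS)
  have xx: "nsq \<L> (coef (orb x) x) = (norm x)\<^sup>2" by (simp add: S_nsq Sx cinner_self)
  show ?thesis
  proof (cases "\<forall>f. nsq \<L> (coef (orb x) f) = (norm f)\<^sup>2")
    case True
    then show ?thesis using x1 xx by blast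
  next
    case False
    then obtain f0 where "nsq \<L> (coef (orb x) f0) \<noteq> (norm f0)\<^sup>2" by blast
    then have f0: "f0 - S f0 \<noteq> 0" using split[of f0] by auto
    \<comment> \<open>The projection 1 - S is nonzero, so it cannot vanish on the dense set of
      Bessel vectors. Its value at a suitable one is a nonzero Bessel vector in the kernel of
      S.\<close>
    have "\<exists>z0\<in>bessel_vectors. z0 - S z0 \<noteq> 0"
    proof (rule ccontr)
      assume "\<not> ?thesis"
      then have *: "z0 - S z0 = 0" if "z0 \<in> bessel_vectors" for z0 using that by blast
      have "f0 - S f0 = 0"
      proof (rule orthogonal_dense_eq_0[OF bessel_vectors_dense])
        fix w assume "w \<in> bessel_vectors"
        then have "cinner f0 (w - S w) = 0" using * by simp
        then show "cinner (f0 - S f0) w = 0" by (simp add: cinner_simps S_sa)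
      qed
      then show False using f0 by simp
    qed
    then obtain z0 b0 where z0: "bessel \<L> (orb z0) b0" "z0 - S z0 \<noteq> 0"
      by (auto simp: bessel_vectors_def)
    define z where "z = z0 - S z0"
    define b where "b = max b0 1"
    have b: "b > 0" "b0 \<le> b" by (auto simp: b_def)
    have z_ne: "z \<noteq> 0" and Sz: "S z = 0" using z0 by (simp_all add: z_def S_diff SS)
    have zb: "bessel \<L> (orb z) b"
      unfolding z_def
    proof (rule bessel_commute[where A = "\<lambda>w. w - S w"])
      fix f
      have "nsq \<L> (coef (orb z0) (f - S f)) \<le> b0 * (norm (f - S f))\<^sup>2" by (rule bessel_nsq[OF z0(1)])
      also have "\<dots> \<le> b * (norm (f - S f))\<^sup>2" using b by (intro mult_right_mono) auto
      also have "\<dots> \<le> b * (norm f)\<^sup>2"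
        unfolding split using b by (intro mult_left_mono) auto
      finally show "nsq \<L> (coef (orb z0) (f - S f)) \<le> b * (norm f)\<^sup>2" .
    qed (auto simp: cinner_simps S_sa S_pi unitary_diff[OF pi_unitary] bessel_vectorsI[OF z0(1)])
    have step: "z = T x z x \<and> (\<forall>f. nsq \<L> (coef (orb z) f) \<le> b * ((norm f)\<^sup>2 - nsq \<L> (coef (orb x) f)))"
      if zb: "bessel \<L> (orb z) b" and Sz: "S z = 0" for z
    proof -
      have z: "z \<in> bessel_vectors" using zb by (rule bessel_vectorsI)
      define w where "w = T x z x"
      \<comment> \<open>With |c|^2 b = 1 the perturbation will just fill the gap between the frame
        operator of x and the identity.\<close>
      define c where "c = complex_of_real (1 / sqrt b)"
      have c: "(cmod c)\<^sup>2 * b = 1" using b(1) unfolding c_def norm_of_real by (simp add: power_divide)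
      let ?q = "\<lambda>f. T z x f"
      let ?F = "\<lambda>f. coef (orb x) f"
      let ?Z = "\<lambda>f. coef (orb z) f"
      let ?W = "\<lambda>f. coef (orb x) (?q f)"
      let ?Y = "\<lambda>f \<gamma>. ?Z f \<gamma> - ?W f \<gamma>"
      have F: "square_integrable \<L> (?F f)" and Z: "square_integrable \<L> (?Z f)"
        and W: "square_integrable \<L> (?W f)" for f
        using coef_sq x z by auto
      have Y: "square_integrable \<L> (?Y f)" for f by (rule square_integrable_diff[OF Z W])
      \<comment> \<open>This reads \<open>C_w = C_x C_x^* C_z\<close>, so \<open>?Y f\<close> is the
        component of \<open>C_z f\<close> orthogonal to the range of \<open>C_x\<close>.\<close>
      have w_coef: "cinner f (\<pi> \<gamma> w) = ?W f \<gamma>" if "\<gamma> \<in> \<Gamma>" for f \<gamma>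
      proof -
        have "cinner f (\<pi> \<gamma> w) = cinner (T z x (\<pi> (- \<gamma>) f)) x"
          unfolding w_def cinner_pi_right by (simp add: T_adjoint z x)
        then show ?thesis using that by (simp add: T_pi x z uminus_in cinner_pi_left)
      qed
      have ZF: "ip \<L> (?Z f) (?F h) = cinner (?q f) h" for f h by (simp add: T_cinner x z)
      have Sq: "S (?q f) = ?q f" for f
      proof (rule cinner_ext)
        fix h
        have "cinner (S (?q f)) h = cinner (?q f) (S h)" by (rule S_sa)
        also have "\<dots> = ip \<L> (?Z f) (?F (S h))" by (rule ZF[symmetric])
        also have "\<dots> = ip \<L> (?Z f) (?F h)" by (rule ip_cong) (auto simp: coef_S Sx)
        also have "\<dots> = cinner (?q f) h" by (rule ZF)
        finally show "cinner (S (?q f)) h = cinner (?q f) h" .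
      qed
      have YF: "ip \<L> (?Y f) (?F h) = 0" for f h
      proof -
        have "ip \<L> (?Y f) (?F h) = ip \<L> (?Z f) (?F h) - ip \<L> (?W f) (?F h)"
          by (rule ip_diff_left[OF Z W F])
        also have "ip \<L> (?W f) (?F h) = cinner (?q f) h" by (simp add: S_cinner[symmetric] Sq)
        finally show ?thesis by (simp add: ZF)
      qed
      have nsq_Z: "nsq \<L> (?Z f) \<le> b * ((norm f)\<^sup>2 - nsq \<L> (?F f))" for f
      proof -
        \<comment> \<open>Since S z = 0, the map \<open>C_z\<close> vanishes on the range of
          S.\<close>
        have "?Z f \<gamma> = ?Z (f - S f) \<gamma>" if "\<gamma> \<in> \<Gamma>" for \<gamma>
        proof -
          have "?Z (S f) \<gamma> = 0"
            unfolding coef_S[OF that] Sz using unitary_scaleC[OF pi_unitary, of \<gamma> 0 0] by simp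
          then show ?thesis by (simp add: cinner_diff_left)
        qed
        then have "nsq \<L> (?Z f) = nsq \<L> (?Z (f - S f))" by (intro nsq_cong) simp
        also have "\<dots> \<le> b * (norm (f - S f))\<^sup>2" by (rule bessel_nsq[OF zb])
        finally show ?thesis by (simp add: split)
      qed
      have nsq_Y: "nsq \<L> (?Y f) \<le> nsq \<L> (?Z f)" for f
      proof -
        have "nsq \<L> (?Z f) = nsq \<L> (\<lambda>\<gamma>. ?Y f \<gamma> + ?W f \<gamma>)" by simp
        also have "\<dots> = nsq \<L> (?Y f) + nsq \<L> (?W f)"
          using nsq_add[OF Y W, of f f] YF by simp
        finally show ?thesis using nsq_nonneg[of \<L> "?W f"] by linarith
      qed
      \<comment> \<open>By orthogonality the squared norms add up: that of \<open>?F f\<close> plus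
        |c|^2 times that of \<open>?Y f\<close>, and the second summand is at most the defect of
        \<open>?F f\<close> from the squared norm of f.\<close>
      have pert: "bessel \<L> (orb (x + a *\<^sub>C (z - w))) 1" if a: "cmod a = cmod c" for a
        unfolding bessel_def
      proof
        fix f
        have eq: "coef (orb (x + a *\<^sub>C (z - w))) f \<gamma> = ?F f \<gamma> + cnj a * ?Y f \<gamma>" if "\<gamma> \<in> \<Gamma>" for \<gamma>
          using w_coef[OF that] by (simp add: unitary_add[OF pi_unitary] unitary_scaleC[OF pi_unitary]
              unitary_diff[OF pi_unitary] cinner_simps)
        have aY: "square_integrable \<L> (\<lambda>\<gamma>. cnj a * ?Y f \<gamma>)" by (rule square_integrable_cmult[OF Y])
        have "ip \<L> (?F f) (\<lambda>\<gamma>. cnj a * ?Y f \<gamma>) = a * cnj (ip \<L> (?Y f) (?F f))"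
          unfolding ip_cmult_right by (simp add: ip_cnj[of \<L> "?F f" "?Y f"])
        then have "nsq \<L> (\<lambda>\<gamma>. ?F f \<gamma> + cnj a * ?Y f \<gamma>) = nsq \<L> (?F f) + (cmod c)\<^sup>2 * nsq \<L> (?Y f)"
          using nsq_add[OF F aY] by (simp only: YF nsq_cmult complex_mod_cnj a) simp
        also have "\<dots> \<le> nsq \<L> (?F f) + (cmod c)\<^sup>2 * (b * ((norm f)\<^sup>2 - nsq \<L> (?F f)))"
          by (intro add_left_mono mult_left_mono order_trans[OF nsq_Y nsq_Z]) simp
        also have "\<dots> = (norm f)\<^sup>2" unfolding mult.assoc[symmetric] c by simp
        finally show "square_integrable \<L> (coef (orb (x + a *\<^sub>C (z - w))) f) \<and>
            nsq \<L> (coef (orb (x + a *\<^sub>C (z - w))) f) \<le> 1 * (norm f)\<^sup>2"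
          using square_integrable_cong_\<L>[OF eq] square_integrable_add[OF F aY] by simp
      qed
      have "c *\<^sub>C (z - w) = 0"
      proof (rule ext)
        show "bessel \<L> (orb (x + c *\<^sub>C (z - w))) 1" by (rule pert) simp
        have "x - c *\<^sub>C (z - w) = x + (- c) *\<^sub>C (z - w)" by simp
        then show "bessel \<L> (orb (x - c *\<^sub>C (z - w))) 1" using pert[of "- c"] by simp
      qed
      then have "z = w" using b(1) by (simp add: c_def)
      then show ?thesis using nsq_Z by (simp add: w_def)
    qed
    have z: "z \<in> bessel_vectors" using zb by (rule bessel_vectorsI)
    have "cinner z z = cinner x x * cnj (cinner z z)"
    proof -
      \<comment> \<open>Every translate of z satisfies the same identity. Conjugation removes the
        translation from the second factor, so the pairing of the conjugated
        \<open>coef (orb x) x\<close> with \<open>coef (orb z) z\<close> is \<langle>z, z\<rangle>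
        for every a.\<close>
      have "cinner z z = coef (orb x) x 0 * cnj (coef (orb z) z 0)"
      proof (rule icc_average)
        show "square_integrable \<L> (coef (orb x) x)" "square_integrable \<L> (coef (orb z) z)"
          using coef_sq x z by auto
        fix a assume a: "a \<in> \<Gamma>"
        have "S (\<pi> a z) = 0" using S_pi[OF a, of z] Sz unitary_scaleC[OF pi_unitary, of a 0 0] by simp
        then have "\<pi> a z = T x (\<pi> a z) x" using step[OF bessel_pi[OF zb a]] by blast
        then have "cinner z z = cinner (T x (\<pi> a z) x) (\<pi> a z)" by (metis pi_cinner)
        also have "\<dots> = ip \<L> (coef (orb x) x) (coef (orb (\<pi> a z)) (\<pi> a z))"
          using T_cinner x bessel_vectors_pi[OF z a] by blast
        also have "\<dots> = ip \<L> (\<lambda>\<gamma>. coef (orb x) x (a + \<gamma> + - a)) (\<lambda>\<gamma>. coef (orb (\<pi> a z)) (\<pi> a z) (a + \<gamma> + - a))"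
          by (rule bij_square_integrable(3)[OF bij_conj[OF a], symmetric])
        also have "(\<lambda>\<gamma>. coef (orb (\<pi> a z)) (\<pi> a z) (a + \<gamma> + - a)) = coef (orb z) z"
        proof
          fix \<gamma>
          have "\<pi> (a + \<gamma> + - a) (\<pi> a z) = \<pi> a (\<pi> \<gamma> z)" by (simp add: pi_add[symmetric] add.assoc)
          then show "coef (orb (\<pi> a z)) (\<pi> a z) (a + \<gamma> + - a) = coef (orb z) z \<gamma>" by simp
        qed
        finally show "ip \<L> (\<lambda>\<gamma>. coef (orb x) x (a + \<gamma> + - a)) (coef (orb z) z) = cinner z z" ..
      qed
      then show ?thesis by simp
    qed
    then have "cinner x x = 1" using z_ne by (simp add: cinner_self)
    then have "(norm x)\<^sup>2 = 1" unfolding cinner_self of_real_eq_1_iff .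
    then have "norm x = 1" by (simp add: power2_eq_1_iff) (use norm_ge_zero[of x] in linarith)
    then show ?thesis using x1 xx z_ne zb step[OF zb Sz] by blast
  qed
qed


section \<open>The trace and the existence results\<close>

lemma nsq_measurable:
  assumes u: "u \<in> bessel_vectors"
  shows "(\<lambda>\<omega>. nsq \<L> (coef (orb u) (\<pi> (- \<omega>) h))) \<in> borel_measurable \<nu>"
proof -
  interpret L: sigma_finite_measure \<L>
    by (rule sigma_finite_measure_count_space_countable[OF countable])
  have "(\<lambda>(\<gamma>, \<omega>). ennreal ((cmod (cinner (\<pi> (- \<omega>) h) (\<pi> \<gamma> u)))\<^sup>2)) \<in> borel_measurable (\<L> \<Otimes>\<^sub>M \<nu>)"
  proof (rule measurable_pair_measure_countable1[OF countable])
    fix \<gamma>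
    have "(\<lambda>\<omega>. cinner (\<pi> (- \<omega>) h) (\<pi> \<gamma> u)) = (\<lambda>\<omega>. cnj (cinner (\<pi> \<gamma> u) (\<pi> (- \<omega>) h)))"
      by (simp flip: cinner_commute)
    then have [measurable]: "(\<lambda>\<omega>. cinner (\<pi> (- \<omega>) h) (\<pi> \<gamma> u)) \<in> borel_measurable \<nu>"
      using measurable_compose[OF coef_nu_measurable borel_measurable_cnj] by simp
    show "(\<lambda>\<omega>. case (\<gamma>, \<omega>) of (\<gamma>, \<omega>) \<Rightarrow> ennreal ((cmod (cinner (\<pi> (- \<omega>) h) (\<pi> \<gamma> u)))\<^sup>2)) \<in> borel_measurable \<nu>"
      by simp
  qed
  from measurable_pair_swap[OF this]
  have "(\<lambda>(\<omega>, \<gamma>). ennreal ((cmod (cinner (\<pi> (- \<omega>) h) (\<pi> \<gamma> u)))\<^sup>2)) \<in> borel_measurable (\<nu> \<Otimes>\<^sub>M \<L>)"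
    by simp
  from L.borel_measurable_nn_integral_fst[OF this]
  have "(\<lambda>\<omega>. enn2real (\<integral>\<^sup>+\<gamma>. ennreal ((cmod (cinner (\<pi> (- \<omega>) h) (\<pi> \<gamma> u)))\<^sup>2) \<partial>\<L>)) \<in> borel_measurable \<nu>"
    by simp
  then show ?thesis by (simp add: nn_integral_cmod_sq[OF coef_sq[OF u]])
qed

lemma trace_nsq:
  assumes u: "u \<in> bessel_vectors"
  shows "integrable \<nu> (\<lambda>\<omega>. nsq \<L> (coef (orb u) (\<pi> (- \<omega>) h)))"
    and "(\<integral>\<omega>. nsq \<L> (coef (orb u) (\<pi> (- \<omega>) h)) \<partial>\<nu>) = form_const * (norm h)\<^sup>2 * (norm u)\<^sup>2"
proof -
  have nn: "(\<integral>\<^sup>+\<omega>. ennreal (nsq \<L> (coef (orb u) (\<pi> (- \<omega>) h))) \<partial>\<nu>)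
      = ennreal (form_const * (norm h)\<^sup>2 * (norm u)\<^sup>2)"
    using trace_nn[of h u] by (simp add: nn_integral_cmod_sq[OF coef_sq[OF u]])
  show "integrable \<nu> (\<lambda>\<omega>. nsq \<L> (coef (orb u) (\<pi> (- \<omega>) h)))"
    by (rule integrableI_nonneg[OF nsq_measurable[OF u]]) (simp_all add: nn)
  show "(\<integral>\<omega>. nsq \<L> (coef (orb u) (\<pi> (- \<omega>) h)) \<partial>\<nu>) = form_const * (norm h)\<^sup>2 * (norm u)\<^sup>2"
    using form_const_pos
    by (subst integral_eq_nn_integral[OF nsq_measurable[OF u]]) (simp_all add: nn)
qed

text \<open>Polarisation of \<open>trace_nsq\<close> through the Bessel vector u + v. It evaluates
  the real part of the trace of \<open>T u v\<close>.\<close>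

lemma trace_ip:
  assumes u: "u \<in> bessel_vectors" and v: "v \<in> bessel_vectors"
  shows "integrable \<nu> (\<lambda>\<omega>. Re (ip \<L> (coef (orb u) (\<pi> (- \<omega>) h)) (coef (orb v) (\<pi> (- \<omega>) h))))"
    and "(\<integral>\<omega>. Re (ip \<L> (coef (orb u) (\<pi> (- \<omega>) h)) (coef (orb v) (\<pi> (- \<omega>) h))) \<partial>\<nu>)
      = form_const * (norm h)\<^sup>2 * Re (cinner u v)"
proof -
  let ?N = "\<lambda>u \<omega>. nsq \<L> (coef (orb u) (\<pi> (- \<omega>) h))"
  have uv: "u + v \<in> bessel_vectors" by (rule csubspace_add[OF csubspace_bessel_vectors u v])
  have pol: "Re (ip \<L> (coef (orb u) f) (coef (orb v) f))
      = (nsq \<L> (coef (orb (u + v)) f) - nsq \<L> (coef (orb u) f) - nsq \<L> (coef (orb v) f)) / 2" for f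
  proof -
    have "coef (orb (u + v)) f = (\<lambda>\<gamma>. coef (orb u) f \<gamma> + coef (orb v) f \<gamma>)"
      by (simp add: unitary_add[OF pi_unitary] cinner_add_right)
    then show ?thesis using nsq_add[OF coef_sq[OF u] coef_sq[OF v], of f f] by simp
  qed
  show "integrable \<nu> (\<lambda>\<omega>. Re (ip \<L> (coef (orb u) (\<pi> (- \<omega>) h)) (coef (orb v) (\<pi> (- \<omega>) h))))"
    unfolding pol by (intro Bochner_Integration.integrable_diff integrable_divide trace_nsq u v uv)
  have "(\<integral>\<omega>. (?N (u + v) \<omega> - ?N u \<omega> - ?N v \<omega>) / 2 \<partial>\<nu>)
      = ((\<integral>\<omega>. ?N (u + v) \<omega> \<partial>\<nu>) - (\<integral>\<omega>. ?N u \<omega> \<partial>\<nu>) - (\<integral>\<omega>. ?N v \<omega> \<partial>\<nu>)) / 2"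
    using trace_nsq(1)[OF u] trace_nsq(1)[OF v] trace_nsq(1)[OF uv] by simp
  also have "\<dots> = form_const * (norm h)\<^sup>2 * Re (cinner u v)"
    using norm_add_sq[of u v] unfolding trace_nsq(2)[OF u] trace_nsq(2)[OF v] trace_nsq(2)[OF uv]
    by (simp add: algebra_simps)
  finally show "(\<integral>\<omega>. Re (ip \<L> (coef (orb u) (\<pi> (- \<omega>) h)) (coef (orb v) (\<pi> (- \<omega>) h))) \<partial>\<nu>)
      = form_const * (norm h)\<^sup>2 * Re (cinner u v)"
    unfolding pol .
qed

lemma measure_nu [simp]: "measure \<nu> (space \<nu>) = vol"
  unfolding measure_def emeasure_nu by (simp add: vol_def)

lemma integrable_nu_const: "integrable \<nu> (\<lambda>\<omega>. a :: real)"
  and integral_nu_const: "(\<integral>\<omega>. (a :: real) \<partial>\<nu>) = a * vol"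
proof -
  interpret finite_measure \<nu> by (rule finite_measure_nu)
  show "integrable \<nu> (\<lambda>\<omega>. a)" by simp
  show "(\<integral>\<omega>. a \<partial>\<nu>) = a * vol" by simp
qed

lemma unit_vector: "\<exists>h :: 'h. norm h = 1"
proof -
  obtain u :: 'h where "u \<noteq> 0" using irr unfolding irreducible_rep_def by blast
  then show ?thesis by (intro exI[of _ "u /\<^sub>R norm u"]) simp
qed

text \<open>The hypothesis says that the real part of \<open>T u v\<close> is at most the identity,
  whose trace is \<open>vol\<close>.\<close>

lemma trace_ip_le:
  assumes "u \<in> bessel_vectors" "v \<in> bessel_vectors"
    and le: "\<And>f. Re (ip \<L> (coef (orb u) f) (coef (orb v) f)) \<le> (norm f)\<^sup>2"
  shows "form_const * Re (cinner u v) \<le> vol"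
proof -
  obtain h :: 'h where h: "norm h = 1" using unit_vector by blast
  have "form_const * (norm h)\<^sup>2 * Re (cinner u v) \<le> (\<integral>\<omega>. (norm h)\<^sup>2 \<partial>\<nu>)"
    unfolding trace_ip(2)[OF assms(1,2), symmetric]
    by (intro integral_mono trace_ip assms integrable_nu_const) (use le[of "\<pi> _ h"] in simp)
  then show ?thesis by (simp add: integral_nu_const h)
qed

lemma bessel_1_trace:
  assumes "bessel \<L> (orb x) 1" shows "form_const * (norm x)\<^sup>2 \<le> vol"
  using trace_ip_le[of x x] bessel_nsq[OF assms] bessel_vectorsI[OF assms] by (simp add: ip_self cinner_self)

lemma parseval_trace:
  assumes "bessel \<L> (orb x) 1" "\<And>f. nsq \<L> (coef (orb x) f) = (norm f)\<^sup>2"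
  shows "form_const * (norm x)\<^sup>2 = vol"
proof -
  obtain h :: 'h where h: "norm h = 1" using unit_vector by blast
  show ?thesis
    using trace_nsq(2)[OF bessel_vectorsI[OF assms(1)], of h] by (simp add: assms(2) integral_nu_const h)
qed

text \<open>In the other alternative for the extremal vector the frame operator S has trace c, as x
  is a unit vector, so c = vol and 1 - S has trace 0. The form of z is dominated by b (1 - S), which
  forces z = 0.\<close>

lemma parseval_exists:
  assumes "vol \<le> form_const"
  shows "\<exists>x. bessel \<L> (orb x) 1 \<and> (\<forall>f. nsq \<L> (coef (orb x) f) = (norm f)\<^sup>2) \<and>
    nsq \<L> (coef (orb x) x) = (norm x)\<^sup>2"
proof -
  obtain x where x: "bessel \<L> (orb x) 1" "nsq \<L> (coef (orb x) x) = (norm x)\<^sup>2"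
    and alt: "(\<forall>f. nsq \<L> (coef (orb x) f) = (norm f)\<^sup>2) \<or>
      norm x = 1 \<and> (\<exists>z b. z \<noteq> 0 \<and> bessel \<L> (orb z) b \<and>
        (\<forall>f. nsq \<L> (coef (orb z) f) \<le> b * ((norm f)\<^sup>2 - nsq \<L> (coef (orb x) f))))"
    using extremal_vector by blast
  have False if "norm x = 1" and z: "z \<noteq> 0" "bessel \<L> (orb z) b"
    "\<And>f. nsq \<L> (coef (orb z) f) \<le> b * ((norm f)\<^sup>2 - nsq \<L> (coef (orb x) f))" for z b
  proof -
    have eq: "form_const = vol" using bessel_1_trace[OF x(1)] that(1) assms by simp
    obtain h :: 'h where h: "norm h = 1" using unit_vector by blast
    have "form_const * (norm h)\<^sup>2 * (norm z)\<^sup>2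
        \<le> (\<integral>\<omega>. b * ((norm h)\<^sup>2 - nsq \<L> (coef (orb x) (\<pi> (- \<omega>) h))) \<partial>\<nu>)"
      unfolding trace_nsq(2)[OF bessel_vectorsI[OF z(2)], symmetric]
      by (intro integral_mono trace_nsq integrable_mult_right Bochner_Integration.integrable_diff
          integrable_nu_const bessel_vectorsI[OF z(2)] bessel_vectorsI[OF x(1)])
         (use z(3)[of "\<pi> _ h"] in simp)
    also have "\<dots> = b * (vol - form_const)"
      using trace_nsq[OF bessel_vectorsI[OF x(1)], of h] that(1) h
      by (simp add: integrable_nu_const integral_nu_const)
    finally have "form_const * (norm z)\<^sup>2 \<le> 0" using eq h by simp
    then show False using form_const_pos z(1) by (simp add: mult_le_0_iff)
  qed
  then show ?thesis using x alt by blast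
qed

text \<open>In the Parseval alternative comparing traces gives the squared norm vol / c of x, which
  is at least 1, while the Bessel bound 1 keeps it at most 1.\<close>

lemma unit_exists:
  assumes "form_const \<le> vol"
  shows "\<exists>x. norm x = 1 \<and> nsq \<L> (coef (orb x) x) = (norm x)\<^sup>2 \<and> x \<in> bessel_vectors"
proof -
  obtain x where x: "bessel \<L> (orb x) 1" "nsq \<L> (coef (orb x) x) = (norm x)\<^sup>2"
    and alt: "(\<forall>f. nsq \<L> (coef (orb x) f) = (norm f)\<^sup>2) \<or> norm x = 1"
    using extremal_vector by blast
  have "norm x = 1" if "\<forall>f. nsq \<L> (coef (orb x) f) = (norm f)\<^sup>2"
  proof -
    have "form_const * 1 \<le> form_const * (norm x)\<^sup>2"
      using parseval_trace[OF x(1)] that assms by simp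
    then have "1 \<le> (norm x)\<^sup>2" using form_const_pos by (simp only: mult_le_cancel_left_pos)
    then have "1 \<le> norm x" using norm_ge_zero by (simp add: abs_le_square_iff[of 1 "norm x", simplified])
    then show ?thesis using bessel_1_norm_le[OF x(1)] by simp
  qed
  then show ?thesis using x alt bessel_vectorsI by blast
qed

text \<open>The coefficient at the identity already exhausts the sum of squares, so all others
  vanish.\<close>

lemma orthonormal_system_orbit:
  assumes "norm x = 1" "nsq \<L> (coef (orb x) x) = (norm x)\<^sup>2" "x \<in> bessel_vectors"
  shows "orthonormal_system \<Gamma> (orb x)"
proof -
  have zero: "cinner x (\<pi> \<gamma> x) = 0" if "\<gamma> \<in> \<Gamma>" "\<gamma> \<noteq> 0" for \<gamma>
  proof -
    have "(\<Sum>t\<in>{0, \<gamma>}. (cmod (coef (orb x) x t))\<^sup>2) \<le> nsq \<L> (coef (orb x) x)"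
      using that zero_in by (intro sum_le_nsq coef_sq assms) auto
    then show ?thesis using that assms by (simp add: cinner_self)
  qed
  show ?thesis
    unfolding orthonormal_system_def
  proof (intro ballI)
    fix i j assume ij: "i \<in> \<Gamma>" "j \<in> \<Gamma>"
    have "cinner (\<pi> i x) (\<pi> j x) = cinner x (\<pi> (- i + j) x)"
      by (simp add: cinner_pi_left pi_add)
    moreover have "- i + j = 0 \<longleftrightarrow> i = j"
      using add_left_cancel[of i "- i + j" 0] by (auto simp: add.assoc[symmetric])
    ultimately show "cinner (\<pi> i x) (\<pi> j x) = (if i = j then 1 else 0)"
      using zero[of "- i + j"] ij assms(1) by (auto simp: add_in uminus_in cinner_self)
  qed
qed

section \<open>Necessary conditions\<close>

lemma frame_resolvent_orb: "s > 0 \<Longrightarrow> frame_resolvent \<L> (orb g) s"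
  by unfold_locales auto

abbreviation RB :: "'h \<Rightarrow> real \<Rightarrow> 'h \<Rightarrow> 'h" where
  "RB g s \<equiv> frame_resolvent.B \<L> (orb g) s"

text \<open>Up to conjugation and \<gamma> \<mapsto> -\<gamma>, the coefficients of f along the
  orbit of g are those of g along the orbit of f. So Bessel vectors belong to the domain for every
  g.\<close>

lemma frame_domain_orb_dense: "closure (frame_domain \<L> (orb g)) = UNIV"
proof -
  have "bessel_vectors \<subseteq> frame_domain \<L> (orb g)"
  proof
    fix f assume "f \<in> bessel_vectors"
    then have "square_integrable \<L> (\<lambda>\<gamma>. coef (orb f) g (- \<gamma>))"
      using coef_sq[of f g] bij_square_integrable(1)[OF bij_uminus, of "coef (orb f) g"] by blast
    then show "f \<in> frame_domain \<L> (orb g)"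
      unfolding frame_domain_def by (subst coef_flip) (simp add: square_integrable_cnj)
  qed
  then show ?thesis using bessel_vectors_dense closure_mono by blast
qed

lemma RB_pi:
  assumes s: "s > 0" and \<delta>: "\<delta> \<in> \<Gamma>"
  shows "RB g s (\<pi> \<delta> f) = \<pi> \<delta> (RB g s f)"
proof -
  interpret frame_resolvent \<L> "orb g" s by (rule frame_resolvent_orb[OF s])
  have shift: "coef (orb g) (\<pi> a f) = (\<lambda>\<gamma>. coef (orb g) f (- a + \<gamma>))" for a f
    by (rule ext) (rule coef_pi)
  have dom_pi: "\<pi> a f \<in> frame_domain \<L> (orb g)" if "a \<in> \<Gamma>" "f \<in> frame_domain \<L> (orb g)" for a f
    using that bij_square_integrable(1)[OF bij_left[of "- a"], of "coef (orb g) f"]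
    by (simp add: frame_domain_def shift uminus_in)
  show ?thesis
  proof (rule B_commute)
    show "\<pi> \<delta> ` frame_domain \<L> (orb g) = frame_domain \<L> (orb g)"
    proof (intro equalityI subsetI)
      fix f assume "f \<in> frame_domain \<L> (orb g)"
      then show "f \<in> \<pi> \<delta> ` frame_domain \<L> (orb g)"
        using dom_pi[of "- \<delta>" f] \<delta> by (intro image_eqI[of _ _ "\<pi> (- \<delta>) f"]) (auto simp: uminus_in)
    qed (auto intro: dom_pi \<delta>)
    show "ip \<L> (coef (orb g) (\<pi> \<delta> f)) (coef (orb g) (\<pi> \<delta> f')) = ip \<L> (coef (orb g) f) (coef (orb g) f')"
      for f f'
      unfolding shift by (rule bij_square_integrable(3)[OF bij_left]) (rule uminus_in[OF \<delta>])
  qed simp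
qed

lemma RB_coef:
  assumes "s > 0" "\<gamma> \<in> \<Gamma>"
  shows "coef (orb (RB g s w)) f \<gamma> = coef (orb w) (RB g s f) \<gamma>"
  by (rule coef_commute[OF _ RB_pi[OF assms(1)] assms(2)])
     (rule frame_resolvent.B_selfadjoint[OF frame_resolvent_orb[OF assms(1)]])

text \<open>The analysis map of \<open>B g\<close> is \<open>C_g B\<close>, which is bounded even
  when \<open>C_g\<close> is not.\<close>

lemma RB_bessel:
  assumes s: "s > 0" shows "bessel \<L> (orb (RB g s g)) (1 / s)"
proof -
  interpret frame_resolvent \<L> "orb g" s by (rule frame_resolvent_orb[OF s])
  show ?thesis
    unfolding bessel_def
  proof
    fix f
    note cong = square_integrable_cong_\<L>[of "coef (orb (B g)) f" "coef (orb g) (B f)", OF RB_coef[OF s]]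
    show "square_integrable \<L> (coef (orb (B g)) f) \<and> nsq \<L> (coef (orb (B g)) f) \<le> 1 / s * (norm f)\<^sup>2"
      using cong B_square_integrable[of f] nsq_coef_B_le[of f] s by (simp add: pos_le_divide_eq mult.commute)
  qed
qed

text \<open>With \<open>y = s (1 + s C\<^sup>* C)\<^sup>-\<^sup>1 v\<close>, the number \<open>\<langle>y, v\<rangle>\<close> is at the same time the trace of
  \<open>s C\<^sup>* C (1 + s C\<^sup>* C)\<^sup>-\<^sup>1\<close> on the representation space and of
  \<open>s C C\<^sup>* (1 + s C C\<^sup>*)\<^sup>-\<^sup>1\<close> on \<open>\<ell>\<^sup>2\<close>.\<close>

lemma resolvent_vector:
  assumes v: "v \<in> bessel_vectors" and s: "s > 0"
  defines "y \<equiv> s *\<^sub>R RB v s v"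
  shows "y \<in> bessel_vectors"
    and "cinner y m + s * ip \<L> (coef (orb v) y) (coef (orb v) m) = s * cinner v m"
    and "Re (ip \<L> (coef (orb y) f) (coef (orb v) f)) = (norm f)\<^sup>2 - Re (cinner (RB v s f) f)"
    and "(norm y)\<^sup>2 \<le> s" and "nsq \<L> (coef (orb v) y) \<le> 1" and "Re (cinner y v) \<le> 1"
proof -
  interpret frame_resolvent \<L> "orb v" s by (rule frame_resolvent_orb[OF s])
  have dom: "m \<in> frame_domain \<L> (orb v)" for m by (simp add: frame_domain_def coef_sq v)
  have yB: "y = B (s *\<^sub>R v)" by (simp add: y_def scaleR_eq_scaleC B_scaleC)
  have "B v \<in> bessel_vectors" by (rule bessel_vectorsI[OF RB_bessel[OF s]])
  then show y: "y \<in> bessel_vectors"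
    unfolding y_def by (rule csubspace_scaleR[OF csubspace_bessel_vectors])
  show eq: "cinner y m + s * ip \<L> (coef (orb v) y) (coef (orb v) m) = s * cinner v m" for m
    using B_eq[OF dom, of "s *\<^sub>R v" m] unfolding yB cinner_scaleR_left[of s v] .
  have "ip \<L> (coef (orb y) f) (coef (orb v) f) = ip \<L> (\<lambda>\<gamma>. s * coef (orb v) (B f) \<gamma>) (coef (orb v) f)"
  proof (rule ip_cong)
    fix \<gamma> assume "\<gamma> \<in> space \<L>"
    then show "coef (orb y) f \<gamma> = s * coef (orb v) (B f) \<gamma>"
      using RB_coef[OF s, of \<gamma> f v v]
      by (simp add: y_def scaleR_eq_scaleC unitary_scaleC[OF pi_unitary] cinner_scaleC_right)
  qed simp
  then have "ip \<L> (coef (orb y) f) (coef (orb v) f) = cinner f f - cinner (B f) f"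
    using B_eq[OF dom, of f f] by (simp add: ip_cmult_left algebra_simps)
  then show "Re (ip \<L> (coef (orb y) f) (coef (orb v) f)) = (norm f)\<^sup>2 - Re (cinner (B f) f)"
    by (simp add: cinner_self)
  have "complex_of_real ((norm y)\<^sup>2 + s * nsq \<L> (coef (orb v) y)) = s * cinner v y"
    using eq[of y] by (simp add: cinner_self ip_self)
  then have "Re (complex_of_real ((norm y)\<^sup>2 + s * nsq \<L> (coef (orb v) y))) = Re (s * cinner v y)"
    by (rule arg_cong)
  then have e: "(norm y)\<^sup>2 + s * nsq \<L> (coef (orb v) y) = s * Re (cinner y v)"
    by (simp add: Re_cinner_commute[of v y])
  \<comment> \<open>t is the real part of the coefficient of \<open>C_v y\<close> at the identity,
    hence t^2 is at most the squared norm of \<open>C_v y\<close>, which is at most t.\<close>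
  define t where "t = Re (cinner y v)"
  have "s * nsq \<L> (coef (orb v) y) \<le> s * t" using e zero_le_power2[of "norm y"] unfolding t_def by linarith
  then have nt: "nsq \<L> (coef (orb v) y) \<le> t" using s by simp
  have "(cmod (coef (orb v) y 0))\<^sup>2 \<le> nsq \<L> (coef (orb v) y)"
    by (rule nsq_pointwise_le[OF coef_sq[OF v] zero_in])
  moreover have "t\<^sup>2 \<le> (cmod (coef (orb v) y 0))\<^sup>2"
    using power_mono[OF abs_Re_le_cmod[of "cinner y v"] abs_ge_zero, of 2] by (simp add: t_def)
  ultimately have tt: "t * t \<le> 1 * t" using nt by (simp add: power2_eq_square)
  have "t \<ge> 0" using nt nsq_nonneg[of \<L> "coef (orb v) y"] by linarith
  then have t1: "t \<le> 1" using tt by (cases "t = 0") (auto simp: mult_le_cancel_right)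
  then show "Re (cinner y v) \<le> 1" by (simp add: t_def)
  show "nsq \<L> (coef (orb v) y) \<le> 1" using nt t1 by linarith
  have "(norm y)\<^sup>2 \<le> s * t" using e s nsq_nonneg[of \<L> "coef (orb v) y"] unfolding t_def by (smt (verit) mult_nonneg_nonneg)
  also have "\<dots> \<le> s" using t1 s by simp
  finally show "(norm y)\<^sup>2 \<le> s" .
qed

text \<open>By injectivity the range of S = \<open>T v v\<close> is dense, and on S h the resolvent
  at s has norm at most 2 / s times that of h, because s S B = 1 - B. Contractivity extends the
  convergence to all f.\<close>

lemma resolvent_tendsto_0:
  assumes v: "v \<in> bessel_vectors"
    and inj: "\<And>f. (\<And>\<gamma>. \<gamma> \<in> \<Gamma> \<Longrightarrow> cinner f (\<pi> \<gamma> v) = 0) \<Longrightarrow> f = 0"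
  shows "(\<lambda>n. RB v (real (Suc n)) f) \<longlonglongrightarrow> 0"
proof (rule LIMSEQ_I)
  fix e :: real assume e: "e > 0"
  have "closure (range (T v v)) = UNIV"
  proof (rule dense_if_orthogonal_trivial)
    show "csubspace (range (T v v))"
    proof -
      have add: "T v v f + T v v g = T v v (f + g)" for f g
        by (rule cinner_ext) (simp add: T_adjoint v cinner_add_left)
      have "0 = T v v 0" using T_scaleC[OF v v, of 0 0] by simp
      then show ?thesis
        using add T_scaleC[OF v v, symmetric] by (auto simp: complex_vector.subspace_def)
    qed
    fix g assume "\<And>w. w \<in> range (T v v) \<Longrightarrow> cinner g w = 0"
    then have "cinner (T v v g) g = 0" by (simp add: T_adjoint v)
    then have "nsq \<L> (coef (orb v) g) = 0" using T_self[OF v, of g] by simp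
    then show "g = 0"
      using square_integrable_count_space_eq_0[OF coef_sq[OF v]] by (intro inj) blast
  qed
  then obtain h where h: "dist (T v v h) f < e / 2"
    using closure_approachable[of f "range (T v v)"] e by (auto dest!: spec[of _ "e/2"])
  obtain N :: nat where N: "4 * norm h / e < N" using reals_Archimedean2 by blast
  have "norm (RB v (real (Suc n)) f - 0) < e" if n: "n \<ge> N" for n
  proof -
    let ?s = "real (Suc n)"
    interpret frame_resolvent \<L> "orb v" ?s by (rule frame_resolvent_orb) simp
    have dom: "m \<in> frame_domain \<L> (orb v)" for m by (simp add: frame_domain_def coef_sq v)
    define m where "m = B (T v v h)"
    have "cinner m m = cinner (T v v h) (B m)" unfolding m_def by (rule B_selfadjoint)
    also have "\<dots> = cnj (ip \<L> (coef (orb v) (B m)) (coef (orb v) h))"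
      unfolding T_cinner[OF v v] by (rule ip_cnj)
    finally have "cmod (cinner m m) = cmod (ip \<L> (coef (orb v) (B m)) (coef (orb v) h))" by simp
    then have "?s * (norm m)\<^sup>2 = cmod (?s * ip \<L> (coef (orb v) (B m)) (coef (orb v) h))"
      by (simp only: cinner_self norm_mult norm_of_real abs_of_nonneg[OF of_nat_0_le_iff] abs_power2)
    also have "?s * ip \<L> (coef (orb v) (B m)) (coef (orb v) h) = cinner m h - cinner (B m) h"
      using B_eq[OF dom, of m h] by (simp add: algebra_simps)
    also have "cmod \<dots> \<le> norm m * norm h + norm m * norm h"
    proof -
      have "cmod (cinner (B m) h) \<le> norm m * norm h"
        by (rule order_trans[OF Cauchy_Schwarz_cinner mult_right_mono[OF norm_B_le norm_ge_zero]])
      then show ?thesis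
        using norm_triangle_ineq4[of "cinner m h" "cinner (B m) h"] Cauchy_Schwarz_cinner[of m h] by linarith
    qed
    finally have "norm m * (?s * norm m) \<le> norm m * (2 * norm h)" by (simp add: power2_eq_square algebra_simps)
    then have "?s * norm m \<le> 2 * norm h" by (cases "m = 0") (auto simp: mult_le_cancel_left)
    moreover have "4 * norm h < ?s * e"
    proof -
      have "4 * norm h < real N * e" using N e by (simp add: divide_less_eq)
      also have "\<dots> \<le> ?s * e" using n e by (intro mult_right_mono) auto
      finally show ?thesis .
    qed
    ultimately have "?s * norm m < ?s * (e / 2)" by linarith
    then have "norm m < e / 2" by (rule mult_left_less_imp_less) simp
    moreover have "norm (B (f - T v v h)) < e / 2"
      using norm_B_le[of "f - T v v h"] h by (simp add: dist_norm norm_minus_commute)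
    moreover have "B f = m + B (f - T v v h)" unfolding m_def using B_add[of "T v v h" "f - T v v h"] by simp
    ultimately show ?thesis using norm_triangle_ineq[of m "B (f - T v v h)"] by simp
  qed
  then show "\<exists>N. \<forall>n\<ge>N. norm (RB v (real (Suc n)) f - 0) < e" by blast
qed

text \<open>The traces of s S (1 + s S)^-1, with S = \<open>T v v\<close>, are c \<langle>y,
  v\<rangle> up to real parts, so they never exceed c. By dominated convergence they tend to
  \<open>vol\<close>, as the resolvents tend strongly to 0.\<close>

lemma analysis_injective_imp_vol_le:
  assumes v: "v \<in> bessel_vectors"
    and inj: "\<And>f. (\<And>\<gamma>. \<gamma> \<in> \<Gamma> \<Longrightarrow> cinner f (\<pi> \<gamma> v) = 0) \<Longrightarrow> f = 0"
  shows "vol \<le> form_const"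
proof -
  obtain h :: 'h where h: "norm h = 1" using unit_vector by blast
  define y where "y n = real (Suc n) *\<^sub>R RB v (real (Suc n)) v" for n
  have pos: "real (Suc n) > 0" for n by simp
  note rv = resolvent_vector[OF v pos, folded y_def]
  let ?B = "\<lambda>n. RB v (real (Suc n))"
  let ?F = "\<lambda>n \<omega>. Re (ip \<L> (coef (orb (y n)) (\<pi> (- \<omega>) h)) (coef (orb v) (\<pi> (- \<omega>) h)))"
  have F: "?F n \<omega> = 1 - Re (cinner (?B n (\<pi> (- \<omega>) h)) (\<pi> (- \<omega>) h))" for n \<omega>
    using rv(3)[of "\<pi> (- \<omega>) h" n] h by simp
  have "(\<lambda>n. \<integral>\<omega>. ?F n \<omega> \<partial>\<nu>) \<longlonglongrightarrow> (\<integral>\<omega>. 1 \<partial>\<nu>)"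
  proof (rule integral_dominated_convergence[of _ _ _ "\<lambda>_. 2"])
    show "AE \<omega> in \<nu>. (\<lambda>n. ?F n \<omega>) \<longlonglongrightarrow> 1"
    proof (rule AE_I2)
      fix \<omega>
      have "(\<lambda>n. 1 - Re (cinner (?B n (\<pi> (- \<omega>) h)) (\<pi> (- \<omega>) h))) \<longlonglongrightarrow> 1 - Re (cinner 0 (\<pi> (- \<omega>) h))"
        by (intro tendsto_intros tendsto_cinner resolvent_tendsto_0[OF v inj])
      then show "(\<lambda>n. ?F n \<omega>) \<longlonglongrightarrow> 1" unfolding F by simp
    qed
    show "AE \<omega> in \<nu>. norm (?F n \<omega>) \<le> 2" for n
    proof (rule AE_I2)
      fix \<omega>
      let ?k = "\<pi> (- \<omega>) h"
      have "cmod (cinner (?B n ?k) ?k) \<le> norm ?k * norm ?k"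
        by (rule order_trans[OF Cauchy_Schwarz_cinner
              mult_right_mono[OF frame_resolvent.norm_B_le[OF frame_resolvent_orb[OF pos]] norm_ge_zero]])
      then have "\<bar>Re (cinner (?B n ?k) ?k)\<bar> \<le> 1"
        using h abs_Re_le_cmod[of "cinner (?B n ?k) ?k"] by simp
      then show "norm (?F n \<omega>) \<le> 2" unfolding F by simp
    qed
    show "?F n \<in> borel_measurable \<nu>" for n
      by (rule borel_measurable_integrable[OF trace_ip(1)[OF rv(1) v]])
  qed (auto simp: integrable_nu_const)
  then have "(\<lambda>n. form_const * Re (cinner (y n) v)) \<longlonglongrightarrow> vol"
    unfolding trace_ip(2)[OF rv(1) v] by (simp add: h integral_nu_const)
  then show ?thesis
  proof (rule LIMSEQ_le_const2)
    show "\<exists>N. \<forall>n\<ge>N. form_const * Re (cinner (y n) v) \<le> form_const"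
      using rv(6) form_const_pos by (auto intro!: exI[of _ 0] mult_left_le)
  qed
qed

text \<open>Here \<open>\<epsilon> n\<close> is the resolvent of \<open>C_v C_v^*\<close> at s = n +
  1 applied to the unit vector at the identity of \<Gamma>. A weak limit is annihilated by synthesis
  and so vanishes, whence \<langle>y, v\<rangle> tends to 1 along a subsequence, while c times its
  real part is a trace bounded by \<open>vol\<close>.\<close>

lemma synthesis_injective_imp_le_vol:
  assumes v: "v \<in> bessel_vectors"
    and inj: "\<And>c \<gamma>. square_integrable \<L> c \<Longrightarrow> (\<And>h. ip \<L> c (coef (orb v) h) = 0) \<Longrightarrow> \<gamma> \<in> \<Gamma> \<Longrightarrow> c \<gamma> = 0"
  shows "form_const \<le> vol"
proof -
  define y where "y n = real (Suc n) *\<^sub>R RB v (real (Suc n)) v" for n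
  have pos: "real (Suc n) > 0" for n by simp
  note rv = resolvent_vector[OF v pos, folded y_def]
  have le: "form_const * Re (cinner (y n) v) \<le> vol" for n
  proof (rule trace_ip_le[OF rv(1) v])
    show "Re (ip \<L> (coef (orb (y n)) f) (coef (orb v) f)) \<le> (norm f)\<^sup>2" for f
      unfolding rv(3) using frame_resolvent.B_nonneg[OF frame_resolvent_orb[OF pos]] by simp
  qed
  define \<epsilon> where "\<epsilon> n \<gamma> = 1 * indicator {0} \<gamma> - coef (orb v) (y n) \<gamma>" for n \<gamma>
  have one: "square_integrable \<L> (\<lambda>\<gamma>. 1 * indicator {0} \<gamma>)" "nsq \<L> (\<lambda>\<gamma>. 1 * indicator {0} \<gamma>) = 1"
    using square_integrable_finite_support[of "{0}" \<Gamma> "\<lambda>_. 1"] zero_in by auto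
  have \<epsilon>_sq: "square_integrable \<L> (\<epsilon> n)" for n
    unfolding \<epsilon>_def by (rule square_integrable_diff[OF one(1) coef_sq[OF v]])
  have \<epsilon>_bd: "nsq \<L> (\<epsilon> n) \<le> 4" for n
    using nsq_parallelogram[OF one(1) coef_sq[OF v], of "y n"] one(2) rv(5)[of n]
      nsq_nonneg[of \<L> "\<lambda>\<gamma>. 1 * indicator {0} \<gamma> + coef (orb v) (y n) \<gamma>"] unfolding \<epsilon>_def by linarith
  \<comment> \<open>Synthesis maps \<open>\<epsilon> n\<close> to y divided by n + 1, which tends to
    0 because the norm of y is at most the square root of n + 1.\<close>
  have ip_\<epsilon>: "ip \<L> (\<epsilon> n) (coef (orb v) m) = cinner (y n) m / real (Suc n)" for n m
  proof -
    have "ip \<L> (\<lambda>\<gamma>. 1 * indicator {0} \<gamma>) (coef (orb v) m)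
        = (\<integral>\<gamma>. cnj (cinner m v) * complex_of_real (indicator {0} \<gamma>) \<partial>\<L>)"
      unfolding ip_def by (intro Bochner_Integration.integral_cong) (auto simp: indicator_def)
    also have "\<dots> = cinner v m" using zero_in by (simp add: measure_count_space flip: cinner_commute)
    finally have "ip \<L> (\<epsilon> n) (coef (orb v) m) = cinner v m - ip \<L> (coef (orb v) (y n)) (coef (orb v) m)"
      unfolding \<epsilon>_def by (subst ip_diff_left[OF one(1) coef_sq[OF v] coef_sq[OF v]]) simp
    moreover have "cinner (y n) m = complex_of_real (real (Suc n)) *
        (cinner v m - ip \<L> (coef (orb v) (y n)) (coef (orb v) m))"
      using rv(2)[of n m] by (simp add: algebra_simps del: of_nat_Suc)
    moreover have "complex_of_real (real (Suc n)) \<noteq> 0" by (simp del: of_nat_Suc)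
    ultimately show ?thesis by (simp del: of_nat_Suc)
  qed
  have "cmod (\<epsilon> n \<gamma>) \<le> 2" if "\<gamma> \<in> \<Gamma>" for n \<gamma>
  proof -
    have "(cmod (\<epsilon> n \<gamma>))\<^sup>2 \<le> 2\<^sup>2" using nsq_pointwise_le[OF \<epsilon>_sq that, of n] \<epsilon>_bd[of n] by simp
    then show ?thesis by (rule power2_le_imp_le) simp
  qed
  then obtain r where r: "strict_mono r" "\<And>\<gamma>. \<gamma> \<in> \<Gamma> \<Longrightarrow> convergent (\<lambda>n. \<epsilon> (r n) \<gamma>)"
    using bounded_family_subsequence[OF countable, of \<epsilon>] by metis
  define c where "c \<gamma> = lim (\<lambda>n. \<epsilon> (r n) \<gamma>)" for \<gamma>
  have lim: "(\<lambda>n. \<epsilon> (r n) \<gamma>) \<longlonglongrightarrow> c \<gamma>" if "\<gamma> \<in> \<Gamma>" for \<gamma>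
    using r(2)[OF that] by (simp add: c_def convergent_LIMSEQ_iff)
  have c_sq: "square_integrable \<L> c"
    using square_integrable_limit_bounded[of \<L> "\<lambda>n. \<epsilon> (r n)" c 4] \<epsilon>_sq \<epsilon>_bd lim by auto
  have "ip \<L> c (coef (orb v) m) = 0" for m
  proof (rule LIMSEQ_unique)
    show "(\<lambda>n. ip \<L> (\<epsilon> (r n)) (coef (orb v) m)) \<longlonglongrightarrow> ip \<L> c (coef (orb v) m)"
      by (rule ip_tendsto[OF countable \<epsilon>_sq \<epsilon>_bd lim coef_sq[OF v]])
    have "(\<lambda>n. ip \<L> (\<epsilon> n) (coef (orb v) m)) \<longlonglongrightarrow> 0"
    proof (rule Lim_null_comparison)
      show "\<forall>\<^sub>F n in sequentially. norm (ip \<L> (\<epsilon> n) (coef (orb v) m)) \<le> norm m * inverse (sqrt (real (Suc n)))"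
      proof (intro always_eventually allI)
        fix n
        have "norm (y n) \<le> sqrt (real (Suc n))" using rv(4)[of n] by (rule real_le_rsqrt)
        then have "cmod (cinner (y n) m) \<le> sqrt (real (Suc n)) * norm m"
          using Cauchy_Schwarz_cinner[of "y n" m] mult_right_mono[OF _ norm_ge_zero] order_trans by blast
        then have "cmod (cinner (y n) m) / real (Suc n) \<le> sqrt (real (Suc n)) * norm m / real (Suc n)"
          by (intro divide_right_mono) auto
        also have "\<dots> = norm m * inverse (sqrt (real (Suc n)))"
          using real_sqrt_mult_self[of "real (Suc n)"] by (simp add: field_simps del: of_nat_Suc real_sqrt_mult_self)
        finally show "norm (ip \<L> (\<epsilon> n) (coef (orb v) m)) \<le> norm m * inverse (sqrt (real (Suc n)))"
          unfolding ip_\<epsilon> norm_divide norm_of_real by simp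
      qed
      have "(\<lambda>n. sqrt (inverse (real (Suc n)))) \<longlonglongrightarrow> sqrt 0"
        by (intro tendsto_real_sqrt LIMSEQ_inverse_real_of_nat)
      then have "(\<lambda>n. inverse (sqrt (real (Suc n)))) \<longlonglongrightarrow> 0" by (simp add: real_sqrt_inverse)
      then show "(\<lambda>n. norm m * inverse (sqrt (real (Suc n)))) \<longlonglongrightarrow> 0" by (rule tendsto_mult_right_zero)
    qed
    from LIMSEQ_subseq_LIMSEQ[OF this r(1)]
    show "(\<lambda>n. ip \<L> (\<epsilon> (r n)) (coef (orb v) m)) \<longlonglongrightarrow> 0" by (simp add: o_def)
  qed
  then have "c 0 = 0" using inj[OF c_sq _ zero_in] by blast
  then have "(\<lambda>n. 1 - \<epsilon> (r n) 0) \<longlonglongrightarrow> 1 - 0" using lim[OF zero_in] by (intro tendsto_intros) simp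
  then have "(\<lambda>n. Re (cinner (y (r n)) v)) \<longlonglongrightarrow> Re 1" by (intro tendsto_Re) (simp add: \<epsilon>_def)
  then have "(\<lambda>n. form_const * Re (cinner (y (r n)) v)) \<longlonglongrightarrow> form_const * 1"
    by (intro tendsto_mult_left) simp
  then show ?thesis using le by (intro LIMSEQ_le_const2) auto
qed

end

section \<open>Unordered sums, adjoints and orthogonal projections\<close>

lemma integrable_count_space_has_sum:
  fixes f :: "'a \<Rightarrow> 'b::{banach, second_countable_topology}"
  assumes "integrable (count_space A) f"
  shows "(f has_sum (\<integral>x. f x \<partial>count_space A)) A"
proof -
  have abs: "Infinite_Set_Sum.abs_summable_on f A"
    using assms by (simp add: Infinite_Set_Sum.abs_summable_on_def)
  then have "f summable_on A"
    using Infinite_Sum.abs_summable_summable abs_summable_equivalent by blast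
  then have "(f has_sum infsum f A) A" by (rule has_sum_infsum)
  then show ?thesis by (simp add: infsetsum_infsum[OF abs, symmetric] infsetsum_def)
qed

lemma square_integrable_has_sum:
  assumes "square_integrable (count_space A) F"
  shows "((\<lambda>x. (cmod (F x))\<^sup>2) has_sum nsq (count_space A) F) A"
  using integrable_count_space_has_sum[of A "\<lambda>x. (cmod (F x))\<^sup>2"] assms
  by (simp add: square_integrable_def nsq_def)

lemma square_integrable_if_finite_sums_bounded:
  assumes A: "countable A" and le: "\<And>E. finite E \<Longrightarrow> E \<subseteq> A \<Longrightarrow> (\<Sum>x\<in>E. (cmod (F x))\<^sup>2) \<le> K"
  shows "square_integrable (count_space A) F \<and> nsq (count_space A) F \<le> K"
proof (rule square_integrable_limit_bounded[where F = "\<lambda>n x. F x * indicator (from_nat_into A ` {..<n} \<inter> A) x"])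
  fix n
  note fin = square_integrable_finite_support[of "from_nat_into A ` {..<n} \<inter> A" A F]
  show "square_integrable (count_space A) (\<lambda>x. F x * indicator (from_nat_into A ` {..<n} \<inter> A) x)"
    by (rule fin) auto
  show "nsq (count_space A) (\<lambda>x. F x * indicator (from_nat_into A ` {..<n} \<inter> A) x) \<le> K"
    by (subst fin) (auto intro: le)
next
  fix x assume "x \<in> space (count_space A)"
  then have x: "x \<in> A" by simp
  show "(\<lambda>n. F x * indicator (from_nat_into A ` {..<n} \<inter> A) x) \<longlonglongrightarrow> F x"
  proof (rule tendsto_eventually, rule eventually_sequentiallyI)
    fix n assume "n \<ge> Suc (to_nat_on A x)"
    then have "x \<in> from_nat_into A ` {..<n} \<inter> A"
      using x from_nat_into_to_nat_on[OF A x] by (auto simp: image_iff intro!: bexI[of _ "to_nat_on A x"])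
    then show "F x * indicator (from_nat_into A ` {..<n} \<inter> A) x = F x" by simp
  qed
qed

lemma orthogonal_cspan:
  assumes "\<And>w. w \<in> W \<Longrightarrow> cinner f w = 0" "w \<in> cspan W"
  shows "cinner f (w :: 'h::complex_inner) = 0"
proof -
  have "csubspace {w. cinner f w = 0}"
    by (auto simp: complex_vector.subspace_def cinner_simps)
  then have "cspan W \<subseteq> {w. cinner f w = 0}"
    using assms(1) by (intro complex_vector.span_minimal) auto
  then show ?thesis using assms(2) by blast
qed

lemma adjoint_exists:
  fixes A :: "'h::complex_hilbert_space \<Rightarrow> 'h"
  assumes "bounded_clinear A"
  shows "\<exists>B. bounded_clinear B \<and> (\<forall>f g. cinner (B f) g = cinner f (A g))"
proof -
  interpret bounded_linear A using assms by (simp add: bounded_clinear_def)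
  have sc: "A (c *\<^sub>C f) = c *\<^sub>C A f" for c f using assms by (simp add: bounded_clinear_def)
  obtain K where K: "\<And>f. norm (A f) \<le> norm f * K" "K > 0" using pos_bounded by blast
  have "\<exists>k. \<forall>g. cinner k g = cinner f (A g)" for f
  proof (rule riesz_representation_bound)
    show "cmod (cinner f (A g)) \<le> (norm f * K) * norm g" for g
      using Cauchy_Schwarz_cinner[of f "A g"] mult_left_mono[OF K(1)[of g] norm_ge_zero[of f]]
      by (simp add: mult_ac)
  qed (simp_all add: add sc cinner_simps)
  then obtain B where B: "\<And>f g. cinner (B f) g = cinner f (A g)" by metis
  have B_add: "B (f + g) = B f + B g" and B_sc: "B (c *\<^sub>C f) = c *\<^sub>C B f" for f g c
    by (rule cinner_ext, simp add: B cinner_simps)+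
  have "norm (B f) \<le> norm f * K" for f
  proof -
    have "norm (B f) * norm (B f) = cmod (cinner (B f) (B f))" by (simp add: cinner_self power2_eq_square norm_mult)
    also have "\<dots> \<le> norm f * (norm (B f) * K)"
      unfolding B by (rule order_trans[OF Cauchy_Schwarz_cinner mult_left_mono[OF K(1) norm_ge_zero]])
    finally have "norm (B f) * norm (B f) \<le> (norm f * K) * norm (B f)" by (simp add: mult_ac)
    then show ?thesis using K(2) by (cases "B f = 0") (auto simp: mult_le_cancel_right)
  qed
  then have "bounded_linear B"
    by (intro bounded_linear_intro[of _ K]) (auto simp: B_add B_sc scaleR_eq_scaleC)
  then show ?thesis using B B_sc by (auto simp: bounded_clinear_def)
qed

text \<open>A projection commutes with A when its range reduces A, so invariance is asked for A and
  for its adjoint B.\<close>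

lemma projection_commutes:
  fixes W :: "'h::complex_hilbert_space set"
  assumes W: "csubspace W" "closed W"
  shows "\<exists>Q. bounded_clinear Q \<and> (\<forall>f. Q f \<in> W) \<and> (\<forall>f\<in>W. Q f = f) \<and>
    (\<forall>A B. (\<forall>f g. cinner (B f) g = cinner f (A g)) \<and> A ` W \<subseteq> W \<and> B ` W \<subseteq> W \<longrightarrow> (\<forall>f. Q (A f) = A (Q f)))"
proof -
  obtain Q where Q: "\<And>f. Q f \<in> W" "\<And>f m. m \<in> W \<Longrightarrow> cinner (Q f) m = cinner f m"
    using orthogonal_projection_exists[OF W] by metis
  have unique: "k = Q f" if "k \<in> W" "\<And>m. m \<in> W \<Longrightarrow> cinner k m = cinner f m" for k f
  proof -
    have "k - Q f \<in> W" using that Q W csubspace_diff by blast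
    then have "cinner (k - Q f) (k - Q f) = 0"
      using that(2) Q(2) by (simp add: cinner_diff_left[of k])
    then show ?thesis by simp
  qed
  have add: "Q (f + g) = Q f + Q g" and sc: "Q (c *\<^sub>C f) = c *\<^sub>C Q f" for f g c
    by (rule unique[symmetric]; use W Q in \<open>auto simp: cinner_simps intro: csubspace_add csubspace_scale\<close>)+
  have "norm (Q f) \<le> norm f * 1" for f
  proof -
    have "norm (Q f) * norm (Q f) = cmod (cinner (Q f) (Q f))" by (simp add: cinner_self power2_eq_square norm_mult)
    also have "\<dots> \<le> norm f * norm (Q f)" unfolding Q(2)[OF Q(1)] by (rule Cauchy_Schwarz_cinner)
    finally show ?thesis by (cases "Q f = 0") (auto simp: mult_le_cancel_right)
  qed
  then have "bounded_linear Q" by (intro bounded_linear_intro[of _ 1]) (auto simp: add sc scaleR_eq_scaleC)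
  then have Q_bounded: "bounded_clinear Q" by (simp add: bounded_clinear_def sc)
  have Q_id: "Q f = f" if "f \<in> W" for f using unique[OF that, of f] by simp
  have Q_comm: "Q (A f) = A (Q f)"
    if adj: "\<forall>f g. cinner (B f) g = cinner f (A g)" and inv: "A ` W \<subseteq> W" "B ` W \<subseteq> W" for A B f
  proof (rule unique[symmetric])
    show "A (Q f) \<in> W" using Q inv by blast
    have adj': "cinner (A f) g = cinner f (B g)" for f g
      using adj by (metis cinner_commute)
    fix m assume "m \<in> W"
    then show "cinner (A (Q f)) m = cinner (A f) m" using inv Q by (auto simp: adj')
  qed
  have "\<forall>A B. (\<forall>f g. cinner (B f) g = cinner f (A g)) \<and> A ` W \<subseteq> W \<and> B ` W \<subseteq> W \<longrightarrow>
      (\<forall>f. Q (A f) = A (Q f))"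
    by (intro allI impI, elim conjE) (rule Q_comm)
  then show ?thesis using Q_bounded Q(1) Q_id by (intro exI[of _ Q]) simp
qed

section \<open>Cyclic vectors and Riesz sequences\<close>

context lattice_rep
begin

text \<open>The Bessel vector \<open>B g\<close> has the analysis map \<open>C_g B\<close>. If this
  kills f, then B f is orthogonal to the total orbit of g and vanishes, and B is injective.\<close>

lemma total_imp_vol_le:
  assumes "total_family \<Gamma> (orb g)" shows "vol \<le> form_const"
proof (rule analysis_injective_imp_vol_le)
  interpret frame_resolvent \<L> "orb g" 1 by (rule frame_resolvent_orb) simp
  show "B g \<in> bessel_vectors" by (rule bessel_vectorsI[OF RB_bessel]) simp
  fix f assume zero: "\<And>\<gamma>. \<gamma> \<in> \<Gamma> \<Longrightarrow> cinner f (\<pi> \<gamma> (B g)) = 0"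
  have "B f = 0"
  proof (rule orthogonal_dense_eq_0)
    show "closure (cspan (orb g ` \<Gamma>)) = UNIV" using assms by (simp add: total_family_def)
    have "cinner (B f) (\<pi> \<gamma> g) = 0" if "\<gamma> \<in> \<Gamma>" for \<gamma>
      using RB_coef[OF zero_less_one that, of f g g] zero[OF that] by simp
    then show "cinner (B f) w = 0" if "w \<in> cspan (orb g ` \<Gamma>)" for w
      using orthogonal_cspan[OF _ that] by blast
  qed
  then show "f = 0" by (rule B_inj[OF frame_domain_orb_dense])
qed

text \<open>The upper Riesz bound makes g a Bessel vector by duality, the lower one makes its
  synthesis map injective.\<close>

lemma riesz_imp_le_vol:
  assumes "riesz_sequence \<Gamma> (orb g)" shows "form_const \<le> vol"
proof -
  obtain A B where A: "A > 0" and B: "B > 0"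
    and R: "\<And>c. (\<lambda>\<gamma>. (cmod (c \<gamma>))\<^sup>2) summable_on \<Gamma> \<Longrightarrow>
        (\<lambda>\<gamma>. c \<gamma> *\<^sub>C \<pi> \<gamma> g) summable_on \<Gamma> \<and>
        A * (\<Sum>\<^sub>\<infinity>\<gamma>\<in>\<Gamma>. (cmod (c \<gamma>))\<^sup>2) \<le> (norm (\<Sum>\<^sub>\<infinity>\<gamma>\<in>\<Gamma>. c \<gamma> *\<^sub>C \<pi> \<gamma> g))\<^sup>2 \<and>
        (norm (\<Sum>\<^sub>\<infinity>\<gamma>\<in>\<Gamma>. c \<gamma> *\<^sub>C \<pi> \<gamma> g))\<^sup>2 \<le> B * (\<Sum>\<^sub>\<infinity>\<gamma>\<in>\<Gamma>. (cmod (c \<gamma>))\<^sup>2)"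
    using assms unfolding riesz_sequence_def by blast
  have "bessel \<L> (orb g) B"
    unfolding bessel_def
  proof (rule allI, rule square_integrable_if_finite_sums_bounded[OF countable])
    fix f E assume E: "finite E" "E \<subseteq> \<Gamma>"
    \<comment> \<open>The coefficients of f themselves, cut off outside \<open>E\<close>, are the
      test sequence: the resulting sum k has \<langle>f, k\<rangle> = S and squared norm at most B
      S.\<close>
    define c where "c \<gamma> = coef (orb g) f \<gamma> * indicator E \<gamma>" for \<gamma>
    define S where "S = (\<Sum>\<gamma>\<in>E. (cmod (coef (orb g) f \<gamma>))\<^sup>2)"
    have c: "square_integrable \<L> c" "nsq \<L> c = S"
      using square_integrable_finite_support[OF E, of "coef (orb g) f"] by (simp_all add: c_def[abs_def] S_def)
    have sum: "(\<Sum>\<^sub>\<infinity>\<gamma>\<in>\<Gamma>. c \<gamma> *\<^sub>C \<pi> \<gamma> g) = (\<Sum>\<gamma>\<in>E. c \<gamma> *\<^sub>C \<pi> \<gamma> g)"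
    proof -
      have "(\<Sum>\<^sub>\<infinity>\<gamma>\<in>\<Gamma>. c \<gamma> *\<^sub>C \<pi> \<gamma> g) = (\<Sum>\<^sub>\<infinity>\<gamma>\<in>E. c \<gamma> *\<^sub>C \<pi> \<gamma> g)"
        using E by (intro infsum_cong_neutral) (auto simp: c_def)
      then show ?thesis using E by simp
    qed
    let ?k = "\<Sum>\<gamma>\<in>E. c \<gamma> *\<^sub>C \<pi> \<gamma> g"
    have "(norm ?k)\<^sup>2 \<le> B * S"
    proof -
      note hs = square_integrable_has_sum[OF c(1), unfolded c(2)]
      show ?thesis using R[OF has_sum_imp_summable[OF hs]] unfolding sum infsumI[OF hs] by simp
    qed
    have "cinner f ?k = (\<Sum>\<gamma>\<in>E. cinner f (c \<gamma> *\<^sub>C \<pi> \<gamma> g))"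
      by (rule linear_sum) (rule bounded_linear.linear[OF bounded_bilinear.bounded_linear_right[OF bounded_bilinear_cinner]])
    also have "\<dots> = (\<Sum>\<gamma>\<in>E. complex_of_real ((cmod (coef (orb g) f \<gamma>))\<^sup>2))"
      unfolding complex_norm_square by (intro sum.cong) (auto simp: c_def cinner_scaleC_right mult.commute)
    finally have "cinner f ?k = complex_of_real S" by (simp add: S_def)
    moreover have S0: "S \<ge> 0" unfolding S_def by (intro sum_nonneg) auto
    ultimately have "S \<le> norm f * norm ?k" using Cauchy_Schwarz_cinner[of f ?k] by simp
    then have "S\<^sup>2 \<le> (norm f * norm ?k)\<^sup>2" using S0 by (intro power_mono) auto
    also have "\<dots> \<le> (norm f)\<^sup>2 * (B * S)"
      unfolding power_mult_distrib by (intro mult_left_mono \<open>(norm ?k)\<^sup>2 \<le> B * S\<close>) simp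
    finally have "S * S \<le> (B * (norm f)\<^sup>2) * S" by (simp add: power2_eq_square mult_ac)
    then show "S \<le> B * (norm f)\<^sup>2"
      using S0 B by (cases "S = 0") (auto simp: mult_le_cancel_right)
  qed
  then have g: "g \<in> bessel_vectors" by (rule bessel_vectorsI)
  show ?thesis
  proof (rule synthesis_injective_imp_le_vol[OF g])
    fix c \<gamma> assume c: "square_integrable \<L> c" and zero: "\<And>h. ip \<L> c (coef (orb g) h) = 0"
      and \<gamma>: "\<gamma> \<in> \<Gamma>"
    have c_sum: "((\<lambda>\<gamma>. (cmod (c \<gamma>))\<^sup>2) has_sum nsq \<L> c) \<Gamma>" by (rule square_integrable_has_sum[OF c])
    define k where "k = (\<Sum>\<^sub>\<infinity>\<gamma>\<in>\<Gamma>. c \<gamma> *\<^sub>C \<pi> \<gamma> g)"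
    have k: "((\<lambda>\<gamma>. c \<gamma> *\<^sub>C \<pi> \<gamma> g) has_sum k) \<Gamma>" and le: "A * nsq \<L> c \<le> (norm k)\<^sup>2"
      using R[of c] has_sum_imp_summable[OF c_sum] infsumI[OF c_sum] by (auto simp: k_def)
    have "cinner k h = 0" for h
    proof -
      have "((\<lambda>\<gamma>. cinner (c \<gamma> *\<^sub>C \<pi> \<gamma> g) h) has_sum cinner k h) \<Gamma>"
        using has_sum_bounded_linear[OF bounded_bilinear.bounded_linear_left[OF bounded_bilinear_cinner] k]
        by (simp add: o_def)
      moreover have "(\<lambda>\<gamma>. cinner (c \<gamma> *\<^sub>C \<pi> \<gamma> g) h) = (\<lambda>\<gamma>. c \<gamma> * cnj (coef (orb g) h \<gamma>))"
        by (simp add: cinner_scaleC_left flip: cinner_commute)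
      moreover have "((\<lambda>\<gamma>. c \<gamma> * cnj (coef (orb g) h \<gamma>)) has_sum ip \<L> c (coef (orb g) h)) \<Gamma>"
        unfolding ip_def
        by (rule integrable_count_space_has_sum[OF square_integrable_mult_cnj[OF c coef_sq[OF g]]])
      ultimately show ?thesis using zero has_sum_unique by metis
    qed
    then have "k = 0" using cinner_ext[of k 0] by simp
    then have "A * nsq \<L> c \<le> 0" using le by simp
    then have "nsq \<L> c = 0" using A nsq_nonneg[of \<L> c] by (simp add: mult_le_0_iff)
    then show "c \<gamma> = 0" using square_integrable_count_space_eq_0[OF c _ \<gamma>] by blast
  qed
qed

section \<open>The commutant and separating vectors\<close>

abbreviation "N \<equiv> commutant (\<pi> ` \<Gamma>)"

lemma N_bounded: "A \<in> N \<Longrightarrow> bounded_clinear A"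
  and N_pi: "A \<in> N \<Longrightarrow> \<gamma> \<in> \<Gamma> \<Longrightarrow> A (\<pi> \<gamma> f) = \<pi> \<gamma> (A f)"
  by (auto simp: commutant_def o_def fun_eq_iff)

lemma N_I: "bounded_clinear A \<Longrightarrow> (\<And>\<gamma> f. \<gamma> \<in> \<Gamma> \<Longrightarrow> A (\<pi> \<gamma> f) = \<pi> \<gamma> (A f)) \<Longrightarrow> A \<in> N"
  by (auto simp: commutant_def o_def fun_eq_iff)

lemma N_adjoint:
  assumes A: "A \<in> N" shows "\<exists>B\<in>N. \<forall>f g. cinner (B f) g = cinner f (A g)"
proof -
  obtain B where B: "bounded_clinear B" "\<And>f g. cinner (B f) g = cinner f (A g)"
    using adjoint_exists[OF N_bounded[OF A]] by blast
  have "B \<in> N"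
  proof (rule N_I[OF B(1)], rule cinner_ext)
    fix \<gamma> f g assume "\<gamma> \<in> \<Gamma>"
    then show "cinner (B (\<pi> \<gamma> f)) g = cinner (\<pi> \<gamma> (B f)) g"
      by (simp add: B(2) cinner_pi_left N_pi[OF A] uminus_in)
  qed
  then show ?thesis using B(2) by blast
qed

lemma N_comp: "A \<in> N \<Longrightarrow> A' \<in> N \<Longrightarrow> (\<lambda>f. A (A' f)) \<in> N"
  by (rule N_I) (auto simp: N_pi bounded_clinear_def dest!: N_bounded
      intro: bounded_linear_compose[unfolded o_def])

text \<open>The projection Q onto the closure of N v commutes with N, so 1 - Q lies in
  \<open>commutant N\<close> and kills v.\<close>

lemma separating_imp_dense:
  assumes sep: "\<And>P. P \<in> commutant N \<Longrightarrow> P v = 0 \<Longrightarrow> P = (\<lambda>_. 0)"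
  shows "closure {A v | A. A \<in> N} = UNIV"
proof -
  let ?O = "{A v | A. A \<in> N}"
  have id: "(\<lambda>f. f) \<in> N" by (rule N_I) (auto simp: bounded_clinear_def)
  have "csubspace ?O"
  proof -
    have 0: "(\<lambda>f. 0) \<in> N" using unitary_scaleC[OF pi_unitary, of _ 0 0]
      by (intro N_I) (auto simp: bounded_clinear_def)
    have add: "(\<lambda>f. A f + A' f) \<in> N" if "A \<in> N" "A' \<in> N" for A A'
      using that by (intro N_I)
        (auto simp: bounded_clinear_def N_pi unitary_add[OF pi_unitary] scaleC_add_right
          dest!: N_bounded intro: bounded_linear_add)
    have sc: "(\<lambda>f. A (c *\<^sub>C f)) \<in> N" if "A \<in> N" for A c
    proof (rule N_comp[OF that])
      show "(\<lambda>f. c *\<^sub>C f) \<in> N"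
        by (intro N_I) (auto intro: bounded_linear_scaleC simp: bounded_clinear_def unitary_scaleC[OF pi_unitary] scaleC_scaleC mult.commute)
    qed
    have scv: "A (c *\<^sub>C v) = c *\<^sub>C A v" if "A \<in> N" for A c
      using N_bounded[OF that] by (simp add: bounded_clinear_def)
    show ?thesis
      unfolding complex_vector.subspace_def
    proof (intro conjI ballI allI)
      show "0 \<in> ?O" using 0 by (intro CollectI exI[of _ "\<lambda>f. 0"]) simp
    next
      fix x y assume "x \<in> ?O" "y \<in> ?O"
      then obtain A A' where A: "A \<in> N" "A' \<in> N" "x = A v" "y = A' v" by blast
      then show "x + y \<in> ?O" using add[OF A(1,2)] by (intro CollectI exI[of _ "\<lambda>f. A f + A' f"]) simp
    next
      fix c x assume "x \<in> ?O"
      then obtain A where A: "A \<in> N" "x = A v" by blast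
      then show "c *\<^sub>C x \<in> ?O"
        using sc[OF A(1), of c] scv[OF A(1), of c] by (intro CollectI exI[of _ "\<lambda>f. A (c *\<^sub>C f)"]) simp
    qed
  qed
  then have W: "csubspace (closure ?O)" by (rule csubspace_closure)
  obtain Q where Q: "bounded_clinear Q" "\<forall>f. Q f \<in> closure ?O" "\<forall>f\<in>closure ?O. Q f = f"
    and comm: "\<forall>A B. (\<forall>f g. cinner (B f) g = cinner f (A g)) \<and> A ` closure ?O \<subseteq> closure ?O \<and>
      B ` closure ?O \<subseteq> closure ?O \<longrightarrow> (\<forall>f. Q (A f) = A (Q f))"
    using projection_commutes[OF W closed_closure] by (elim exE conjE) rule
  have inv: "A ` closure ?O \<subseteq> closure ?O" if A: "A \<in> N" for A
  proof (rule image_closure_subset)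
    have "bounded_linear A" using N_bounded[OF A] by (simp add: bounded_clinear_def)
    then show "continuous_on (closure ?O) A" by (simp add: linear_continuous_on)
    show "A ` ?O \<subseteq> closure ?O"
      using N_comp[OF A] closure_subset[of ?O] by fastforce
  qed simp
  have QA: "Q (A f) = A (Q f)" if A: "A \<in> N" for A f
  proof -
    obtain B where B: "B \<in> N" "\<forall>f g. cinner (B f) g = cinner f (A g)" using N_adjoint[OF A] by blast
    then show ?thesis using comm[rule_format, of B A] inv[OF A] inv[OF B(1)] by simp
  qed
  have "(\<lambda>f. f - Q f) \<in> commutant N"
    unfolding commutant_def[of N]
  proof (intro CollectI conjI ballI)
    show "bounded_clinear (\<lambda>f. f - Q f)"
      using Q(1) by (auto simp: bounded_clinear_def complex_vector.scale_right_diff_distrib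
          intro: bounded_linear_sub)
    show "(\<lambda>f. f - Q f) \<circ> A = A \<circ> (\<lambda>f. f - Q f)" if "A \<in> N" for A
    proof -
      have "bounded_linear A" using N_bounded[OF that] by (simp add: bounded_clinear_def)
      then show ?thesis by (auto simp: QA[OF that] linear_simps)
    qed
  qed
  moreover have "v \<in> closure ?O" using id closure_subset[of ?O] by blast
  ultimately have eq: "(\<lambda>f. f - Q f) = (\<lambda>_. 0)" using sep[of "\<lambda>f. f - Q f"] Q(3) by simp
  have "f \<in> closure ?O" for f using Q(2)[rule_format, of f] fun_cong[OF eq, of f] by simp
  then show ?thesis by blast
qed

text \<open>Conjugating c by a in the pairing with \<open>coef (orb w) w\<close> amounts to
  replacing w by \<pi>(a)w in both places. So the pairing is 0 for all a, and
  \<open>icc_average\<close> gives c(0) times a nonzero number for it.\<close>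

lemma icc_orthogonal_eq_0:
  assumes c: "square_integrable \<L> c"
    and zero: "\<And>k w. k \<in> bessel_vectors \<Longrightarrow> ip \<L> c (coef (orb w) k) = 0"
  shows "c 0 = 0"
proof -
  obtain w :: 'h where w: "w \<in> bessel_vectors" "w \<noteq> 0"
  proof -
    have "\<not> bessel_vectors \<subseteq> {0}"
    proof
      assume "bessel_vectors \<subseteq> {0}"
      then have "closure bessel_vectors \<subseteq> {0}" by (simp add: closure_minimal)
      then have "h = 0" for h :: 'h using bessel_vectors_dense by blast
      moreover obtain h :: 'h where "norm h = 1" using unit_vector by blast
      ultimately show False by (metis norm_zero zero_neq_one)
    qed
    then show ?thesis using that by blast
  qed
  have "0 = c 0 * cnj (coef (orb w) w 0)"
  proof (rule icc_average[OF c coef_sq[OF w(1)]])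
    fix a assume a: "a \<in> \<Gamma>"
    have "ip \<L> (\<lambda>\<gamma>. c (a + \<gamma> + - a)) (coef (orb w) w)
        = ip \<L> (\<lambda>\<gamma>. c (a + \<gamma> + - a)) (\<lambda>\<gamma>. coef (orb (\<pi> a w)) (\<pi> a w) (a + \<gamma> + - a))"
    proof -
      have "\<pi> (a + \<gamma> + - a) (\<pi> a w) = \<pi> a (\<pi> \<gamma> w)" for \<gamma> by (simp add: pi_add[symmetric] add.assoc)
      then show ?thesis by simp
    qed
    also have "\<dots> = ip \<L> c (coef (orb (\<pi> a w)) (\<pi> a w))"
      by (rule bij_square_integrable(3)[OF bij_conj[OF a]])
    also have "\<dots> = 0" by (rule zero[OF bessel_vectors_pi[OF w(1) a]])
    finally show "ip \<L> (\<lambda>\<gamma>. c (a + \<gamma> + - a)) (coef (orb w) w) = 0" .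
  qed
  then show ?thesis using w(2) by simp
qed

text \<open>The vector u = B v is Bessel and again separating, as B lies in N and is injective. If c
  is annihilated by the synthesis map of u, it is so by that of A u for A in N, then by density
  against all orbits, and the ICC property leaves only c = 0.\<close>

lemma separating_imp_le_vol:
  assumes "separating_vector (commutant N) v" shows "form_const \<le> vol"
proof -
  interpret frame_resolvent \<L> "orb v" 1 by (rule frame_resolvent_orb) simp
  have BN: "B \<in> N" by (rule N_I[OF bounded_clinear_B]) (rule RB_pi, simp_all)
  define u where "u = B v"
  have u: "u \<in> bessel_vectors" unfolding u_def by (rule bessel_vectorsI[OF RB_bessel]) simp
  have dense: "closure {A u | A. A \<in> N} = UNIV"
  proof (rule separating_imp_dense)
    fix P assume P: "P \<in> commutant N" "P u = 0"
    then have "P (B v) = B (P v)" using BN by (auto simp: commutant_def fun_eq_iff)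
    then have "B (P v) = 0" using P by (simp add: u_def)
    then have "P v = 0" by (rule B_inj[OF frame_domain_orb_dense])
    then show "P = (\<lambda>_. 0)" using assms P by (simp add: separating_vector_def)
  qed
  show ?thesis
  proof (rule synthesis_injective_imp_le_vol[OF u])
    fix c \<delta> assume c: "square_integrable \<L> c" and zero: "\<And>h. ip \<L> c (coef (orb u) h) = 0"
      and \<delta>: "\<delta> \<in> \<Gamma>"
    have all: "ip \<L> c (coef (orb w) k) = 0" if k: "k \<in> bessel_vectors" for k w
    proof -
      obtain b where b: "bessel \<L> (orb k) b" using k by (auto simp: bessel_vectors_def)
      define c' where "c' \<gamma> = cnj (c (- \<gamma>))" for \<gamma>
      have c': "square_integrable \<L> c'"
        using c bij_square_integrable(1)[OF bij_uminus, of c] by (simp add: c'_def[abs_def] square_integrable_cnj)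
      \<comment> \<open>For a Bessel vector k the pairing, read after \<gamma> \<mapsto> -\<gamma>
        along the orbit of k, is continuous in w; so it suffices to treat w in the dense set of the
        A u.\<close>
      have syn: "ip \<L> c (coef (orb w) k) = cnj (cinner (synthesis \<L> (orb k) c') w)" for w
      proof -
        have "ip \<L> c (coef (orb w) k) = ip \<L> (\<lambda>\<gamma>. c (- \<gamma>)) (\<lambda>\<gamma>. coef (orb w) k (- \<gamma>))"
          by (rule bij_square_integrable(3)[OF bij_uminus, symmetric])
        also have "\<dots> = (\<integral>\<gamma>. cnj (c' \<gamma> * cnj (coef (orb k) w \<gamma>)) \<partial>\<L>)"
          unfolding ip_def
        proof (rule Bochner_Integration.integral_cong)
          fix \<gamma>
          show "c (- \<gamma>) * cnj (coef (orb w) k (- \<gamma>)) = cnj (c' \<gamma> * cnj (coef (orb k) w \<gamma>))"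
            using fun_cong[OF coef_flip[of k w], of "- \<gamma>"] by (simp add: c'_def)
        qed simp
        also have "\<dots> = cnj (ip \<L> c' (coef (orb k) w))" unfolding ip_def by (rule Bochner_Integration.integral_cnj)
        finally show ?thesis by (simp add: cinner_synthesis[OF b c'])
      qed
      have "synthesis \<L> (orb k) c' = 0"
        using dense
      proof (rule orthogonal_dense_eq_0)
        fix w assume "w \<in> {A u | A. A \<in> N}"
        then obtain A where A: "A \<in> N" "w = A u" by blast
        obtain A' where A': "A' \<in> N" "\<And>f g. cinner (A' f) g = cinner f (A g)" using N_adjoint[OF A(1)] by blast
        have "ip \<L> c (coef (orb w) k) = ip \<L> c (coef (orb u) (A' k))"
          by (rule ip_cong) (auto simp: A' A N_pi[OF A(1), symmetric])
        then show "cinner (synthesis \<L> (orb k) c') w = 0" using zero syn[of w] by simp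
      qed
      then show ?thesis by (simp add: syn)
    qed
    \<comment> \<open>A right translation moves \<delta> to the identity and replaces w by
      \<pi>(-\<delta>)w.\<close>
    have "(\<lambda>\<gamma>. c (\<gamma> + \<delta>)) 0 = 0"
    proof (rule icc_orthogonal_eq_0)
      show "square_integrable \<L> (\<lambda>\<gamma>. c (\<gamma> + \<delta>))"
        using c bij_square_integrable(1)[OF bij_right[OF \<delta>]] by blast
      fix k w assume k: "k \<in> bessel_vectors"
      have "ip \<L> (\<lambda>\<gamma>. c (\<gamma> + \<delta>)) (coef (orb w) k)
          = ip \<L> (\<lambda>\<gamma>. c (\<gamma> + \<delta>)) (\<lambda>\<gamma>. coef (orb (\<pi> (- \<delta>) w)) k (\<gamma> + \<delta>))"
        by (simp add: pi_add)
      also have "\<dots> = ip \<L> c (coef (orb (\<pi> (- \<delta>) w)) k)"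
        by (rule bij_square_integrable(3)[OF bij_right[OF \<delta>]])
      finally show "ip \<L> (\<lambda>\<gamma>. c (\<gamma> + \<delta>)) (coef (orb w) k) = 0" using all[OF k] by simp
    qed
    then show "c \<delta> = 0" by simp
  qed
qed

section \<open>The trichotomy\<close>

lemma parseval_frame_orbit:
  assumes "bessel \<L> (orb x) 1" "\<And>f. nsq \<L> (coef (orb x) f) = (norm f)\<^sup>2"
  shows "parseval_frame \<Gamma> (orb x)"
  using square_integrable_has_sum[OF coef_sq[OF bessel_vectorsI[OF assms(1)]]]
  by (simp add: parseval_frame_def assms(2))

lemma total_family_orbit:
  assumes "bessel \<L> (orb x) 1" "\<And>f. nsq \<L> (coef (orb x) f) = (norm f)\<^sup>2"
  shows "total_family \<Gamma> (orb x)"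
  unfolding total_family_def
proof (rule dense_if_orthogonal_trivial)
  show "csubspace (cspan (orb x ` \<Gamma>))" by (rule complex_vector.subspace_span)
  fix f assume "\<And>w. w \<in> cspan (orb x ` \<Gamma>) \<Longrightarrow> cinner f w = 0"
  then have "cinner f (\<pi> \<gamma> x) = 0" if "\<gamma> \<in> \<Gamma>" for \<gamma>
    using that complex_vector.span_base by blast
  then have "nsq \<L> (coef (orb x) f) = nsq \<L> (\<lambda>_. 0)" by (intro nsq_cong) simp
  then show "f = 0" by (simp add: assms(2)) (simp add: nsq_def)
qed

theorem density_theorem:
  defines "D \<equiv> vol * formal_dimension \<mu> \<pi>"
  shows "D < 1 \<Longrightarrow> (\<exists>g. parseval_frame \<Gamma> (orb g)) \<and>
      \<not> (\<exists>g. separating_vector (commutant N) g) \<and> \<not> (\<exists>g. riesz_sequence \<Gamma> (orb g))"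
    and "D = 1 \<Longrightarrow> \<exists>g. orthonormal_basis \<Gamma> (orb g)"
    and "D > 1 \<Longrightarrow> (\<exists>g. orthonormal_system \<Gamma> (orb g)) \<and> \<not> (\<exists>g. total_family \<Gamma> (orb g))"
proof -
  have D: "D = vol / form_const" by (simp add: D_def formal_dimension_eq)
  show "(\<exists>g. parseval_frame \<Gamma> (orb g)) \<and>
      \<not> (\<exists>g. separating_vector (commutant N) g) \<and> \<not> (\<exists>g. riesz_sequence \<Gamma> (orb g))" if "D < 1"
  proof -
    have lt: "vol < form_const" using that form_const_pos by (simp add: D divide_less_eq)
    then obtain x where x: "bessel \<L> (orb x) 1" "\<And>f. nsq \<L> (coef (orb x) f) = (norm f)\<^sup>2"
      using parseval_exists by auto
    show ?thesis
      using parseval_frame_orbit[OF x] lt separating_imp_le_vol riesz_imp_le_vol by fastforce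
  qed
  show "\<exists>g. orthonormal_basis \<Gamma> (orb g)" if "D = 1"
  proof -
    have eq: "vol = form_const" using that form_const_pos by (simp add: D)
    then obtain x where x: "bessel \<L> (orb x) 1" "\<And>f. nsq \<L> (coef (orb x) f) = (norm f)\<^sup>2"
      using parseval_exists by auto
    \<comment> \<open>Equality of vol and c turns the Parseval vector into a unit vector, so its
      orbit is also orthonormal.\<close>
    have "(norm x)\<^sup>2 = 1" using parseval_trace[OF x] eq form_const_pos by simp
    then have "norm x = 1" by (metis norm_ge_zero one_power2 power2_eq_imp_eq zero_le_one)
    then have "orthonormal_system \<Gamma> (orb x)"
      by (rule orthonormal_system_orbit) (use x bessel_vectorsI in auto)
    then show ?thesis using total_family_orbit[OF x] by (auto simp: orthonormal_basis_def)
  qed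
  show "(\<exists>g. orthonormal_system \<Gamma> (orb g)) \<and> \<not> (\<exists>g. total_family \<Gamma> (orb g))" if "D > 1"
  proof -
    have gt: "form_const < vol" using that form_const_pos by (simp add: D less_divide_eq)
    then obtain x where "norm x = 1" "nsq \<L> (coef (orb x) x) = (norm x)\<^sup>2" "x \<in> bessel_vectors"
      using unit_exists by auto
    then have "orthonormal_system \<Gamma> (orb x)" by (rule orthonormal_system_orbit)
    then show ?thesis using gt total_imp_vol_le by fastforce
  qed
qed

end

lemma countable_discrete:
  fixes S :: "'a::second_countable_topology set"
  assumes "discrete S" shows "countable S"
proof -
  obtain B :: "'a set set" where B: "countable B" "topological_basis B"
    using ex_countable_basis by blast
  have "\<exists>U\<in>B. U \<inter> S = {x}" if x: "x \<in> S" for x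
  proof -
    obtain T where T: "open T" "T \<inter> S = {x}"
      using assms x unfolding discrete_def isolated_in_def by blast
    then obtain U where "U \<in> B" "x \<in> U" "U \<subseteq> T"
      using topological_basisE[OF B(2) T(1), of x] by blast
    then show ?thesis using T(2) x by blast
  qed
  then obtain F where F: "\<And>x. x \<in> S \<Longrightarrow> F x \<in> B \<and> F x \<inter> S = {x}" by metis
  have "inj_on F S" by (rule inj_onI) (metis F singleton_inject)
  moreover have "countable (F ` S)" using F B(1) by (auto intro: countable_subset)
  ultimately show ?thesis by (rule countable_image_inj_on[rotated])
qed

theorem theorem1p1:
  fixes \<mu> :: "'g::{topological_group_add, t2_space, second_countable_topology} measure"
    and \<pi> :: "'g \<Rightarrow> 'h::complex_hilbert_space \<Rightarrow> 'h"
    and \<Gamma> :: "'g set"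
  assumes "locally_compact_space (euclidean :: 'g topology)"
    and "unimodular TYPE('g)"
    and "haar_measure \<mu>"
    and "separable_space (euclidean :: 'h topology)"
    and "discrete_series \<mu> \<pi>"
    and "lattice_subgroup \<mu> \<Gamma>"
    and "icc \<Gamma>"
  shows
    "(covolume \<mu> \<Gamma> * formal_dimension \<mu> \<pi> < 1 \<longrightarrow>
        (\<exists>g. parseval_frame \<Gamma> (\<lambda>\<gamma>. \<pi> \<gamma> g)) \<and>
        \<not> (\<exists>g. separating_vector (commutant (commutant (\<pi> ` \<Gamma>))) g) \<and>
        \<not> (\<exists>g. riesz_sequence \<Gamma> (\<lambda>\<gamma>. \<pi> \<gamma> g))) \<and>
     (covolume \<mu> \<Gamma> * formal_dimension \<mu> \<pi> = 1 \<longrightarrow>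
        (\<exists>g. orthonormal_basis \<Gamma> (\<lambda>\<gamma>. \<pi> \<gamma> g))) \<and>
     (covolume \<mu> \<Gamma> * formal_dimension \<mu> \<pi> > 1 \<longrightarrow>
        (\<exists>g. orthonormal_system \<Gamma> (\<lambda>\<gamma>. \<pi> \<gamma> g)) \<and>
        \<not> (\<exists>g. total_family \<Gamma> (\<lambda>\<gamma>. \<pi> \<gamma> g)))"
proof -
  \<comment> \<open>The domain chosen inside \<open>covolume\<close>, so that \<open>vol\<close> is
    the covolume by definition.\<close>
  define \<Omega> where "\<Omega> = (SOME \<Omega>. right_fundamental_domain \<mu> \<Gamma> \<Omega>)"
  have \<Omega>: "right_fundamental_domain \<mu> \<Gamma> \<Omega>"
    using assms(6) unfolding lattice_subgroup_def \<Omega>_def by (metis someI_ex)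
  have \<Gamma>: "is_subgroup \<Gamma>" "countable \<Gamma>"
    using assms(6) countable_discrete by (auto simp: lattice_subgroup_def)
  have sets: "sets \<mu> = sets borel"
    using assms(3) by (simp add: haar_measure_def radon_measure_def)
  then have space: "space \<mu> = UNIV" using sets_eq_imp_space_eq[of \<mu> borel] by simp
  have left: "emeasure \<mu> ((\<lambda>x. a + x) ` A) = emeasure \<mu> A" if "A \<in> sets borel" for a A
    using assms(3) that by (simp add: haar_measure_def)
  have right: "emeasure \<mu> ((\<lambda>x. x + a) ` A) = emeasure \<mu> A" if "A \<in> sets borel" for a A
    using assms(2,3) that by (simp add: unimodular_def)
  interpret lattice_rep \<mu> \<pi> \<Gamma> \<Omega>
  proof
    \<comment> \<open>Sigma-finiteness comes from the lattice: the countably many translates of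
      \<Omega> have finite measure and cover G.\<close>
    show "\<exists>A. countable A \<and> A \<subseteq> sets \<mu> \<and> \<Union> A = space \<mu> \<and> (\<forall>a\<in>A. emeasure \<mu> a \<noteq> \<infinity>)"
    proof -
      have "\<Omega> \<in> sets borel" "emeasure \<mu> \<Omega> < \<infinity>" "(\<Union>\<gamma>\<in>\<Gamma>. (\<lambda>x. x + \<gamma>) ` \<Omega>) = UNIV"
        using \<Omega> by (simp_all add: right_fundamental_domain_def)
      then show ?thesis
        unfolding sets space
        by (intro exI[of _ "(\<lambda>\<gamma>. (\<lambda>x. x + \<gamma>) ` \<Omega>) ` \<Gamma>"] conjI countable_image \<Gamma>(2))
           (auto simp: right less_top intro: borel_translate_right)
    qed
  qed (use assms left right sets \<Omega> \<Gamma> in \<open>auto simp: haar_measure_def discrete_series_def\<close>)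
  have "covolume \<mu> \<Gamma> = vol" unfolding vol_def by (simp add: covolume_def \<Omega>_def)
  then show ?thesis
    by (simp only:) (intro conjI impI; drule density_theorem; blast)
qed

end
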